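(* Let $n\ge2$, let $A$ be a proper non-empty subset of $\{1,\dots,n\}$ and $B=\{1,\dots,n\}\setminus A$. For each $i=1,\dots,n$ let $\Phi_i=\{\varphi_{i,k}\}_{k=-\infty}^{\infty}$ be a sequence of Blaschke products with no common non-constant inner factor (that is, for each $i$ no non-constant inner function divides $\varphi_{i,k}$ for every $k\in\mathbb{Z}$). Suppose $\Phi_i$ is increasing for all $i\in A$ and decreasing for all $i\in B$. Let $$\mathcal{Q}_{\bm{\Phi}}=\bigvee_{k=-\infty}^{\infty}\mathcal{Q}_{\varphi_{1,k}}\otimes\cdots\otimes\mathcal{Q}_{\varphi_{n,k}}\subseteq H^2(\mathbb{D}^n).$$ Then $$\operatorname{co-rank}\mathcal{Q}_{\bm{\Phi}}=\sup_{(\xi_1,\dots,\xi_n)\in\Lambda}\#\tilde{Z}(\xi_1,\dots,\xi_n).$$ Moreover, for all $(\xi_1,\dots,\xi_n)\in\Lambda$, writing $I(\xi_1,\dots,\xi_n)=\{k_0<k_1<\dots<k_m\}$, $$\#\tilde{Z}(\xi_1,\dots,\xi_n)=1+\#\{k_j\in I(\xi_1,\dots,\xi_n): k_j\neq k_m,\ P(\xi_i)|\eta_{i,k_j}\text{ for some }i\in B\}.$$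
   Context: $\mathbb{N}$ includes $0$. $H^2(\mathbb{D}^n)$ is the Hardy space over the open unit polydisc, identified with the $n$-fold Hilbert space tensor product $H^2(\mathbb{D})\otimes\cdots\otimes H^2(\mathbb{D})$; $M_{z_i}$ is multiplication by $z_i$. $\bigvee$ denotes closed linear span. A quotient module $\mathcal{Q}$ of $H^2(\mathbb{D}^n)$ is a closed subspace whose orthogonal complement is invariant under all $M_{z_i}$; thus $\mathcal{Q}$ is invariant under all $M_{z_i}^*$. For a commuting $n$-tuple $T=(T_1,\dots,T_n)$ of bounded operators on a separable Hilbert space $\mathcal{H}$ and $S\subseteq\mathcal{H}$, let $[S]_T=\bigvee\{p(T_1,\dots,T_n)h: p\in\mathbb{C}[z_1,\dots,z_n],\,h\in S\}$ (with $[\emptyset]_T=\{0\}$), and $\operatorname{rank}T=\inf\{\#S: S\subseteq\mathcal{H},\,[S]_T=\mathcal{H}\}\in\mathbb{N}\cup\{\infty\}$. For a quotient module, $\operatorname{co-rank}\mathcal{Q}=\operatorname{rank}(M_{z_1}^*|_{\mathcal{Q}},\dots,M_{z_n}^*|_{\mathcal{Q}})$. For an inner function $\varphi$ on $\mathbb{D}$, $\mathcal{Q}_\varphi=H^2(\mathbb{D})\ominus\varphi H^2(\mathbb{D})$. For $\alpha\in\mathbb{D}$, $b_\alpha(z)=\frac{z-\alpha}{1-\bar\alpha z}$. A Blaschke product is an inner function $\varphi=\prod_m b_{\alpha_m}^{l_m}$ (finite or countable product, with the factors multiplied by unimodular constants as needed for convergence), with distinct $\alpha_m\in\mathbb{D}$,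 integers $l_m\ge1$, and $\sum_m l_m(1-|\alpha_m|)<\infty$. For such $\varphi$ put $\mathcal{I}_\varphi=\{b_{\alpha_m}^{l_m}\}_m$, and for $\xi=b_{\alpha}^{l}$ with $l\ge1$ put $P(\xi)=b_\alpha$. Divisibility $|$ is divisibility among inner functions. $\operatorname{ord}(\varphi,b_\alpha)$ is the order of the zero of $\varphi$ at $\alpha$. A sequence $\{\varphi_{i,k}\}_k$ is increasing if $\varphi_{i,k}|\varphi_{i,k+1}$ for all $k$, and decreasing if $\varphi_{i,k+1}|\varphi_{i,k}$ for all $k$. Put $\Lambda_k=\mathcal{I}_{\varphi_{1,k}}\times\cdots\times\mathcal{I}_{\varphi_{n,k}}$ for $k\in\mathbb{Z}$ and $\Lambda=\bigcup_{k\in\mathbb{Z}}\Lambda_k$. For $(\xi_1,\dots,\xi_n)\in\Lambda$ put $l_{i,k}=\operatorname{ord}(\varphi_{i,k},P(\xi_i))$, $Z(\xi_1,\dots,\xi_n)=\{k\in\mathbb{Z}: P(\xi_i)|\varphi_{i,k}\text{ for all }i=1,\dots,n\}$ (a finite set under the hypotheses of the claim), and $$\mathcal{Q}(\xi_1,\dots,\xi_n)=\bigvee_{k\in Z(\xi_1,\dots,\xi_n)}\mathcal{Q}_{P(\xi_1)^{l_{1,k}}}\otimes\cdots\otimes\mathcal{Q}_{P(\xi_n)^{l_{n,k}}}.$$ $\tilde{Z}(\xi_1,\dots,\xi_n)$ denotes a subset of $Z(\xi_1,\dots,\xi_n)$ of minimal cardinality such that $\mathcal{Q}(\xi_1,\dots,\xi_n)=\bigvee_{k\in\tilde{Z}(\xi_1,\dots,\xi_n)}\mathcal{Q}_{P(\xi_1)^{l_{1,k}}}\otimes\cdots\otimes\mathcal{Q}_{P(\xi_n)^{l_{n,k}}}$.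 Suprema are taken in $\mathbb{N}\cup\{\infty\}$. For $i\in A$ and $k\in Z(\xi_1,\dots,\xi_n)$ put $\zeta_{i,k}=\varphi_{i,k}/\varphi_{i,k-1}$, and $$I(\xi_1,\dots,\xi_n)=\{k\in Z(\xi_1,\dots,\xi_n): P(\xi_i)|\zeta_{i,k}\text{ for some }i\in A\},$$ a finite set containing $\min Z(\xi_1,\dots,\xi_n)$; enumerate it as $k_0<k_1<\dots<k_m$ ($m\ge0$). For $i\in B$ and $0\le j\le m-1$ put $\eta_{i,k_j}=\varphi_{i,k_j}/\varphi_{i,k_{j+1}}$. *)

theory Defs
  imports
    "HOL-Complex_Analysis.Complex_Analysis"
    "HOL-Library.Extended_Nat"
    "HOL-Library.Poly_Mapping"
begin

section \<open>The Hilbert space of square-summable families\<close>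

typedef 'a ell2 = "{c :: 'a \<Rightarrow> complex. (\<lambda>x. (cmod (c x))\<^sup>2) summable_on UNIV}"
  morphisms ell2_coeff Abs_ell2
  by (rule exI[of _ "\<lambda>_. 0"]) simp

setup_lifting type_definition_ell2

lemma square_summable_add:
  fixes f g :: "'a \<Rightarrow> complex"
  assumes "(\<lambda>x. (cmod (f x))\<^sup>2) summable_on UNIV" "(\<lambda>x. (cmod (g x))\<^sup>2) summable_on UNIV"
  shows "(\<lambda>x. (cmod (f x + g x))\<^sup>2) summable_on UNIV"
proof (rule summable_on_comparison_test)
  show "(\<lambda>x. 2 * (cmod (f x))\<^sup>2 + 2 * (cmod (g x))\<^sup>2) summable_on UNIV"
    using assms by (intro summable_on_add summable_on_cmult_right)
  fix x
  have "(cmod (f x + g x))\<^sup>2 \<le> (cmod (f x) + cmod (g x))\<^sup>2"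
    by (intro power_mono norm_triangle_ineq) simp
  also have "\<dots> \<le> 2 * (cmod (f x))\<^sup>2 + 2 * (cmod (g x))\<^sup>2"
    using sum_squares_bound[of "cmod (f x)" "cmod (g x)"] by (simp add: power2_sum)
  finally show "(cmod (f x + g x))\<^sup>2 \<le> 2 * (cmod (f x))\<^sup>2 + 2 * (cmod (g x))\<^sup>2" .
qed simp

lemma square_summable_cmult:
  fixes f :: "'a \<Rightarrow> complex"
  assumes "(\<lambda>x. (cmod (f x))\<^sup>2) summable_on UNIV"
  shows "(\<lambda>x. (cmod (a * f x))\<^sup>2) summable_on UNIV"
  using summable_on_cmult_right[OF assms, of "(cmod a)\<^sup>2"]
  by (simp add: norm_mult power_mult_distrib)

lemma square_summable_inner:
  fixes f g :: "'a \<Rightarrow> complex"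
  assumes "(\<lambda>x. (cmod (f x))\<^sup>2) summable_on UNIV" "(\<lambda>x. (cmod (g x))\<^sup>2) summable_on UNIV"
  shows "(\<lambda>x. f x * cnj (g x)) summable_on UNIV"
proof (rule abs_summable_summable, rule summable_on_comparison_test)
  show "(\<lambda>x. (cmod (f x))\<^sup>2 + (cmod (g x))\<^sup>2) summable_on UNIV"
    using assms by (rule summable_on_add)
  fix x
  have "2 * cmod (f x) * cmod (g x) \<le> (cmod (f x))\<^sup>2 + (cmod (g x))\<^sup>2"
    by (rule sum_squares_bound)
  moreover have "0 \<le> cmod (f x) * cmod (g x)" by simp
  ultimately show "norm (f x * cnj (g x)) \<le> (cmod (f x))\<^sup>2 + (cmod (g x))\<^sup>2"
    unfolding norm_mult complex_mod_cnj by linarith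
qed simp

instantiation ell2 :: (type) ab_group_add
begin

lift_definition zero_ell2 :: "'a ell2" is "\<lambda>_. 0" by simp

lift_definition plus_ell2 :: "'a ell2 \<Rightarrow> 'a ell2 \<Rightarrow> 'a ell2" is "\<lambda>f g x. f x + g x"
  by (rule square_summable_add)

lift_definition uminus_ell2 :: "'a ell2 \<Rightarrow> 'a ell2" is "\<lambda>f x. - f x" by simp

lift_definition minus_ell2 :: "'a ell2 \<Rightarrow> 'a ell2 \<Rightarrow> 'a ell2" is "\<lambda>f g x. f x - g x"
  subgoal for f g using square_summable_add[of f "\<lambda>x. - g x"] by simp
  done

instance
  by standard (transfer; simp add: fun_eq_iff)+

end

lift_definition cscale :: "complex \<Rightarrow> 'a ell2 \<Rightarrow> 'a ell2" is "\<lambda>a f x. a * f x"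
  by (rule square_summable_cmult)

lift_definition cinner :: "'a ell2 \<Rightarrow> 'a ell2 \<Rightarrow> complex" is
  "\<lambda>f g. \<Sum>\<^sub>\<infinity>x. f x * cnj (g x)" .

global_interpretation ell2: vector_space cscale
  by standard (transfer; simp add: fun_eq_iff algebra_simps)+

lemma cinner_self: "cinner f f = complex_of_real (\<Sum>\<^sub>\<infinity>x. (cmod (ell2_coeff f x))\<^sup>2)"
proof -
  have "((\<lambda>x. (cmod (ell2_coeff f x))\<^sup>2) has_sum (\<Sum>\<^sub>\<infinity>x. (cmod (ell2_coeff f x))\<^sup>2)) UNIV"
    using ell2_coeff[of f] by (intro has_sum_infsum) simp
  then have "((\<lambda>x. complex_of_real ((cmod (ell2_coeff f x))\<^sup>2)) has_sum
      complex_of_real (\<Sum>\<^sub>\<infinity>x. (cmod (ell2_coeff f x))\<^sup>2)) UNIV"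
    by (subst has_sum_of_real_iff)
  then show ?thesis
    unfolding cinner.rep_eq complex_norm_square by (rule infsumI)
qed

instantiation ell2 :: (type) real_inner
begin

definition scaleR_ell2 :: "real \<Rightarrow> 'a ell2 \<Rightarrow> 'a ell2" where
  "scaleR_ell2 r = cscale (complex_of_real r)"

definition inner_ell2 :: "'a ell2 \<Rightarrow> 'a ell2 \<Rightarrow> real" where
  "inner_ell2 f g = Re (cinner f g)"

definition norm_ell2 :: "'a ell2 \<Rightarrow> real" where
  "norm_ell2 f = sqrt (inner f f)"

definition dist_ell2 :: "'a ell2 \<Rightarrow> 'a ell2 \<Rightarrow> real" where
  "dist_ell2 f g = norm (f - g)"

definition sgn_ell2 :: "'a ell2 \<Rightarrow> 'a ell2" where
  "sgn_ell2 f = inverse (norm f) *\<^sub>R f"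

definition uniformity_ell2 :: "('a ell2 \<times> 'a ell2) filter" where
  "uniformity_ell2 = (INF e\<in>{0<..}. principal {(x, y). dist x y < e})"

definition open_ell2 :: "'a ell2 set \<Rightarrow> bool" where
  "open_ell2 U \<longleftrightarrow> (\<forall>x\<in>U. eventually (\<lambda>(x', y). x' = x \<longrightarrow> y \<in> U) uniformity)"

instance
proof
  fix f g h :: "'a ell2" and r s :: real
  show "r *\<^sub>R (f + g) = r *\<^sub>R f + r *\<^sub>R g" "(r + s) *\<^sub>R f = r *\<^sub>R f + s *\<^sub>R f"
    "r *\<^sub>R s *\<^sub>R f = (r * s) *\<^sub>R f" "1 *\<^sub>R f = f"
    by (simp_all add: scaleR_ell2_def ell2.scale_right_distrib ell2.scale_left_distrib)
  have sm: "(\<lambda>x. ell2_coeff u x * cnj (ell2_coeff v x)) summable_on UNIV" for u v :: "'a ell2"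
    using ell2_coeff[of u] ell2_coeff[of v] by (intro square_summable_inner) auto
  have "cinner g f = cnj (cinner f g)"
    unfolding cinner.rep_eq infsum_cnj[symmetric] by (simp add: mult.commute)
  then show "inner f g = inner g f" by (simp add: inner_ell2_def)
  show "inner (f + g) h = inner f h + inner g h"
    by (simp add: inner_ell2_def cinner.rep_eq plus_ell2.rep_eq distrib_right infsum_add[OF sm sm])
  have "cinner (r *\<^sub>R f) g = of_real r * cinner f g"
    by (simp add: scaleR_ell2_def cinner.rep_eq cscale.rep_eq mult.assoc infsum_cmult_right')
  then show "inner (r *\<^sub>R f) g = r * inner f g" by (simp add: inner_ell2_def)
  show "0 \<le> inner f f"
    by (simp add: inner_ell2_def cinner_self infsum_nonneg)
  show "inner f f = 0 \<longleftrightarrow> f = 0"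
  proof
    assume "inner f f = 0"
    then have "(\<Sum>\<^sub>\<infinity>x. (cmod (ell2_coeff f x))\<^sup>2) = 0"
      by (simp add: inner_ell2_def cinner_self)
    then have "(cmod (ell2_coeff f x))\<^sup>2 = 0" for x
      using ell2_coeff[of f] by (intro nonneg_infsum_le_0D[where A = UNIV]) auto
    then show "f = 0" by transfer (simp add: fun_eq_iff)
  next
    assume "f = 0"
    then show "inner f f = 0" by (simp add: inner_ell2_def cinner_self zero_ell2.rep_eq)
  qed
qed (rule dist_ell2_def sgn_ell2_def uniformity_ell2_def open_ell2_def norm_ell2_def)+

end

definition closed_cspan :: "'a ell2 set \<Rightarrow> 'a ell2 set" where
  "closed_cspan S = closure (ell2.span S)"

definition cadjoint :: "('a ell2 \<Rightarrow> 'a ell2) \<Rightarrow> 'a ell2 \<Rightarrow> 'a ell2" where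
  "cadjoint T = (THE T'. \<forall>f g. cinner (T f) g = cinner f (T' g))"

section \<open>Rank of a commuting tuple of operators\<close>

text \<open>The monomial \<open>T\<^sub>1 ^ \<alpha>\<^sub>1 \<circ> \<dots> \<circ> T\<^sub>n ^ \<alpha>\<^sub>n\<close>; the fold is independent of the
  order of the indices because the tuple commutes.\<close>
definition tuple_power :: "('n::finite \<Rightarrow> 'h \<Rightarrow> 'h) \<Rightarrow> ('n \<Rightarrow> nat) \<Rightarrow> 'h \<Rightarrow> 'h" where
  "tuple_power T \<alpha> = Finite_Set.fold (\<lambda>i S. (T i ^^ \<alpha> i) \<circ> S) id UNIV"

text \<open>Polynomials in the variables indexed by \<open>'n\<close> are finitely supported families of
  coefficients indexed by the multi-exponents.\<close>
definition poly_apply ::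
  "('n::finite \<Rightarrow> 'a ell2 \<Rightarrow> 'a ell2) \<Rightarrow> (('n \<Rightarrow> nat) \<Rightarrow>\<^sub>0 complex) \<Rightarrow> 'a ell2 \<Rightarrow> 'a ell2" where
  "poly_apply T p h =
     (\<Sum>\<alpha>\<in>Poly_Mapping.keys p. cscale (Poly_Mapping.lookup p \<alpha>) (tuple_power T \<alpha> h))"

definition generated :: "('n::finite \<Rightarrow> 'a ell2 \<Rightarrow> 'a ell2) \<Rightarrow> 'a ell2 set \<Rightarrow> 'a ell2 set" where
  "generated T S = closed_cspan {poly_apply T p h | p h. h \<in> S}"

definition ecard :: "'b set \<Rightarrow> enat" where
  "ecard S = (if finite S then enat (card S) else \<infinity>)"

text \<open>The rank of the restriction of the tuple \<open>T\<close> to the closed invariant subspace \<open>H\<close>.\<close>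
definition tuple_rank :: "('n::finite \<Rightarrow> 'a ell2 \<Rightarrow> 'a ell2) \<Rightarrow> 'a ell2 set \<Rightarrow> enat" where
  "tuple_rank T H = (INF S \<in> {S. S \<subseteq> H \<and> generated T S = H}. ecard S)"

section \<open>Hardy spaces on the disc and on the polydisc\<close>

text \<open>An element of the Hardy space is given by its square-summable family of Taylor coefficients;
  the associated holomorphic function is obtained by evaluation.\<close>

type_synonym hardy_disc = "nat ell2"
type_synonym 'n hardy = "('n \<Rightarrow> nat) ell2"

definition disc_eval :: "hardy_disc \<Rightarrow> complex \<Rightarrow> complex" where
  "disc_eval f z = (\<Sum>\<^sub>\<infinity>k. ell2_coeff f k * z ^ k)"

definition polydisc :: "(complex ^ 'n) set" where
  "polydisc = {z. \<forall>i. z $ i \<in> ball 0 1}"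

definition hardy_eval :: "'n::finite hardy \<Rightarrow> complex ^ 'n \<Rightarrow> complex" where
  "hardy_eval f z = (\<Sum>\<^sub>\<infinity>\<alpha>. ell2_coeff f \<alpha> * (\<Prod>i\<in>UNIV. (z $ i) ^ \<alpha> i))"

text \<open>Multiplication by the \<open>i\<close>-th coordinate; evaluation on the polydisc determines an element of
  the Hardy space, and \<open>g\<close> has the shifted Taylor coefficients of \<open>f\<close>.\<close>
definition coord_mult :: "'n::finite \<Rightarrow> 'n hardy \<Rightarrow> 'n hardy" where
  "coord_mult i f = (THE g. \<forall>z\<in>polydisc. hardy_eval g z = z $ i * hardy_eval f z)"

definition co_rank :: "'n::finite hardy set \<Rightarrow> enat" where
  "co_rank Q = tuple_rank (\<lambda>i. cadjoint (coord_mult i)) Q"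

text \<open>The Hilbert space tensor product of closed subspaces of the one-variable Hardy space, where
  the elementary tensor of \<open>f\<^sub>1, \<dots>, f\<^sub>n\<close> is the function \<open>z \<mapsto> f\<^sub>1(z\<^sub>1) \<cdots> f\<^sub>n(z\<^sub>n)\<close>.\<close>
definition tensor_space :: "('n::finite \<Rightarrow> hardy_disc set) \<Rightarrow> 'n hardy set" where
  "tensor_space E = closed_cspan {h. \<exists>f. (\<forall>i. f i \<in> E i) \<and>
     (\<forall>z\<in>polydisc. hardy_eval h z = (\<Prod>i\<in>UNIV. disc_eval (f i) (z $ i)))}"

section \<open>Inner functions and Blaschke products\<close>

text \<open>Functions on the disc are represented by functions on \<open>\<complex>\<close> whose values outside the open unit
  disc are irrelevant.\<close>

definition inner_function :: "(complex \<Rightarrow> complex) \<Rightarrow> bool" where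
  "inner_function \<phi> \<longleftrightarrow> \<phi> holomorphic_on ball 0 1 \<and> bounded (\<phi> ` ball 0 1) \<and>
     (AE t in lborel. \<exists>w. cmod w = 1 \<and> ((\<lambda>r. \<phi> (complex_of_real r * cis t)) \<longlongrightarrow> w) (at_left 1))"

definition inner_dvd :: "(complex \<Rightarrow> complex) \<Rightarrow> (complex \<Rightarrow> complex) \<Rightarrow> bool" where
  "inner_dvd \<psi> \<phi> \<longleftrightarrow> (\<exists>\<theta>. inner_function \<theta> \<and> (\<forall>z\<in>ball 0 1. \<phi> z = \<psi> z * \<theta> z))"

text \<open>The quotient as an inner function: the pointwise quotient would be wrong at the zeros of
  \<open>\<psi>\<close>. It is determined on the disc.\<close>
definition inner_quot :: "(complex \<Rightarrow> complex) \<Rightarrow> (complex \<Rightarrow> complex) \<Rightarrow> complex \<Rightarrow> complex" where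
  "inner_quot \<phi> \<psi> = (SOME \<theta>. inner_function \<theta> \<and> (\<forall>z\<in>ball 0 1. \<phi> z = \<psi> z * \<theta> z))"

definition model_space :: "(complex \<Rightarrow> complex) \<Rightarrow> hardy_disc set" where
  "model_space \<phi> = {f. \<forall>g. (\<exists>h. \<forall>z\<in>ball 0 1. disc_eval g z = \<phi> z * disc_eval h z) \<longrightarrow> cinner f g = 0}"

definition blaschke_factor :: "complex \<Rightarrow> complex \<Rightarrow> complex" where
  "blaschke_factor \<alpha> z = (z - \<alpha>) / (1 - cnj \<alpha> * z)"

text \<open>\<open>\<phi> = \<Prod>\<^sub>m c\<^sub>m b(\<alpha>\<^sub>m)^(l\<^sub>m)\<close> over a finite or infinite set \<open>M\<close> of indices, for suitable unimodular
  constants \<open>c\<^sub>m\<close>; the empty product is allowed.\<close>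
definition blaschke_expansion ::
  "(complex \<Rightarrow> complex) \<Rightarrow> nat set \<Rightarrow> (nat \<Rightarrow> complex) \<Rightarrow> (nat \<Rightarrow> nat) \<Rightarrow> bool" where
  "blaschke_expansion \<phi> M \<alpha> l \<longleftrightarrow>
     inj_on \<alpha> M \<and> (\<forall>m\<in>M. \<alpha> m \<in> ball 0 1 \<and> 1 \<le> l m) \<and>
     (\<lambda>m. real (l m) * (1 - cmod (\<alpha> m))) summable_on M \<and>
     (\<exists>c. (\<forall>m\<in>M. cmod (c m) = 1) \<and>
       (\<forall>z\<in>ball 0 1. (\<lambda>N. \<Prod>m\<in>M \<inter> {..<N}. c m * blaschke_factor (\<alpha> m) z ^ l m) \<longlonglongrightarrow> \<phi> z))"

definition blaschke_product :: "(complex \<Rightarrow> complex) \<Rightarrow> bool" where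
  "blaschke_product \<phi> \<longleftrightarrow> inner_function \<phi> \<and> (\<exists>M \<alpha> l. blaschke_expansion \<phi> M \<alpha> l)"

definition blaschke_parts :: "(complex \<Rightarrow> complex) \<Rightarrow> (complex \<Rightarrow> complex) set" where
  "blaschke_parts \<phi> =
     {\<lambda>z. blaschke_factor (\<alpha> m) z ^ l m | M \<alpha> l m. blaschke_expansion \<phi> M \<alpha> l \<and> m \<in> M}"

definition prime_part :: "(complex \<Rightarrow> complex) \<Rightarrow> complex \<Rightarrow> complex" where
  "prime_part \<xi> = (THE b. \<exists>\<alpha>\<in>ball 0 1. \<exists>l\<ge>1.
     \<xi> = (\<lambda>z. blaschke_factor \<alpha> z ^ l) \<and> b = blaschke_factor \<alpha>)"

definition factor_order :: "(complex \<Rightarrow> complex) \<Rightarrow> (complex \<Rightarrow> complex) \<Rightarrow> nat" where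
  "factor_order \<phi> b = nat (zorder \<phi> (THE \<alpha>. \<alpha> \<in> ball 0 1 \<and> b = blaschke_factor \<alpha>))"

section \<open>The quotient module of a family of sequences of Blaschke products\<close>

context
  fixes \<phi> :: "'n::finite \<Rightarrow> int \<Rightarrow> complex \<Rightarrow> complex"
begin

definition Q_Phi :: "'n hardy set" where
  "Q_Phi = closed_cspan (\<Union>k. tensor_space (\<lambda>i. model_space (\<phi> i k)))"

definition Lambda :: "('n \<Rightarrow> complex \<Rightarrow> complex) set" where
  "Lambda = (\<Union>k. {\<xi>. \<forall>i. \<xi> i \<in> blaschke_parts (\<phi> i k)})"

definition Z_set :: "('n \<Rightarrow> complex \<Rightarrow> complex) \<Rightarrow> int set" where
  "Z_set \<xi> = {k. \<forall>i. inner_dvd (prime_part (\<xi> i)) (\<phi> i k)}"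

definition Q_join :: "('n \<Rightarrow> complex \<Rightarrow> complex) \<Rightarrow> int set \<Rightarrow> 'n hardy set" where
  "Q_join \<xi> K = closed_cspan (\<Union>k\<in>K. tensor_space (\<lambda>i. model_space
     (\<lambda>z. prime_part (\<xi> i) z ^ factor_order (\<phi> i k) (prime_part (\<xi> i)))))"

text \<open>A choice of a subset of minimal cardinality; \<open>Z_set \<xi>\<close> is finite when some of the sequences
  increase, the others decrease, and none has a common non-constant inner factor.\<close>
definition Z_tilde :: "('n \<Rightarrow> complex \<Rightarrow> complex) \<Rightarrow> int set" where
  "Z_tilde \<xi> = (ARG_MIN card K. K \<subseteq> Z_set \<xi> \<and> Q_join \<xi> (Z_set \<xi>) = Q_join \<xi> K)"

definition I_set :: "'n set \<Rightarrow> ('n \<Rightarrow> complex \<Rightarrow> complex) \<Rightarrow> int set" where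
  "I_set A \<xi> = {k \<in> Z_set \<xi>. \<exists>i\<in>A. inner_dvd (prime_part (\<xi> i)) (inner_quot (\<phi> i k) (\<phi> i (k - 1)))}"

end

end

theory Submission
  imports Defs
begin

text \<open>
The adjoints of the coordinate multiplications are the backward shifts of Taylor coefficients. Their
joint generalized eigenvectors are the vectors \<open>poly_jordan a \<beta>\<close>, for \<open>a\<close> in the polydisc and a
multi-index \<open>\<beta>\<close>; pairing with such a vector is taking the Taylor coefficient of order \<open>\<beta>\<close> at \<open>a\<close>,
and applying the \<open>i\<close>-th shift minus the conjugate of \<open>a\<^sub>i\<close> lowers \<open>\<beta>\<^sub>i\<close> by one. A function in the
Hardy space of the disc is divisible by a Blaschke product as soon as it vanishes to the right order at
its zeros, so the model space of a Blaschke product is the closed span of the corresponding Jordan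
vectors (\<open>model_space_eq\<close>). Closed spans pass through tensor products, hence the quotient module is the
closed span of the vectors \<open>poly_jordan a \<beta>\<close> for which \<open>\<beta>\<close> lies, for some \<open>k\<close>, in the box
\<open>\<Prod>\<^sub>i {0..<ord (\<phi> i k) a\<^sub>i}\<close> (\<open>Q_Phi_eq\<close>).

At a fixed point \<open>a\<close> the boxes form a finite union, and because Jordan vectors are independent, the sets
of indices that realize the whole join are those whose boxes cover this union. Every cover needs one box
for each maximal one. Along \<open>k\<close> the sides in \<open>A\<close> grow and the sides in \<open>B\<close> shrink; the maximal boxes
are those at the indices where a side in \<open>A\<close> has just grown and where some side in \<open>B\<close> shrinks before
the next such growth, or there is no next one. These indices, called peaks, are counted by the formula of
the theorem (\<open>card_minimal_cover\<close>, \<open>card_peaks\<close>).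

The co-rank is at least the number of peaks at each point (\<open>card_peaks_le_co_rank\<close>): for each peak there
is a function in the Hardy space, made from the Blaschke products with one factor removed, that is
orthogonal to all listed Jordan vectors except the one at the corner of the peak. These functions give
joint eigenfunctionals of the shifts on the quotient module with equal eigenvalues. With fewer generators
than peaks some nontrivial combination of them would vanish on all generators, hence on the whole module.

If the numbers of peaks have a finite supremum \<open>r\<close>, it bounds the co-rank (\<open>co_rank_le\<close>): only countably many
points carry boxes, so the corners at all these points can be distributed over \<open>r\<close> sequences with one
corner per point, and each sequence is generated by a single rapidly decreasing superposition
(\<open>cyclic_superposition\<close>), because polynomials in the shifts separate different points.
\<close>

section \<open>The Hilbert space structure of square-summable families\<close>

lemma cinner_summable: "(\<lambda>x. ell2_coeff f x * cnj (ell2_coeff g x)) summable_on UNIV"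
  using ell2_coeff[of f] ell2_coeff[of g] by (intro square_summable_inner) auto

lemma cinner_cnj: "cnj (cinner f g) = cinner g f"
  unfolding cinner.rep_eq infsum_cnj[symmetric] by (simp add: mult.commute)

lemma cinner_add_left: "cinner (f + g) h = cinner f h + cinner g h"
  by (simp add: cinner.rep_eq plus_ell2.rep_eq distrib_right
      infsum_add[OF cinner_summable cinner_summable])

lemma cinner_cscale_left: "cinner (cscale a f) g = a * cinner f g"
  by (simp add: cinner.rep_eq cscale.rep_eq mult.assoc infsum_cmult_right')

lemma cinner_add_right: "cinner h (f + g) = cinner h f + cinner h g"
  by (metis cinner_add_left cinner_cnj complex_cnj_add)

lemma cinner_cscale_right: "cinner f (cscale a g) = cnj a * cinner f g"
  by (metis cinner_cnj cinner_cscale_left complex_cnj_mult)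

lemma cscale_minus_one: "cscale (- 1) f = - f"
  by transfer (simp add: fun_eq_iff)

lemma cinner_minus_left: "cinner (- f) g = - cinner f g"
  using cinner_cscale_left[of "- 1" f g] by (simp add: cscale_minus_one)

lemma cinner_minus_right: "cinner f (- g) = - cinner f g"
  using cinner_cscale_right[of f "- 1" g] by (simp add: cscale_minus_one)

lemma cinner_diff_left: "cinner (f - g) h = cinner f h - cinner g h"
  using cinner_add_left[of f "- g" h] by (simp add: cinner_minus_left)

lemma cinner_diff_right: "cinner h (f - g) = cinner h f - cinner h g"
  using cinner_add_right[of h f "- g"] by (simp add: cinner_minus_right)

lemma cinner_zero_left [simp]: "cinner 0 f = 0"
  using cinner_diff_left[of 0 0 f] by simp

lemma cinner_zero_right [simp]: "cinner f 0 = 0"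
  using cinner_diff_right[of f 0 0] by simp

lemma norm_ell2_square: "(norm f)\<^sup>2 = (\<Sum>\<^sub>\<infinity>x. (cmod (ell2_coeff f x))\<^sup>2)"
  by (simp add: power2_norm_eq_inner inner_ell2_def cinner_self)

lemma cinner_self_norm: "cinner f f = complex_of_real ((norm f)\<^sup>2)"
  by (simp add: norm_ell2_square cinner_self)

lemma norm_cscale: "norm (cscale a f) = cmod a * norm f"
proof -
  have "(norm (cscale a f))\<^sup>2 = (cmod a * norm f)\<^sup>2"
    by (simp add: norm_ell2_square cscale.rep_eq norm_mult power_mult_distrib infsum_cmult_right')
  then show ?thesis by (simp add: power2_eq_iff_nonneg)
qed

lemma cmod_cinner_le: "cmod (cinner f g) \<le> norm f * norm g"
proof (cases "cinner f g = 0")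
  case False
  define a where "a = cnj (cinner f g) / of_real (cmod (cinner f g))"
  have a: "cmod a = 1" using False by (simp add: a_def norm_divide)
  have "cinner (cscale a f) g = of_real (cmod (cinner f g))"
    using False by (simp add: cinner_cscale_left a_def mult.commute complex_norm_square[symmetric]
        power2_eq_square)
  then have "cmod (cinner f g) = inner (cscale a f) g" by (simp add: inner_ell2_def)
  also have "\<dots> \<le> norm (cscale a f) * norm g" by (rule norm_cauchy_schwarz)
  finally show ?thesis by (simp add: norm_cscale a)
qed simp

lemma scaleR_cscale: "r *\<^sub>R f = cscale (complex_of_real r) f"
  by (simp add: scaleR_ell2_def)

lemma bounded_linear_cinner_left: "bounded_linear (\<lambda>f. cinner f g)"
  by (rule bounded_linear_intro[where K = "norm g"])
    (auto simp: cinner_add_left scaleR_cscale cinner_cscale_left scaleR_conv_of_real cmod_cinner_le)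

lemma bounded_linear_cinner_right: "bounded_linear (\<lambda>g. cinner f g)"
  by (rule bounded_linear_intro[where K = "norm f"])
    (use cmod_cinner_le[of f] in \<open>auto simp: cinner_add_right scaleR_cscale cinner_cscale_right
      scaleR_conv_of_real mult.commute\<close>)

lemma ell2_ext: "(\<And>x. ell2_coeff f x = ell2_coeff g x) \<Longrightarrow> f = g"
  by (simp add: ell2_coeff_inject[symmetric] fun_eq_iff)

lift_definition ell2_delta :: "'a \<Rightarrow> 'a ell2" is "\<lambda>x y. if y = x then 1 else 0"
proof -
  fix x :: 'a
  show "(\<lambda>y. (cmod (if y = x then 1 else 0))\<^sup>2) summable_on UNIV"
    by (subst summable_on_cong_neutral[where T = "{x}" and g = "\<lambda>_. 1"]) auto
qed

lemma cinner_delta_right: "cinner f (ell2_delta x) = ell2_coeff f x"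
proof -
  have "cinner f (ell2_delta x) = (\<Sum>\<^sub>\<infinity>y\<in>{x}. ell2_coeff f y)"
    unfolding cinner.rep_eq by (rule infsum_cong_neutral) (auto simp: ell2_delta.rep_eq)
  then show ?thesis by simp
qed

lemma norm_delta [simp]: "norm (ell2_delta x) = 1"
proof -
  have "complex_of_real ((norm (ell2_delta x))\<^sup>2) = 1"
    unfolding cinner_self_norm[symmetric] cinner_delta_right by (simp add: ell2_delta.rep_eq)
  then have "(norm (ell2_delta x))\<^sup>2 = 1" using of_real_eq_1_iff by blast
  then show ?thesis by (simp add: power2_eq_1_iff) (use norm_ge_zero[of "ell2_delta x"] in linarith)
qed

lemma cmod_coeff_le: "cmod (ell2_coeff f x) \<le> norm f"
  using cmod_cinner_le[of f "ell2_delta x"] by (simp add: cinner_delta_right)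

lemma ell2_of_bounded_sums:
  assumes "C \<ge> 0" and "\<And>F. finite F \<Longrightarrow> (\<Sum>x\<in>F. (cmod (c x))\<^sup>2) \<le> C\<^sup>2"
  obtains h where "ell2_coeff h = c" "norm h \<le> C"
proof -
  have sm: "(\<lambda>x. (cmod (c x))\<^sup>2) summable_on UNIV"
    using assms(2) by (intro nonneg_bdd_above_summable_on bdd_aboveI[where M = "C\<^sup>2"]) auto
  define h where "h = Abs_ell2 c"
  have h: "ell2_coeff h = c" using sm by (simp add: h_def Abs_ell2_inverse)
  have "(norm h)\<^sup>2 \<le> C\<^sup>2"
    unfolding norm_ell2_square h by (rule infsum_le_finite_sums[OF sm]) (use assms(2) in auto)
  then have "norm h \<le> C" using assms(1) by (simp add: power2_le_iff_abs_le)
  with h show thesis using that by blast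
qed

lemma finite_sum_coeff_le:
  assumes "finite F" shows "(\<Sum>x\<in>F. (cmod (ell2_coeff f x))\<^sup>2) \<le> (norm f)\<^sup>2"
  unfolding norm_ell2_square
  by (rule finite_sum_le_infsum) (use assms ell2_coeff[of f] in auto)

text \<open>Every finite partial sum of squares passes to the limit, so the bound survives.\<close>
lemma coefficientwise_limit:
  assumes "\<And>n. norm (X n) \<le> C" and "\<And>x. (\<lambda>n. ell2_coeff (X n) x) \<longlonglongrightarrow> c x"
  obtains h where "ell2_coeff h = c" "norm h \<le> C"
proof (rule ell2_of_bounded_sums)
  show "0 \<le> C" using norm_ge_zero[of "X 0"] assms(1)[of 0] by linarith
  fix F :: "'a set" assume F: "finite F"
  have "(\<lambda>n. \<Sum>x\<in>F. (cmod (ell2_coeff (X n) x))\<^sup>2) \<longlonglongrightarrow> (\<Sum>x\<in>F. (cmod (c x))\<^sup>2)"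
    by (intro tendsto_intros assms)
  moreover have "(\<Sum>x\<in>F. (cmod (ell2_coeff (X n) x))\<^sup>2) \<le> C\<^sup>2" for n
    using finite_sum_coeff_le[OF F, of "X n"] power_mono[OF assms(1) norm_ge_zero, of n 2] by linarith
  ultimately show "(\<Sum>x\<in>F. (cmod (c x))\<^sup>2) \<le> C\<^sup>2"
    by (intro LIMSEQ_le_const2) auto
qed (use that in auto)

text \<open>A Cauchy sequence has a coefficientwise limit; applying the previous lemma to its differences with
  one fixed far term shows that the limit is also one in norm.\<close>
instance ell2 :: (type) complete_space
proof
  fix X :: "nat \<Rightarrow> 'a ell2" assume X: "Cauchy X"
  have "Cauchy (\<lambda>n. ell2_coeff (X n) x)" for x
    using bounded_linear.Cauchy[OF bounded_linear_cinner_left X, of "ell2_delta x"]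
    by (simp add: cinner_delta_right)
  then have "\<forall>x. \<exists>l. (\<lambda>n. ell2_coeff (X n) x) \<longlonglongrightarrow> l"
    using Cauchy_convergent convergent_def by blast
  then obtain c where c: "\<And>x. (\<lambda>n. ell2_coeff (X n) x) \<longlonglongrightarrow> c x" by metis
  obtain C where C: "\<And>n. norm (X n) \<le> C"
    using cauchy_imp_bounded[OF X] by (auto simp: bounded_iff)
  obtain L where L: "ell2_coeff L = c" using coefficientwise_limit[OF C c] by blast
  have "X \<longlonglongrightarrow> L"
  proof (rule LIMSEQ_I)
    fix r :: real assume r: "r > 0"
    then obtain N where N: "\<And>m n. m \<ge> N \<Longrightarrow> n \<ge> N \<Longrightarrow> norm (X m - X n) < r / 2"
      using CauchyD[OF X, of "r / 2"] by auto
    have "norm (X n - L) < r" if n: "n \<ge> N" for n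
    proof -
      have "norm (X n - X (m + N)) \<le> r / 2" for m using N[OF n, of "m + N"] by simp
      moreover have "(\<lambda>m. ell2_coeff (X n - X (m + N)) x) \<longlonglongrightarrow> ell2_coeff (X n - L) x" for x
        using LIMSEQ_ignore_initial_segment[OF c[of x], of N]
        by (auto simp: minus_ell2.rep_eq L intro!: tendsto_intros)
      ultimately obtain h where "ell2_coeff h = ell2_coeff (X n - L)" "norm h \<le> r / 2"
        by (rule coefficientwise_limit)
      then show ?thesis using r by (simp add: ell2_coeff_inject)
    qed
    then show "\<exists>N. \<forall>n\<ge>N. norm (X n - L) < r" by blast
  qed
  then show "convergent X" by (auto simp: convergent_def)
qed

instance ell2 :: (type) banach ..

subsection \<open>Closed subspaces and orthogonal projection\<close>

definition closed_csubspace :: "'a ell2 set \<Rightarrow> bool" where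
  "closed_csubspace V \<longleftrightarrow> ell2.subspace V \<and> closed V"

definition bounded_clinear :: "('a ell2 \<Rightarrow> 'b ell2) \<Rightarrow> bool" where
  "bounded_clinear F \<longleftrightarrow> bounded_linear F \<and> (\<forall>a x. F (cscale a x) = cscale a (F x))"

lemma bounded_clinear_intro:
  assumes "\<And>x y. F (x + y) = F x + F y" "\<And>a x. F (cscale a x) = cscale a (F x)"
    and "\<And>x. norm (F x) \<le> norm x * K"
  shows "bounded_clinear F"
  unfolding bounded_clinear_def
  using assms by (auto intro!: bounded_linear_intro[where K = K] simp: scaleR_cscale)

lemma bounded_clinear_cscale: "bounded_clinear (cscale a)"
  by (rule bounded_clinear_intro[where K = "cmod a"])
    (auto simp: ell2.scale_right_distrib ell2.scale_scale mult.commute norm_cscale)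

lemma bounded_clinear_id: "bounded_clinear (\<lambda>x. x)"
  by (rule bounded_clinear_intro[where K = 1]) auto

lemma bounded_clinear_compose:
  "bounded_clinear F \<Longrightarrow> bounded_clinear G \<Longrightarrow> bounded_clinear (\<lambda>x. F (G x))"
  unfolding bounded_clinear_def by (auto intro: bounded_linear_compose)

lemma bounded_clinear_add:
  "bounded_clinear F \<Longrightarrow> bounded_clinear G \<Longrightarrow> bounded_clinear (\<lambda>x. F x + G x)"
  unfolding bounded_clinear_def by (auto intro: bounded_linear_add simp: ell2.scale_right_distrib)

lemma bounded_clinearD:
  assumes "bounded_clinear F"
  shows "bounded_linear F" "F (x + y) = F x + F y" "F (x - y) = F x - F y" "F 0 = 0" "F (- x) = - F x"
    "F (cscale a x) = cscale a (F x)"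
  using assms linear_add linear_diff linear_0 linear_neg
  unfolding bounded_clinear_def by (auto dest!: bounded_linear.linear)

lemma closed_csubspaceD:
  assumes "closed_csubspace V"
  shows "0 \<in> V" "x \<in> V \<Longrightarrow> y \<in> V \<Longrightarrow> x + y \<in> V" "x \<in> V \<Longrightarrow> y \<in> V \<Longrightarrow> x - y \<in> V"
    "x \<in> V \<Longrightarrow> cscale a x \<in> V" "closed V"
  using assms by (auto simp: closed_csubspace_def ell2.subspace_0 ell2.subspace_add
      ell2.subspace_diff ell2.subspace_scale)

lemma closed_csubspace_vimage:
  assumes "bounded_clinear F" "closed_csubspace V"
  shows "closed_csubspace {x. F x \<in> V}"
proof -
  have "closed (F -` V)"
    using assms bounded_clinearD(1)[OF assms(1)] closed_csubspaceD(5)[OF assms(2)]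
    by (intro continuous_closed_vimage) (auto intro: linear_continuous_at)
  then show ?thesis
    using bounded_clinearD[OF assms(1)] closed_csubspaceD[OF assms(2)]
    by (auto simp: closed_csubspace_def ell2.subspace_def vimage_def)
qed

lemma closed_csubspace_orth: "closed_csubspace {x. \<forall>g\<in>G. cinner x g = 0}"
proof -
  have "{x. \<forall>g\<in>G. cinner x g = 0} = (\<Inter>g\<in>G. (\<lambda>x. cinner x g) -` {0})" by auto
  moreover have "closed \<dots>"
    by (intro closed_INT ballI continuous_closed_vimage)
      (auto intro: linear_continuous_at bounded_linear_cinner_left)
  ultimately show ?thesis
    by (auto simp: closed_csubspace_def ell2.subspace_def cinner_add_left cinner_cscale_left)
qed

lemma closed_csubspace_Int:
  "closed_csubspace V \<Longrightarrow> closed_csubspace W \<Longrightarrow> closed_csubspace (V \<inter> W)"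
  by (auto simp: closed_csubspace_def ell2.subspace_inter)

lemma closed_csubspace_closed_cspan: "closed_csubspace (closed_cspan S)"
proof -
  let ?V = "ell2.span S"
  have "x + y \<in> closure ?V" if xy: "x \<in> closure ?V" "y \<in> closure ?V" for x y
  proof -
    obtain X Y where "\<And>n. X n \<in> ?V" "X \<longlonglongrightarrow> x" "\<And>n. Y n \<in> ?V" "Y \<longlonglongrightarrow> y"
      using xy unfolding closure_sequential by blast
    then have "\<And>n. X n + Y n \<in> ?V" "(\<lambda>n. X n + Y n) \<longlonglongrightarrow> x + y"
      by (auto intro: ell2.span_add tendsto_add)
    then show ?thesis unfolding closure_sequential by (intro exI[of _ "\<lambda>n. X n + Y n"]) simp
  qed
  moreover have "cscale a x \<in> closure ?V" if x: "x \<in> closure ?V" for a x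
  proof -
    obtain X where X: "\<And>n. X n \<in> ?V" "X \<longlonglongrightarrow> x"
      using x unfolding closure_sequential by blast
    have "\<And>n. cscale a (X n) \<in> ?V" using X(1) by (rule ell2.span_scale)
    moreover have "(\<lambda>n. cscale a (X n)) \<longlonglongrightarrow> cscale a x"
      by (rule bounded_linear.tendsto[OF bounded_clinearD(1)[OF bounded_clinear_cscale] X(2)])
    ultimately show ?thesis unfolding closure_sequential
      by (intro exI[of _ "\<lambda>n. cscale a (X n)"]) simp
  qed
  moreover have "0 \<in> closure ?V" using closure_subset ell2.span_zero by blast
  ultimately show ?thesis
    by (auto simp: closed_csubspace_def closed_cspan_def ell2.subspace_def)
qed

lemma closed_cspan_superset: "S \<subseteq> closed_cspan S"
  unfolding closed_cspan_def using ell2.span_superset closure_subset by blast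

lemma closed_cspan_minimal: "closed_csubspace V \<Longrightarrow> S \<subseteq> V \<Longrightarrow> closed_cspan S \<subseteq> V"
  unfolding closed_cspan_def closed_csubspace_def
  by (intro closure_minimal ell2.span_minimal) auto

lemma closed_cspan_mono: "S \<subseteq> S' \<Longrightarrow> closed_cspan S \<subseteq> closed_cspan S'"
  by (meson closed_cspan_minimal closed_cspan_superset closed_csubspace_closed_cspan order_trans)

lemma closed_cspan_eqI:
  "S \<subseteq> closed_cspan S' \<Longrightarrow> S' \<subseteq> closed_cspan S \<Longrightarrow> closed_cspan S = closed_cspan S'"
  by (simp add: closed_cspan_minimal closed_csubspace_closed_cspan subset_antisym)


lemma cinner_closed_cspan_zero:
  assumes "\<And>s. s \<in> S \<Longrightarrow> cinner s g = 0" "x \<in> closed_cspan S"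
  shows "cinner x g = 0"
  using closed_cspan_minimal[OF closed_csubspace_orth[of "{g}"], of S] assms by auto

text \<open>If the inner product did not vanish, moving \<open>w\<close> by a small multiple of \<open>v\<close> would shorten it.\<close>
lemma norm_minimal_imp_orth:
  assumes "\<And>a. norm w \<le> norm (w - cscale a v)"
  shows "cinner w v = 0"
proof (rule ccontr)
  define c where "c = cinner w v"
  \<comment> \<open>The gain is linear and the loss quadratic in \<open>t\<close>; this \<open>t\<close> keeps the loss below the gain.\<close>
  define t where "t = 1 / (1 + (norm v)\<^sup>2)"
  assume "cinner w v \<noteq> 0"
  then have c: "(cmod c)\<^sup>2 > 0" by (simp add: c_def)
  have t: "t > 0" "t * (norm v)\<^sup>2 < 1" by (auto simp: t_def field_simps add_pos_nonneg)
  let ?a = "of_real t * c"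
  have "inner w (cscale ?a v) = t * (cmod c)\<^sup>2"
  proof -
    have "cinner w (cscale ?a v) = of_real t * (cnj c * c)"
      by (simp add: cinner_cscale_right c_def mult_ac)
    also have "\<dots> = of_real (t * (cmod c)\<^sup>2)"
      by (simp only: of_real_mult complex_norm_square mult.commute)
    finally have "cinner w (cscale ?a v) = of_real (t * (cmod c)\<^sup>2)" .
    then show ?thesis unfolding inner_ell2_def by (metis Re_complex_of_real)
  qed
  moreover have "(norm (cscale ?a v))\<^sup>2 = t\<^sup>2 * (cmod c)\<^sup>2 * (norm v)\<^sup>2"
    by (simp add: norm_cscale norm_mult power_mult_distrib)
  moreover have "(norm (w - cscale ?a v))\<^sup>2 = (norm w)\<^sup>2 + (norm (cscale ?a v))\<^sup>2
      - 2 * inner w (cscale ?a v)"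
    by (simp add: power2_norm_eq_inner inner_diff_left inner_diff_right inner_commute)
  moreover have "(norm w)\<^sup>2 \<le> (norm (w - cscale ?a v))\<^sup>2"
    using assms[of ?a] by (intro power_mono) auto
  ultimately have "2 * (t * (cmod c)\<^sup>2) \<le> t\<^sup>2 * (cmod c)\<^sup>2 * (norm v)\<^sup>2" by linarith
  then have "(t * (cmod c)\<^sup>2) * 2 \<le> (t * (cmod c)\<^sup>2) * (t * (norm v)\<^sup>2)"
    by (simp add: power2_eq_square mult_ac)
  then have "2 \<le> t * (norm v)\<^sup>2" using t c by simp
  with t show False by linarith
qed

text \<open>By the parallelogram law a sequence minimizing the distance to \<open>f\<close> is Cauchy.\<close>
lemma orthogonal_decomposition:
  assumes V: "closed_csubspace V"
  obtains p where "p \<in> V" "\<And>v. v \<in> V \<Longrightarrow> cinner (f - p) v = 0"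
proof -
  define D where "D = (\<lambda>v. norm (f - v)) ` V"
  define d where "d = Inf D"
  have D0: "D \<noteq> {}" "bdd_below D"
    using closed_csubspaceD(1)[OF V] by (auto simp: D_def intro!: bdd_belowI[where m = 0])
  have dle: "d \<le> norm (f - v)" if "v \<in> V" for v
    unfolding d_def by (rule cInf_lower) (use that D0 in \<open>auto simp: D_def\<close>)
  have d0: "d \<ge> 0" unfolding d_def by (rule cInf_greatest[OF D0(1)]) (auto simp: D_def)
  have "\<exists>v\<in>V. norm (f - v) < d + 1 / real (Suc n)" for n
  proof -
    have "Inf D < d + 1 / real (Suc n)" by (simp add: d_def)
    then show ?thesis using cInf_lessD[OF D0(1)] by (auto simp: D_def)
  qed
  then obtain v where v: "\<And>n. v n \<in> V" "\<And>n. norm (f - v n) < d + 1 / real (Suc n)" by metis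
  have lim: "(\<lambda>n. norm (f - v n)) \<longlonglongrightarrow> d"
  proof (rule tendsto_sandwich[where f = "\<lambda>_. d" and h = "\<lambda>n. d + 1 / real (Suc n)"])
    show "(\<lambda>n. d + 1 / real (Suc n)) \<longlonglongrightarrow> d"
      using tendsto_add[OF tendsto_const LIMSEQ_Suc[OF lim_1_over_n[where 'a = real]], of d] by simp
    show "(\<lambda>n. d) \<longlonglongrightarrow> d" by simp
    show "\<forall>\<^sub>F n in sequentially. d \<le> norm (f - v n)" using v(1) dle by simp
    show "\<forall>\<^sub>F n in sequentially. norm (f - v n) \<le> d + 1 / real (Suc n)"
      using less_imp_le[OF v(2)] by simp
  qed
  have par: "(norm (v m - v n))\<^sup>2 \<le> 2 * ((norm (f - v m))\<^sup>2 - d\<^sup>2) + 2 * ((norm (f - v n))\<^sup>2 - d\<^sup>2)" for m n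
  proof -
    define w where "w = (1/2) *\<^sub>R (v m + v n)"
    have "w \<in> V"
      unfolding w_def scaleR_cscale by (intro closed_csubspaceD(2,4)[OF V] v)
    then have "d\<^sup>2 \<le> (norm (f - w))\<^sup>2" by (intro power_mono dle d0)
    moreover have "(norm (v m - v n))\<^sup>2 = 2 * (norm (f - v m))\<^sup>2 + 2 * (norm (f - v n))\<^sup>2
        - 4 * (norm (f - w))\<^sup>2"
      by (simp add: w_def power2_norm_eq_inner inner_diff_left inner_diff_right inner_add_left
          inner_add_right inner_commute algebra_simps)
    moreover have aux: "x \<le> 2 * (a - e) + 2 * (b - e)" if "e \<le> c" "x = 2 * a + 2 * b - 4 * c"
      for x a b c e :: real using that by simp
    ultimately show ?thesis by (intro aux)
  qed
  have "Cauchy v"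
  proof (rule CauchyI)
    fix e :: real assume e: "e > 0"
    have "(\<lambda>n. (norm (f - v n))\<^sup>2 - d\<^sup>2) \<longlonglongrightarrow> d\<^sup>2 - d\<^sup>2" by (intro tendsto_intros lim)
    then obtain N where N: "\<And>n. n \<ge> N \<Longrightarrow> \<bar>(norm (f - v n))\<^sup>2 - d\<^sup>2\<bar> < e\<^sup>2 / 4"
      using LIMSEQ_D[of _ 0 "e\<^sup>2 / 4"] e by force
    have "norm (v m - v n) < e" if "m \<ge> N" "n \<ge> N" for m n
    proof -
      have less: "x < z" if "x \<le> 2 * a + 2 * b" "\<bar>a\<bar> < z / 4" "\<bar>b\<bar> < z / 4" for x z a b :: real
        using that by linarith
      have "(norm (v m - v n))\<^sup>2 < e\<^sup>2"
        by (rule less[OF par N[OF that(1)] N[OF that(2)]])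
      then show ?thesis using e by (auto intro: power_less_imp_less_base)
    qed
    then show "\<exists>M. \<forall>m\<ge>M. \<forall>n\<ge>M. norm (v m - v n) < e" by blast
  qed
  then obtain p where p: "v \<longlonglongrightarrow> p" using Cauchy_convergent convergent_def by blast
  have pV: "p \<in> V" using closed_sequentially[OF closed_csubspaceD(5)[OF V] _ p] v(1) by blast
  have "(\<lambda>n. norm (f - v n)) \<longlonglongrightarrow> norm (f - p)" by (intro tendsto_intros p)
  then have fp: "norm (f - p) = d" using lim LIMSEQ_unique by blast
  show thesis
  proof (rule that[OF pV])
    fix u assume u: "u \<in> V"
    show "cinner (f - p) u = 0"
    proof (rule norm_minimal_imp_orth)
      fix a
      have "p + cscale a u \<in> V" using pV u closed_csubspaceD[OF V] by blast
      from dle[OF this] show "norm (f - p) \<le> norm (f - p - cscale a u)"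
        by (simp add: fp diff_diff_eq)
    qed
  qed
qed

lemma closed_cspan_eq_UNIV:
  assumes "\<And>f. (\<And>s. s \<in> S \<Longrightarrow> cinner f s = 0) \<Longrightarrow> f = 0"
  shows "closed_cspan S = UNIV"
proof -
  have "f \<in> closed_cspan S" for f
  proof -
    obtain p where p: "p \<in> closed_cspan S" "\<And>v. v \<in> closed_cspan S \<Longrightarrow> cinner (f - p) v = 0"
      using orthogonal_decomposition[OF closed_csubspace_closed_cspan] by blast
    then have "f - p = 0" using closed_cspan_superset by (intro assms) blast
    then show ?thesis using p by simp
  qed
  then show ?thesis by blast
qed

lemma closed_cspan_delta: "closed_cspan (range ell2_delta) = UNIV"
proof (rule closed_cspan_eq_UNIV, rule ell2_ext)
  fix f :: "'a ell2" and x
  assume "\<And>s. s \<in> range ell2_delta \<Longrightarrow> cinner f s = 0"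
  then show "ell2_coeff f x = ell2_coeff 0 x"
    using cinner_delta_right[of f x] by (simp add: zero_ell2.rep_eq)
qed

text \<open>Since the sequence is bounded, the vectors against which it converges form a closed subspace, and
  this subspace contains the coordinate vectors.\<close>
lemma bounded_coefficientwise_imp_weak:
  assumes C: "\<And>n. norm (X n) \<le> C" and c: "\<And>x. (\<lambda>n. ell2_coeff (X n) x) \<longlonglongrightarrow> ell2_coeff h x"
  shows "(\<lambda>n. cinner (X n) g) \<longlonglongrightarrow> cinner h g"
proof -
  let ?V = "{g. (\<lambda>n. cinner (X n) g) \<longlonglongrightarrow> cinner h g}"
  have C0: "C \<ge> 0" using norm_ge_zero[of "X 0"] C[of 0] by linarith
  have "closed ?V"
  proof (unfold closed_sequential_limits, intro allI impI, elim conjE)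
    fix G g assume G: "\<forall>n. G n \<in> ?V" "G \<longlonglongrightarrow> g"
    have "(\<lambda>n. cinner (X n) g) \<longlonglongrightarrow> cinner h g"
    proof (rule LIMSEQ_I)
      fix r :: real assume r: "r > 0"
      define e where "e = r / (2 * (C + norm h + 1))"
      have Cp: "C + norm h + 1 > 0" using C0 by (simp add: add_nonneg_pos)
      have e: "e > 0" using r Cp by (simp add: e_def)
      have eC: "e * (C + norm h) < r / 2"
      proof -
        have "e * (C + norm h) < e * (C + norm h + 1)" using e by simp
        also have "\<dots> = r / 2" using Cp by (simp add: e_def field_simps)
        finally show ?thesis .
      qed
      obtain k where k: "norm (g - G k) < e"
        using LIMSEQ_D[OF G(2) e] by (auto simp: norm_minus_commute)
      obtain N where N: "\<And>n. n \<ge> N \<Longrightarrow> norm (cinner (X n) (G k) - cinner h (G k)) < r / 2"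
        using LIMSEQ_D[of "\<lambda>n. cinner (X n) (G k)" "cinner h (G k)" "r / 2"] G(1) r by auto
      have "norm (cinner (X n) g - cinner h g) < r" if n: "n \<ge> N" for n
      proof -
        have "cinner (X n) g - cinner h g = (cinner (X n) (G k) - cinner h (G k)) +
            cinner (X n - h) (g - G k)"
          by (simp add: cinner_diff_left cinner_diff_right)
        then have "norm (cinner (X n) g - cinner h g) \<le>
            norm (cinner (X n) (G k) - cinner h (G k)) + norm (cinner (X n - h) (g - G k))"
          by (metis norm_triangle_ineq)
        moreover have "norm (cinner (X n - h) (g - G k)) \<le> (C + norm h) * e"
        proof -
          have "norm (cinner (X n - h) (g - G k)) \<le> norm (X n - h) * norm (g - G k)"
            by (rule cmod_cinner_le)
          also have "\<dots> \<le> (C + norm h) * e"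
            using k C[of n] C0 norm_triangle_ineq4[of "X n" h] by (intro mult_mono) auto
          finally show ?thesis .
        qed
        ultimately show ?thesis using N[OF n] eC by (simp add: mult.commute)
      qed
      then show "\<exists>N. \<forall>n\<ge>N. norm (cinner (X n) g - cinner h g) < r" by blast
    qed
    then show "g \<in> ?V" by simp
  qed
  then have "closed_csubspace ?V"
    by (auto simp: closed_csubspace_def ell2.subspace_def cinner_add_right cinner_cscale_right
        intro: tendsto_intros)
  moreover have "range ell2_delta \<subseteq> ?V" using c by (auto simp: cinner_delta_right)
  ultimately have "closed_cspan (range ell2_delta) \<subseteq> ?V" by (rule closed_cspan_minimal)
  then show ?thesis unfolding closed_cspan_delta by auto
qed

text \<open>The coefficients lie in a countable product of discs, which is compact and metrizable.\<close>
lemma weakly_convergent_subsequence: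
  fixes X :: "nat \<Rightarrow> 'a::countable ell2"
  assumes C: "\<And>n. norm (X n) \<le> C"
  obtains r :: "nat \<Rightarrow> nat" and h where "strict_mono r" "norm h \<le> C"
    "\<And>g. (\<lambda>n. cinner (X (r n)) g) \<longlonglongrightarrow> cinner h g"
proof -
  define K where "K = PiE (UNIV :: 'a set) (\<lambda>_. cball (0::complex) C)"
  have "compactin (product_topology (\<lambda>_::'a. euclidean) UNIV) K"
    unfolding K_def compactin_PiE by (auto simp: compactin_euclidean_iff)
  then have "compact K" unfolding euclidean_product_topology compactin_euclidean_iff .
  then have "seq_compact K" using compact_eq_seq_compact_metric by blast
  moreover have "\<forall>n. ell2_coeff (X n) \<in> K"
    using order_trans[OF cmod_coeff_le C] by (auto simp: K_def)
  ultimately obtain c r where r: "strict_mono r" "((\<lambda>n. ell2_coeff (X n)) \<circ> r) \<longlonglongrightarrow> c"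
    unfolding seq_compact_def by metis
  have "(\<lambda>n. ell2_coeff (X (r n)) x) \<longlonglongrightarrow> c x" for x
  proof -
    have "continuous_on UNIV (\<lambda>f::'a \<Rightarrow> complex. f x)" by simp
    then have "isCont (\<lambda>f::'a \<Rightarrow> complex. f x) c" using continuous_on_eq_continuous_at[OF open_UNIV] by blast
    from isCont_tendsto_compose[OF this r(2)] show ?thesis by (simp add: o_def)
  qed
  moreover obtain h where "ell2_coeff h = c" "norm h \<le> C"
    using coefficientwise_limit[of "\<lambda>n. X (r n)" C c] C calculation by blast
  ultimately show thesis
    using that[OF r(1), of h] bounded_coefficientwise_imp_weak[of "\<lambda>n. X (r n)" C h] C by auto
qed

text \<open>The solution is the Neumann series \<open>\<Sum>\<^sub>n a ^ n F ^ n f\<close>, which is dominated by a geometric series.\<close>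
lemma neumann_solution:
  assumes F: "bounded_clinear F" "\<And>x. norm (F x) \<le> norm x" and a: "cmod a < 1"
  obtains u where "u - cscale a (F u) = f"
proof -
  define X where "X n = cscale (a ^ n) ((F ^^ n) f)" for n
  have Fn: "norm ((F ^^ n) f) \<le> norm f" for n
    by (induction n) (auto intro: order_trans[OF F(2)])
  have Xn: "norm (X n) \<le> cmod a ^ n * norm f" for n
    unfolding X_def norm_cscale norm_power by (intro mult_left_mono Fn) auto
  have "summable (\<lambda>n. cmod a ^ n * norm f)"
    by (intro summable_mult2 summable_geometric) (use a in simp)
  then have sX: "summable X" by (rule summable_comparison_test[rotated]) (use Xn in blast)
  have G: "bounded_clinear (\<lambda>x. cscale a (F x))"
    by (intro bounded_clinear_compose[OF bounded_clinear_cscale] F)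
  have XS: "X (Suc n) = cscale a (F (X n))" for n
    by (simp add: X_def bounded_clinearD(6)[OF F(1)] mult.commute)
  have "cscale a (F (suminf X)) = suminf (\<lambda>n. X (Suc n))"
    unfolding XS by (rule bounded_linear.suminf[OF bounded_clinearD(1)[OF G] sX])
  also have "\<dots> = suminf X - X 0" by (rule suminf_split_head[OF sX])
  finally have "suminf X - cscale a (F (suminf X)) = f" by (simp add: X_def)
  then show thesis using that by blast
qed

section \<open>Rank of commuting tuples\<close>

locale commuting_tuple =
  fixes T :: "'n::finite \<Rightarrow> 'a ell2 \<Rightarrow> 'a ell2"
  assumes bounded: "\<And>i. bounded_clinear (T i)"
    and commute: "\<And>i j x. T i (T j x) = T j (T i x)"
begin

lemma funpow_commute: "(T i ^^ a) ((T j ^^ b) x) = (T j ^^ b) ((T i ^^ a) x)"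
proof -
  have 1: "T i ((T j ^^ b) x) = (T j ^^ b) (T i x)" for x
    by (induction b) (simp, metis commute comp_apply funpow.simps(2))
  show ?thesis by (induction a) (auto simp: 1)
qed

lemma comp_fun_commute_powers: "comp_fun_commute_on UNIV (\<lambda>i S. (T i ^^ \<alpha> i) \<circ> S)"
  by standard (auto simp: fun_eq_iff funpow_commute)

lemma tuple_power_remove:
  "tuple_power T \<alpha> = (T i ^^ \<alpha> i) \<circ> Finite_Set.fold (\<lambda>i S. (T i ^^ \<alpha> i) \<circ> S) id (UNIV - {i})"
  using comp_fun_commute_on.fold_insert_remove[OF comp_fun_commute_powers, of i UNIV \<alpha> id]
  by (simp add: tuple_power_def)

lemma tuple_power_Suc: "T i (tuple_power T \<alpha> h) = tuple_power T (\<alpha>(i := Suc (\<alpha> i))) h"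
proof -
  have "Finite_Set.fold (\<lambda>j S. (T j ^^ (\<alpha>(i := Suc (\<alpha> i))) j) \<circ> S) id (UNIV - {i})
      = Finite_Set.fold (\<lambda>j S. (T j ^^ \<alpha> j) \<circ> S) id (UNIV - {i})"
    by (rule Finite_Set.fold_cong[of UNIV])
      (auto intro: comp_fun_commute_powers)
  then show ?thesis
    by (simp add: tuple_power_remove[of _ i] del: fun_upd_apply) simp
qed

lemma tuple_power_zero: "tuple_power T (\<lambda>_. 0) h = h"
proof -
  have "Finite_Set.fold (\<lambda>i S. (T i ^^ 0) \<circ> S) id A = id" if "finite A" for A
    using that
    by (induction A rule: finite_induct)
      (simp_all add: comp_fun_commute_on.fold_insert[OF comp_fun_commute_powers[of "\<lambda>_. 0"], simplified])
  from this[OF finite] show ?thesis by (simp add: tuple_power_def)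
qed

lemma tuple_power_in_invariant:
  assumes "\<And>i x. x \<in> W \<Longrightarrow> T i x \<in> W" "h \<in> W"
  shows "tuple_power T \<alpha> h \<in> W"
proof -
  have pow: "(T i ^^ k) x \<in> W" if "x \<in> W" for i k x
    using that by (induction k) (auto intro: assms(1))
  have "Finite_Set.fold (\<lambda>i S. (T i ^^ \<alpha> i) \<circ> S) id A h \<in> W" if "finite A" for A
    using that
  proof (induction A rule: finite_induct)
    case (insert i A)
    show ?case
      unfolding comp_fun_commute_on.fold_insert[OF comp_fun_commute_powers subset_UNIV insert.hyps]
      unfolding comp_def[of "T i ^^ \<alpha> i"]
      by (rule pow) (rule insert.IH)
  qed (simp add: assms(2))
  from this[OF finite] show ?thesis by (simp add: tuple_power_def)
qed

text \<open>Together with the lemmas up to \<open>generated_invariant\<close> this characterizes the generated subspace as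
  the least closed invariant subspace containing \<open>S\<close>, so that
  families of polynomial coefficients do not occur again.\<close>
lemma generated_minimal:
  assumes W: "closed_csubspace W" "\<And>i x. x \<in> W \<Longrightarrow> T i x \<in> W" and "S \<subseteq> W"
  shows "generated T S \<subseteq> W"
  unfolding generated_def
proof (rule closed_cspan_minimal[OF W(1)], safe)
  fix p h assume "h \<in> S"
  then have "tuple_power T \<alpha> h \<in> W" for \<alpha> using assms by (intro tuple_power_in_invariant) auto
  then show "poly_apply T p h \<in> W"
    unfolding poly_apply_def using W(1)[unfolded closed_csubspace_def]
    by (intro ell2.subspace_sum ell2.subspace_scale) auto
qed

lemma tuple_power_in_generated:
  assumes "h \<in> S" shows "tuple_power T \<alpha> h \<in> generated T S"
proof -
  have "tuple_power T \<alpha> h = poly_apply T (Poly_Mapping.single \<alpha> 1) h"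
    by (simp add: poly_apply_def)
  then have "tuple_power T \<alpha> h \<in> {poly_apply T p h | p h. h \<in> S}" using assms unfolding mem_Collect_eq
    by (intro exI[of _ "Poly_Mapping.single \<alpha> 1"] exI[of _ h] conjI)
  then show ?thesis unfolding generated_def by (rule subsetD[OF closed_cspan_superset])
qed

lemma generated_superset: "S \<subseteq> generated T S"
  using tuple_power_in_generated[of _ S "\<lambda>_. 0"] by (auto simp: tuple_power_zero)

lemma closed_csubspace_generated: "closed_csubspace (generated T S)"
  by (simp add: generated_def closed_csubspace_closed_cspan)

lemma generated_invariant:
  assumes "x \<in> generated T S" shows "T i x \<in> generated T S"
proof -
  have "T i (poly_apply T p h) \<in> generated T S" if "h \<in> S" for p h
  proof -
    have "T i (poly_apply T p h) = (\<Sum>\<alpha>\<in>Poly_Mapping.keys p.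
        cscale (Poly_Mapping.lookup p \<alpha>) (tuple_power T (\<alpha>(i := Suc (\<alpha> i))) h))"
      unfolding poly_apply_def
      using bounded_clinearD(1,6)[OF bounded, of i]
      by (simp add: linear_sum bounded_linear.linear tuple_power_Suc)
    then show ?thesis
      using that closed_csubspace_generated[of S] tuple_power_in_generated
      by (auto simp: closed_csubspace_def intro!: ell2.subspace_sum ell2.subspace_scale)
  qed
  then have "closed_cspan {poly_apply T p h | p h. h \<in> S} \<subseteq> {x. T i x \<in> generated T S}"
    by (intro closed_cspan_minimal closed_csubspace_vimage bounded closed_csubspace_generated) auto
  then show ?thesis using assms by (auto simp: generated_def)
qed

text \<open>Generating the polynomials in the tuple as operators turns products into compositions, and lets
  their properties follow by induction from those of the tuple.\<close>

inductive polynomial_op :: "('a ell2 \<Rightarrow> 'a ell2) \<Rightarrow> bool" where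
  ident: "polynomial_op (\<lambda>x. x)"
| coord: "polynomial_op (T i)"
| scale: "polynomial_op R \<Longrightarrow> polynomial_op (\<lambda>x. cscale a (R x))"
| add: "polynomial_op R \<Longrightarrow> polynomial_op R' \<Longrightarrow> polynomial_op (\<lambda>x. R x + R' x)"
| comp: "polynomial_op R \<Longrightarrow> polynomial_op R' \<Longrightarrow> polynomial_op (\<lambda>x. R (R' x))"

lemma polynomial_op_bounded: "polynomial_op R \<Longrightarrow> bounded_clinear R"
  by (induction rule: polynomial_op.induct)
    (auto intro: bounded_clinear_id bounded bounded_clinear_add bounded_clinear_compose
      bounded_clinear_cscale)

lemma polynomial_op_commute_coord: "polynomial_op R \<Longrightarrow> R (T i x) = T i (R x)"
  by (induction arbitrary: x rule: polynomial_op.induct)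
    (auto simp: commute bounded_clinearD[OF bounded])

lemma polynomial_op_commute:
  assumes "polynomial_op R" "polynomial_op R'" shows "R (R' x) = R' (R x)"
  using assms(1)
  by (induction arbitrary: x rule: polynomial_op.induct)
    (auto simp: polynomial_op_commute_coord[OF assms(2)]
      bounded_clinearD[OF polynomial_op_bounded[OF assms(2)]])

lemma polynomial_op_invariant:
  assumes "polynomial_op R" "closed_csubspace W" "\<And>i x. x \<in> W \<Longrightarrow> T i x \<in> W" "x \<in> W"
  shows "R x \<in> W"
  using assms(1,4)
  by (induction arbitrary: x rule: polynomial_op.induct)
    (auto intro: assms(3) closed_csubspaceD[OF assms(2)])

lemma polynomial_op_diff:
  "polynomial_op R \<Longrightarrow> polynomial_op R' \<Longrightarrow> polynomial_op (\<lambda>x. R x - R' x)"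
  using polynomial_op.add[OF _ polynomial_op.scale[of R' "- 1"], of R]
  unfolding cscale_minus_one by simp

lemma polynomial_op_funpow: "polynomial_op R \<Longrightarrow> polynomial_op (R ^^ n)"
proof (induction n)
  case 0 then show ?case using polynomial_op.ident by (simp add: id_def)
next
  case (Suc n)
  then show ?case using polynomial_op.comp[of R "R ^^ n"] by (simp add: o_def)
qed

lemma funpow_cscale:
  assumes "polynomial_op R"
  shows "((\<lambda>x. cscale k (R x)) ^^ n) x = cscale (k ^ n) ((R ^^ n) x)"
  by (induction n) (auto simp: bounded_clinearD(6)[OF polynomial_op_bounded[OF assms]] mult.commute)

text \<open>With \<open>N = (A - a) / (b - a)\<close> the vector \<open>v\<close> is annihilated by \<open>N ^ L\<close> and \<open>w\<close> by
  \<open>(1 - N) ^ L'\<close>. Hence \<open>(1 - N ^ L) ^ L'\<close> fixes \<open>v\<close>, and it kills \<open>w\<close> because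
  \<open>1 - N ^ L\<close> is a multiple of \<open>1 - N\<close>.\<close>
lemma isolating_operator:
  assumes A: "polynomial_op A" and ab: "a \<noteq> b"
    and v: "((\<lambda>x. A x - cscale a x) ^^ L) v = 0" and w: "((\<lambda>x. A x - cscale b x) ^^ L') w = 0"
  obtains R where "polynomial_op R" "R v = v" "R w = 0"
proof -
  define N where "N x = cscale (1 / (b - a)) (A x - cscale a x)" for x
  define M where "M x = cscale (1 / (a - b)) (A x - cscale b x)" for x
  have sh: "polynomial_op (\<lambda>x. A x - cscale c x)" for c
    by (intro polynomial_op_diff A polynomial_op.scale[OF polynomial_op.ident])
  have N: "polynomial_op N" and M: "polynomial_op M"
    unfolding N_def M_def by (intro polynomial_op.scale sh)+
  have MN: "x - N x = M x" for x
  proof (rule ell2_ext)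
    fix y show "ell2_coeff (x - N x) y = ell2_coeff (M x) y" using ab
      by (simp add: M_def N_def minus_ell2.rep_eq cscale.rep_eq divide_simps) (simp add: algebra_simps)
  qed
  have Nv: "(N ^^ L) v = 0" and Mw: "(M ^^ L') w = 0"
    unfolding N_def M_def funpow_cscale[OF sh] v w by simp_all
  have "\<exists>G. polynomial_op G \<and> (\<forall>x. x - (N ^^ n) x = G (M x))" for n
  proof (induction n)
    case 0
    have "polynomial_op (\<lambda>x. 0)" using polynomial_op.scale[OF polynomial_op.ident, of 0] by simp
    then show ?case by (intro exI[of _ "\<lambda>x. 0"]) simp
  next
    case (Suc n)
    then obtain G where G: "polynomial_op G" "\<And>x. x - (N ^^ n) x = G (M x)" by blast
    note Nn = polynomial_op_funpow[OF N, of n]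
    have "x - (N ^^ Suc n) x = G (M x) + (N ^^ n) (M x)" for x
    proof -
      have "(N ^^ n) (M x) = (N ^^ n) x - (N ^^ Suc n) x"
        unfolding MN[symmetric] bounded_clinearD(3)[OF polynomial_op_bounded[OF Nn]]
        by (simp add: funpow_swap1)
      then show ?thesis by (simp flip: G(2))
    qed
    then show ?case using polynomial_op.add[OF G(1) Nn] by blast
  qed
  then obtain G where G: "polynomial_op G" "\<And>x. x - (N ^^ L) x = G (M x)" by blast
  define R where "R = (\<lambda>x. x - (N ^^ L) x) ^^ L'"
  have "R v = v"
    unfolding R_def by (induction L') (simp_all add: Nv)
  moreover have "((\<lambda>x. G (M x)) ^^ n) x = (G ^^ n) ((M ^^ n) x)" for n x
    by (induction n)
      (simp_all add: polynomial_op_commute[OF M polynomial_op_funpow[OF G(1)]])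
  then have "R w = 0"
    unfolding R_def G(2) by (simp add: Mw bounded_clinearD(4)[OF polynomial_op_bounded]
        polynomial_op_funpow G(1))
  moreover have "polynomial_op R"
    unfolding R_def by (intro polynomial_op_funpow polynomial_op_diff polynomial_op.ident N)
  ultimately show thesis using that by blast
qed

text \<open>Products of the separating operators isolate \<open>v m\<close> from \<open>v j\<close> for all \<open>j < N\<close> with \<open>j \<noteq> m\<close>.
  The weights of the superposition decrease so fast that the images of the remaining tail under these
  products tend to zero as \<open>N\<close> grows, which leaves \<open>v m\<close> alone. Repetitions of the zero vector are
  allowed, so that finite families can be treated as sequences.\<close>
lemma cyclic_superposition:
  fixes v :: "nat \<Rightarrow> 'a ell2"
  assumes sep: "\<And>m j. m \<noteq> j \<Longrightarrow> v m \<noteq> 0 \<Longrightarrow>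
      \<exists>R. polynomial_op R \<and> R (v m) = v m \<and> R (v j) = 0"
  obtains f where "f \<in> closed_cspan (range v)"
    "\<And>W m. closed_csubspace W \<Longrightarrow> (\<And>i x. x \<in> W \<Longrightarrow> T i x \<in> W) \<Longrightarrow> f \<in> W \<Longrightarrow> v m \<in> W"
proof -
  define R where "R m j = (SOME R. polynomial_op R \<and> R (v m) = v m \<and> R (v j) = 0)" for m j :: nat
  have R: "polynomial_op (R m j)" "R m j (v m) = v m" "R m j (v j) = 0" if "m \<noteq> j" "v m \<noteq> 0" for m j
    using someI_ex[OF sep[OF that]] by (simp_all add: R_def)
  define P where "P m N = rec_nat (\<lambda>x. x) (\<lambda>j F. if j = m then F else (\<lambda>x. F (R m j x))) N" for m N
  have P0: "P m 0 = (\<lambda>x. x)"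
    and PS: "P m (Suc N) = (if N = m then P m N else (\<lambda>x. P m N (R m N x)))" for m N
    by (simp_all add: P_def)
  have Pop: "polynomial_op (P m N)" if "v m \<noteq> 0" for m N
  proof (induction N)
    case (Suc N)
    then show ?case using polynomial_op.comp[OF Suc R(1)] that by (auto simp: PS)
  qed (simp add: P0 polynomial_op.ident)
  have Pm: "P m N (v m) = v m" if "v m \<noteq> 0" for m N
    by (induction N) (auto simp: P0 PS R(2) that)
  have Pj: "P m N (v j) = 0" if "v m \<noteq> 0" "j < N" "j \<noteq> m" for m N j
    using that(2)
  proof (induction N)
    case (Suc N)
    show ?case
    proof (cases "j = N")
      case True
      then show ?thesis
        using that R(3)[of m j] bounded_clinearD(4)[OF polynomial_op_bounded[OF Pop[OF that(1)]]]
        by (simp add: PS)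
    next
      case False
      then have *: "P m N (v j) = 0" using Suc by simp
      then show ?thesis
        using that polynomial_op_commute[OF Pop[OF that(1), of N] R(1)[OF _ that(1)]]
          bounded_clinearD(4)[OF polynomial_op_bounded[OF R(1)[OF _ that(1)]]] *
        by (auto simp: PS)
    qed
  qed simp
  \<comment> \<open>Term \<open>j\<close> belongs to the tail only of the operators \<open>P m N\<close> with \<open>N \<le> j\<close>; finitely many
    of these matter for \<open>m \<le> j\<close>, and \<open>B j\<close> bounds the images of \<open>v j\<close> under all of them.\<close>
  define B where "B j = 1 + norm (v j) + (\<Sum>m\<le>j. \<Sum>N\<le>j. norm (P m N (v j)))" for j
  define c where "c j = (1 / 2) ^ j / B j" for j
  have B1: "B j \<ge> 1" for j by (simp add: B_def sum_nonneg)
  have cpos: "c j > 0" for j using B1[of j] by (simp add: c_def)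
  have Bv: "norm (v j) \<le> B j" for j
    by (simp add: B_def sum_nonneg add_nonneg_nonneg)
  have BP: "norm (P m N (v j)) \<le> B j" if "m \<le> j" "N \<le> j" for m N j
  proof -
    have "norm (P m N (v j)) \<le> (\<Sum>N\<le>j. norm (P m N (v j)))"
      using that by (intro member_le_sum) auto
    also have "\<dots> \<le> (\<Sum>m\<le>j. \<Sum>N\<le>j. norm (P m N (v j)))"
      using that by (intro member_le_sum[where f = "\<lambda>m. \<Sum>N\<le>j. norm (P m N (v j))"])
        (auto intro: sum_nonneg)
    also have "\<dots> \<le> B j" using norm_ge_zero[of "v j"] by (simp add: B_def del: norm_ge_zero)
    finally show ?thesis .
  qed
  have small: "norm (cscale (of_real (c j)) x) \<le> (1 / 2) ^ j" if "norm x \<le> B j" for x j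
  proof -
    have "norm (cscale (of_real (c j)) x) = c j * norm x"
      using cpos[of j] by (simp add: norm_cscale)
    also have "\<dots> \<le> c j * B j" using that B1[of j] by (intro mult_left_mono) (auto simp: c_def)
    also have "\<dots> = (1 / 2) ^ j" using B1[of j] by (simp add: c_def)
    finally show ?thesis .
  qed
  define X where "X j = cscale (of_real (c j)) (v j)" for j
  have geo: "summable (\<lambda>j. (1 / 2 :: real) ^ j)" by (simp add: summable_geometric)
  have sX: "summable X"
    by (rule summable_comparison_test[OF _ geo]) (use small[OF Bv] in \<open>auto simp: X_def\<close>)
  define f where "f = suminf X"
  show thesis
  proof (rule that)
    have "(\<lambda>n. \<Sum>j<n. X j) \<longlonglongrightarrow> f" unfolding f_def using sX by (rule summable_LIMSEQ)
    moreover have "(\<Sum>j<n. X j) \<in> closed_cspan (range v)" for n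
      using closed_csubspace_closed_cspan[of "range v"] closed_cspan_superset[of "range v"]
      unfolding closed_csubspace_def X_def
      by (intro ell2.subspace_sum ell2.subspace_scale) auto
    ultimately show "f \<in> closed_cspan (range v)"
      by (rule closed_sequentially[OF closed_csubspaceD(5)[OF closed_csubspace_closed_cspan], rotated])
  next
    fix W m
    assume W: "closed_csubspace W" "\<And>i x. x \<in> W \<Longrightarrow> T i x \<in> W" "f \<in> W"
    show "v m \<in> W"
    proof (cases "v m = 0")
      case True then show ?thesis using closed_csubspaceD(1)[OF W(1)] by simp
    next
      case False
      have "norm (P m N f - X m) \<le> 2 * (1 / 2) ^ N" if N: "m < N" for N
      proof -
        define Y where "Y j = P m N (X j)" for j
        note bl = polynomial_op_bounded[OF Pop[OF False, of N]]
        have Y: "Y j = cscale (of_real (c j)) (P m N (v j))" for j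
          by (simp add: Y_def X_def bounded_clinearD(6)[OF bl])
        have sY: "summable Y" unfolding Y_def
          by (rule bounded_linear.summable[OF bounded_clinearD(1)[OF bl] sX])
        have "P m N f = suminf Y" unfolding f_def Y_def
          by (rule bounded_linear.suminf[OF bounded_clinearD(1)[OF bl] sX])
        also have "\<dots> = suminf (\<lambda>j. Y (j + N)) + (\<Sum>j<N. Y j)"
          by (rule suminf_split_initial_segment[OF sY])
        also have "(\<Sum>j<N. Y j) = (\<Sum>j<N. if j = m then X m else 0)"
          by (rule sum.cong) (auto simp: Y X_def Pm Pj False)
        also have "\<dots> = X m" using N by simp
        finally have "P m N f - X m = suminf (\<lambda>j. Y (j + N))" by simp
        moreover have "norm (suminf (\<lambda>j. Y (j + N))) \<le> suminf (\<lambda>j. (1 / 2 :: real) ^ (j + N))"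
          using N geo by (intro norm_suminf_le) (auto simp: Y summable_iff_shift intro!: small BP)
        moreover have "suminf (\<lambda>j. (1 / 2 :: real) ^ (j + N)) = 2 * (1 / 2) ^ N"
          using suminf_mult2[OF geo, of "(1 / 2) ^ N"] by (simp add: power_add suminf_geometric)
        ultimately show ?thesis by simp
      qed
      then have "\<forall>\<^sub>F N in sequentially. norm (P m N f - X m) \<le> 2 * (1 / 2) ^ N"
        by (intro eventually_sequentiallyI[of "Suc m"]) auto
      moreover have "(\<lambda>N. 2 * (1 / 2 :: real) ^ N) \<longlonglongrightarrow> 2 * 0"
        by (intro tendsto_intros LIMSEQ_power_zero) auto
      ultimately have "(\<lambda>N. P m N f - X m) \<longlonglongrightarrow> 0"
        using Lim_null_comparison[of "\<lambda>N. P m N f - X m"] by auto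
      then have "(\<lambda>N. P m N f) \<longlonglongrightarrow> X m" using Lim_null by blast
      moreover have "P m N f \<in> W" for N
        by (rule polynomial_op_invariant[OF Pop[OF False] W])
      ultimately have "X m \<in> W"
        by (rule closed_sequentially[OF closed_csubspaceD(5)[OF W(1)], rotated])
      then have "cscale (of_real (1 / c m)) (X m) \<in> W" by (rule closed_csubspaceD(4)[OF W(1)])
      then show ?thesis using cpos[of m] by (simp add: X_def flip: of_real_mult)
    qed
  qed
qed

end

text \<open>Induction on the equations: one of them is used to eliminate an unknown.\<close>
lemma homogeneous_system_nontrivial:
  fixes c :: "'k \<Rightarrow> 's \<Rightarrow> complex"
  assumes "finite S" "finite K" "card S < card K"
  shows "\<exists>a. (\<exists>k\<in>K. a k \<noteq> 0) \<and> (\<forall>s\<in>S. (\<Sum>k\<in>K. a k * c k s) = 0)"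
  using assms
proof (induction S arbitrary: K c rule: finite_induct)
  case empty
  then have "K \<noteq> {}" by auto
  then show ?case by (intro exI[of _ "\<lambda>_. 1"]) auto
next
  case (insert s S)
  show ?case
  proof (cases "\<forall>k\<in>K. c k s = 0")
    case True
    obtain a where "\<exists>k\<in>K. a k \<noteq> 0" "\<forall>t\<in>S. (\<Sum>k\<in>K. a k * c k t) = 0"
      using insert.IH[of K c] insert.prems insert.hyps by (auto simp: card_insert_if)
    then show ?thesis using True by (intro exI[of _ a]) auto
  next
    case False
    then obtain q where q: "q \<in> K" "c q s \<noteq> 0" by blast
    define K' where "K' = K - {q}"
    have K: "K = insert q K'" "q \<notin> K'" "finite K'" using q insert.prems by (auto simp: K'_def)
    define d where "d k t = c k t - c k s / c q s * c q t" for k t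
    obtain a where a: "\<exists>k\<in>K'. a k \<noteq> 0" "\<And>t. t \<in> S \<Longrightarrow> (\<Sum>k\<in>K'. a k * d k t) = 0"
      using insert.IH[of K' d] insert.prems insert.hyps K by (auto simp: card_insert_if)
    define z where "z = - (\<Sum>k\<in>K'. a k * c k s) / c q s"
    define a' where "a' = a(q := z)"
    have sum': "(\<Sum>k\<in>K. a' k * c k t) = z * c q t + (\<Sum>k\<in>K'. a k * c k t)" for t
    proof -
      have "(\<Sum>k\<in>K'. a' k * c k t) = (\<Sum>k\<in>K'. a k * c k t)"
        using K by (intro sum.cong) (auto simp: a'_def)
      then show ?thesis using K by (simp add: a'_def)
    qed
    have "(\<Sum>k\<in>K. a' k * c k t) = 0" if t: "t \<in> insert s S" for t
    proof (cases "t = s")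
      case True
      then show ?thesis using q unfolding sum' by (simp add: z_def)
    next
      case False
      then have "0 = (\<Sum>k\<in>K'. a k * c k t) - (\<Sum>k\<in>K'. a k * c k s) / c q s * c q t"
        using a(2)[of t] t
        by (simp add: d_def right_diff_distrib sum_subtractf sum_distrib_right sum_divide_distrib mult.assoc)
      then show ?thesis unfolding sum' by (simp add: z_def)
    qed
    moreover have "\<exists>k\<in>K. a' k \<noteq> 0" using a(1) K by (auto simp: a'_def)
    ultimately show ?thesis by blast
  qed
qed

text \<open>With fewer generators than functionals, a nontrivial combination of the functionals vanishes on all
  generators. As the eigenvalues \<open>\<mu> i\<close> do not depend on \<open>k\<close>, its kernel in \<open>H\<close> is invariant and hence
  all of \<open>H\<close>, which the dual vectors \<open>e k\<close> contradict.\<close>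
lemma (in commuting_tuple) card_le_generators:
  assumes gen: "generated T S = H" and K: "finite K"
    and eig: "\<And>k i x. k \<in> K \<Longrightarrow> x \<in> H \<Longrightarrow> cinner (T i x) (g k) = \<mu> i * cinner x (g k)"
    and e: "\<And>k. k \<in> K \<Longrightarrow> e k \<in> H" "\<And>k. k \<in> K \<Longrightarrow> cinner (e k) (g k) \<noteq> 0"
      "\<And>j k. j \<in> K \<Longrightarrow> k \<in> K \<Longrightarrow> j \<noteq> k \<Longrightarrow> cinner (e j) (g k) = 0"
  shows "enat (card K) \<le> ecard S"
proof (rule ccontr)
  assume "\<not> enat (card K) \<le> ecard S"
  then have S: "finite S" "card S < card K" by (auto simp: ecard_def split: if_splits)
  obtain a where a: "\<exists>k\<in>K. a k \<noteq> 0" "\<And>s. s \<in> S \<Longrightarrow> (\<Sum>k\<in>K. a k * cinner s (g k)) = 0"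
    using homogeneous_system_nontrivial[OF S(1) K S(2), of "\<lambda>k s. cinner s (g k)"] by blast
  define G where "G = (\<Sum>k\<in>K. cscale (cnj (a k)) (g k))"
  have G: "cinner x G = (\<Sum>k\<in>K. a k * cinner x (g k))" for x
    unfolding G_def linear_sum[OF bounded_linear.linear[OF bounded_linear_cinner_right]]
    by (simp add: cinner_cscale_right)
  have clo: "closed_csubspace H" unfolding gen[symmetric] by (rule closed_csubspace_generated)
  define W where "W = H \<inter> {x. \<forall>y\<in>{G}. cinner x y = 0}"
  have "generated T S \<subseteq> W"
  proof (rule generated_minimal)
    show "closed_csubspace W"
      unfolding W_def by (intro closed_csubspace_Int clo closed_csubspace_orth)
    show "S \<subseteq> W" using generated_superset[of S] a(2) by (auto simp: W_def gen G)
    fix i x assume x: "x \<in> W"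
    have "cinner (T i x) G = \<mu> i * cinner x G"
      unfolding G sum_distrib_left using x by (intro sum.cong) (auto simp: eig W_def)
    then show "T i x \<in> W" using x generated_invariant[of x S i] by (auto simp: W_def gen)
  qed
  moreover obtain k where k: "k \<in> K" "a k \<noteq> 0" using a(1) by blast
  ultimately have "cinner (e k) G = 0" using e(1) by (auto simp: W_def gen)
  moreover have "cinner (e k) G = (\<Sum>j\<in>K. if j = k then a k * cinner (e k) (g k) else 0)"
    unfolding G using k e(3) by (intro sum.cong) auto
  ultimately show False using k K e(2)[of k] by simp
qed

section \<open>The Hardy space of the disc\<close>

subsection \<open>Shifts\<close>

lemma notin_range_Suc: "k \<notin> range Suc \<Longrightarrow> k = 0"
  by (cases k) auto

lemma summable_on_Suc_iff:
  fixes f :: "nat \<Rightarrow> 'a::{comm_monoid_add, t2_space}"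
  assumes "f 0 = 0"
  shows "f summable_on UNIV \<longleftrightarrow> (\<lambda>k. f (Suc k)) summable_on UNIV"
proof -
  have "f summable_on UNIV \<longleftrightarrow> f summable_on range Suc"
    by (rule summable_on_cong_neutral) (use assms in \<open>auto dest!: notin_range_Suc\<close>)
  also have "\<dots> \<longleftrightarrow> (f \<circ> Suc) summable_on UNIV" by (rule summable_on_reindex) simp
  finally show ?thesis by (simp add: o_def)
qed

lemma infsum_Suc:
  fixes f :: "nat \<Rightarrow> 'a::{comm_monoid_add, t2_space}"
  assumes "f 0 = 0"
  shows "infsum f UNIV = infsum (\<lambda>k. f (Suc k)) UNIV"
proof -
  have "infsum f UNIV = infsum f (range Suc)"
    by (rule infsum_cong_neutral) (use assms in \<open>auto dest!: notin_range_Suc\<close>)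
  also have "\<dots> = infsum (f \<circ> Suc) UNIV" by (rule infsum_reindex) simp
  finally show ?thesis by (simp add: o_def)
qed

lift_definition fshift :: "hardy_disc \<Rightarrow> hardy_disc" is "\<lambda>f k. if k = 0 then 0 else f (k - 1)"
  subgoal for f
    using summable_on_Suc_iff[of "\<lambda>k. (cmod (if k = 0 then 0 else f (k - 1)))\<^sup>2"] by simp
  done

lift_definition bshift :: "hardy_disc \<Rightarrow> hardy_disc" is "\<lambda>f k. f (Suc k)"
  subgoal for f
    using summable_on_subset_banach[of "\<lambda>k. (cmod (f k))\<^sup>2" UNIV "range Suc"]
    by (simp add: summable_on_reindex o_def)
  done

lemma cinner_fshift: "cinner (fshift f) g = cinner f (bshift g)"
  unfolding cinner.rep_eq fshift.rep_eq bshift.rep_eq by (subst infsum_Suc) auto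

lemma bshift_fshift [simp]: "bshift (fshift f) = f"
  by (rule ell2_ext) (simp add: fshift.rep_eq bshift.rep_eq)

lemma fshift_bshift: "fshift (bshift f) = f - cscale (ell2_coeff f 0) (ell2_delta 0)"
  by (rule ell2_ext)
    (simp add: fshift.rep_eq bshift.rep_eq minus_ell2.rep_eq cscale.rep_eq ell2_delta.rep_eq)

lemma cinner_fshift_fshift: "cinner (fshift f) (fshift g) = cinner f g"
  by (simp add: cinner_fshift)

lemma norm_fshift: "norm (fshift f) = norm f"
proof -
  have "(norm (fshift f))\<^sup>2 = (norm f)\<^sup>2"
    using cinner_fshift_fshift[of f f] unfolding cinner_self_norm of_real_eq_iff .
  then show ?thesis by (simp add: power2_eq_iff_nonneg)
qed

lemma norm_bshift_le: "norm (bshift f) \<le> norm f"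
proof -
  have "(norm (bshift f))\<^sup>2 = cmod (cinner (bshift f) (bshift f))"
    by (simp add: cinner_self_norm norm_power)
  also have "\<dots> = cmod (cinner (fshift (bshift f)) f)" by (simp add: cinner_fshift)
  also have "\<dots> \<le> norm (bshift f) * norm f"
    using cmod_cinner_le[of "fshift (bshift f)" f] by (simp add: norm_fshift)
  finally show ?thesis by (cases "norm (bshift f) = 0") (auto simp: power2_eq_square)
qed

lemma bounded_clinear_fshift: "bounded_clinear fshift"
  by (rule bounded_clinear_intro[where K = 1])
    (auto simp: norm_fshift intro!: ell2_ext simp: fshift.rep_eq plus_ell2.rep_eq cscale.rep_eq)

lemma bounded_clinear_bshift: "bounded_clinear bshift"
  by (rule bounded_clinear_intro[where K = 1])
    (auto simp: norm_bshift_le intro!: ell2_ext simp: bshift.rep_eq plus_ell2.rep_eq cscale.rep_eq)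

lemmas bshift_simps = bounded_clinearD(2-6)[OF bounded_clinear_bshift]

subsection \<open>Jordan chains of the backward shift\<close>

definition shift_resolvent :: "complex \<Rightarrow> hardy_disc \<Rightarrow> hardy_disc" where
  "shift_resolvent a x = (SOME u. u - cscale a (fshift u) = x)"

lemma shift_resolvent:
  assumes "cmod a < 1"
  shows "shift_resolvent a x - cscale a (fshift (shift_resolvent a x)) = x"
proof -
  obtain u where "u - cscale a (fshift u) = x"
    using neumann_solution[OF bounded_clinear_fshift _ assms] norm_fshift by (metis order_refl)
  then show ?thesis unfolding shift_resolvent_def by (rule someI)
qed

text \<open>The coefficients of \<open>jordan a j\<close> are \<open>(k choose j) * a ^ (k - j)\<close>: pairing with
  \<open>jordan (cnj \<alpha>) j\<close> is taking the \<open>j\<close>-th Taylor coefficient at \<open>\<alpha>\<close>. Building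
  the chain with the resolvent makes square-summability automatic.\<close>
primrec jordan :: "complex \<Rightarrow> nat \<Rightarrow> hardy_disc" where
  "jordan a 0 = shift_resolvent a (ell2_delta 0)"
| "jordan a (Suc j) = shift_resolvent a (fshift (jordan a j))"

lemma bshift_resolvent:
  assumes "cmod a < 1"
  shows "bshift (shift_resolvent a x) = cscale a (shift_resolvent a x) + bshift x"
proof -
  have "bshift x = bshift (shift_resolvent a x) - cscale a (shift_resolvent a x)"
    using arg_cong[OF shift_resolvent[OF assms, of x], of bshift] by (simp add: bshift_simps)
  then show ?thesis by simp
qed

lemma bshift_jordan_0: "cmod a < 1 \<Longrightarrow> bshift (jordan a 0) = cscale a (jordan a 0)"
proof -
  have "bshift (ell2_delta 0) = 0"
    by (rule ell2_ext) (simp add: bshift.rep_eq ell2_delta.rep_eq zero_ell2.rep_eq)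
  then show "cmod a < 1 \<Longrightarrow> bshift (jordan a 0) = cscale a (jordan a 0)"
    by (simp add: bshift_resolvent)
qed

lemma bshift_jordan_Suc:
  "cmod a < 1 \<Longrightarrow> bshift (jordan a (Suc j)) = cscale a (jordan a (Suc j)) + jordan a j"
  by (simp add: bshift_resolvent)

lemma coeff_jordan_0: assumes "cmod a < 1" shows "ell2_coeff (jordan a 0) k = a ^ k"
proof (induction k)
  case 0
  then show ?case
    using arg_cong[OF shift_resolvent[OF assms, of "ell2_delta 0"], of "\<lambda>f. ell2_coeff f 0"]
    by (simp add: minus_ell2.rep_eq cscale.rep_eq fshift.rep_eq ell2_delta.rep_eq)
next
  case (Suc k)
  have "ell2_coeff (jordan a 0) (Suc k) = ell2_coeff (bshift (jordan a 0)) k"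
    by (simp only: bshift.rep_eq)
  also have "\<dots> = a * ell2_coeff (jordan a 0) k"
    unfolding bshift_jordan_0[OF assms] by (simp only: cscale.rep_eq)
  finally show ?case using Suc by (simp del: jordan.simps)
qed

declare jordan.simps [simp del]

abbreviation taylor :: "hardy_disc \<Rightarrow> complex \<Rightarrow> nat \<Rightarrow> complex" where
  "taylor f \<alpha> j \<equiv> cinner f (jordan (cnj \<alpha>) j)"

lemma disc_eval_cinner: assumes "cmod z < 1" shows "disc_eval f z = taylor f z 0"
  unfolding disc_eval_def cinner.rep_eq using assms by (simp add: coeff_jordan_0)

lemma disc_eval_sums: assumes "cmod z < 1" shows "(\<lambda>k. ell2_coeff f k * z ^ k) sums disc_eval f z"
proof -
  have "(\<lambda>k. ell2_coeff f k * z ^ k) summable_on UNIV"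
    using cinner_summable[of f "jordan (cnj z) 0"] assms by (simp add: coeff_jordan_0)
  then show ?thesis unfolding disc_eval_def by (intro has_sum_imp_sums has_sum_infsum)
qed

lemma disc_eval_holomorphic: "disc_eval f holomorphic_on ball 0 1"
  by (rule power_series_holomorphic[where a = "ell2_coeff f"]) (use disc_eval_sums in simp)

lemma disc_eval_isCont: "cmod z < 1 \<Longrightarrow> isCont (disc_eval f) z"
  using holomorphic_on_imp_continuous_on[OF disc_eval_holomorphic, of f]
  by (simp add: continuous_on_eq_continuous_at)

lemma disc_eval_diff: "cmod z < 1 \<Longrightarrow> disc_eval (f - g) z = disc_eval f z - disc_eval g z"
  and disc_eval_cscale: "cmod z < 1 \<Longrightarrow> disc_eval (cscale a f) z = a * disc_eval f z"
  and disc_eval_fshift: "cmod z < 1 \<Longrightarrow> disc_eval (fshift f) z = z * disc_eval f z"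
  by (simp_all add: disc_eval_cinner cinner_diff_left cinner_cscale_left cinner_fshift
      bshift_jordan_0 cinner_cscale_right)

lemma disc_eval_delta_0: "cmod z < 1 \<Longrightarrow> disc_eval (ell2_delta 0) z = 1"
  using cinner_cnj[of "jordan (cnj z) 0" "ell2_delta 0"]
  by (simp add: disc_eval_cinner cinner_delta_right coeff_jordan_0)

lemma disc_eval_0: "disc_eval f 0 = ell2_coeff f 0"
  using disc_eval_sums[of 0 f] powser_sums_zero sums_unique2 by fastforce

text \<open>If \<open>f\<close> vanishes on the disc, then so does \<open>f / z\<close>, at \<open>0\<close> by continuity; thus the coefficients
  vanish one after the other.\<close>
lemma disc_eval_zero_imp:
  assumes "\<And>z. cmod z < 1 \<Longrightarrow> disc_eval f z = 0"
  shows "f = 0"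
proof -
  have "\<forall>z. cmod z < 1 \<longrightarrow> disc_eval f z = 0 \<Longrightarrow> ell2_coeff f k = 0" for k f
  proof (induction k arbitrary: f)
    case 0
    then show ?case using disc_eval_0[of f] by simp
  next
    case (Suc k)
    have f0: "ell2_coeff f 0 = 0"
      using disc_eval_0[of f] Suc(2) by simp
    have nz: "disc_eval (bshift f) z = 0" if "cmod z < 1" "z \<noteq> 0" for z
      using disc_eval_fshift[OF that(1), of "bshift f"] Suc(2) that f0 by (simp add: fshift_bshift)
    have "disc_eval (bshift f) z = 0" if z: "cmod z < 1" for z
    proof (cases "z = 0")
      case True
      have "\<forall>\<^sub>F w in at 0. disc_eval (bshift f) w = 0"
        unfolding eventually_at by (rule exI[of _ 1]) (auto simp: nz)
      then have "(disc_eval (bshift f) \<longlongrightarrow> 0) (at 0)" by (rule tendsto_eventually)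
      then show ?thesis
        using disc_eval_isCont[of 0 "bshift f"] True
        by (auto simp: isCont_def intro: tendsto_unique[OF at_neq_bot])
    qed (use nz z in auto)
    then have "ell2_coeff (bshift f) k = 0" using Suc.IH by blast
    then show ?case by (simp add: bshift.rep_eq)
  qed
  then show ?thesis using assms by (intro ell2_ext) (simp add: zero_ell2.rep_eq)
qed


lemma closed_cspan_kernels: "closed_cspan {jordan (cnj z) 0 | z. cmod z < 1} = UNIV"
  by (rule closed_cspan_eq_UNIV, rule disc_eval_zero_imp) (auto simp: disc_eval_cinner)

subsection \<open>Division by linear and by Blaschke factors\<close>

definition linmult :: "complex \<Rightarrow> hardy_disc \<Rightarrow> hardy_disc" where
  "linmult \<alpha> f = fshift f - cscale \<alpha> f"

lemma disc_eval_linmult: "cmod z < 1 \<Longrightarrow> disc_eval (linmult \<alpha> f) z = (z - \<alpha>) * disc_eval f z"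
  by (simp add: linmult_def disc_eval_diff disc_eval_fshift disc_eval_cscale algebra_simps)

lemma cinner_linmult: "cinner (linmult \<alpha> f) g = cinner f (bshift g - cscale (cnj \<alpha>) g)"
  by (simp add: linmult_def cinner_diff_left cinner_diff_right cinner_fshift cinner_cscale_left
      cinner_cscale_right)

lemma cinner_linmult_jordan:
  assumes "cmod \<alpha> < 1"
  shows "taylor (linmult \<alpha> f) \<alpha> 0 = 0"
    "taylor (linmult \<alpha> f) \<alpha> (Suc j) = taylor f \<alpha> j"
  using assms by (simp_all add: cinner_linmult bshift_jordan_0 bshift_jordan_Suc)

lemma cinner_linmult_power:
  assumes "cmod \<alpha> < 1"
  shows "taylor ((linmult \<alpha> ^^ l) f) \<alpha> j =
    (if j < l then 0 else taylor f \<alpha> (j - l))"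
proof (induction l arbitrary: j)
  case (Suc l)
  show ?case using Suc by (cases j) (auto simp: cinner_linmult_jordan[OF assms])
qed simp

text \<open>\<open>f / (z - \<alpha>)\<close> is \<open>T (1 - \<alpha> T)\<^bsup>-1\<^esup> f\<close>, where \<open>T\<close> is the backward shift.\<close>
lemma divide_linear_factor:
  assumes \<alpha>: "cmod \<alpha> < 1" and f: "disc_eval f \<alpha> = 0"
  obtains u where "f = linmult \<alpha> u"
proof -
  obtain v where v: "v - cscale \<alpha> (bshift v) = f"
    using neumann_solution[OF bounded_clinear_bshift norm_bshift_le \<alpha>] by blast
  let ?k = "jordan (cnj \<alpha>) 0"
  have "cinner f ?k = cinner v (?k - cscale (cnj \<alpha>) (fshift ?k))"
    using arg_cong[OF cinner_fshift[of ?k v], of cnj]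
    by (simp add: v[symmetric] cinner_diff_left cinner_diff_right cinner_cscale_left
        cinner_cscale_right cinner_cnj)
  also have "?k - cscale (cnj \<alpha>) (fshift ?k) = ell2_delta 0"
    unfolding jordan.simps by (rule shift_resolvent) (use \<alpha> in simp)
  finally have v0: "ell2_coeff v 0 = 0"
    using f \<alpha> by (simp add: disc_eval_cinner cinner_delta_right)
  have "linmult \<alpha> (bshift v) = v - cscale \<alpha> (bshift v)"
    by (simp add: linmult_def fshift_bshift v0)
  then show thesis using that[of "bshift v"] v by simp
qed

text \<open>Both sides have the same expansion, because the shift is an isometry. So multiplication by a Blaschke
  factor preserves the norm.\<close>
lemma norm_blaschke_isometry: "norm (linmult \<alpha> u) = norm (u - cscale (cnj \<alpha>) (fshift u))"
proof -
  have "cinner (linmult \<alpha> u) (linmult \<alpha> u)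
      = cinner (u - cscale (cnj \<alpha>) (fshift u)) (u - cscale (cnj \<alpha>) (fshift u))"
    by (simp add: linmult_def cinner_diff_left cinner_diff_right cinner_cscale_left
        cinner_cscale_right cinner_fshift_fshift algebra_simps)
  then have "(norm (linmult \<alpha> u))\<^sup>2 = (norm (u - cscale (cnj \<alpha>) (fshift u)))\<^sup>2"
    unfolding cinner_self_norm of_real_eq_iff .
  then show ?thesis by (simp add: power2_eq_iff_nonneg)
qed

lemma one_minus_cnj_mult_nonzero: "cmod \<alpha> < 1 \<Longrightarrow> cmod z < 1 \<Longrightarrow> 1 - cnj \<alpha> * z \<noteq> 0"
proof
  assume *: "cmod \<alpha> < 1" "cmod z < 1" "1 - cnj \<alpha> * z = 0"
  then have "cmod (cnj \<alpha> * z) = 1" by (metis eq_iff_diff_eq_0 norm_one)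
  then show False using * mult_strict_mono[of "cmod \<alpha>" 1 "cmod z" 1]
    by (simp add: norm_mult)
qed

lemma disc_eval_blaschke_pair:
  assumes "cmod \<alpha> < 1" "cmod z < 1"
  shows "disc_eval (linmult \<alpha> u) z =
    blaschke_factor \<alpha> z * disc_eval (u - cscale (cnj \<alpha>) (fshift u)) z"
proof -
  have "disc_eval (u - cscale (cnj \<alpha>) (fshift u)) z = (1 - cnj \<alpha> * z) * disc_eval u z"
    using assms by (simp add: disc_eval_diff disc_eval_cscale disc_eval_fshift algebra_simps)
  then show ?thesis
    using assms one_minus_cnj_mult_nonzero[OF assms]
    by (simp add: disc_eval_linmult blaschke_factor_def)
qed

lemma divide_blaschke_factor:
  assumes "cmod \<alpha> < 1" "disc_eval f \<alpha> = 0"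
  obtains g where "norm g = norm f" "\<And>z. cmod z < 1 \<Longrightarrow> disc_eval f z = blaschke_factor \<alpha> z * disc_eval g z"
proof -
  obtain u where "f = linmult \<alpha> u" using divide_linear_factor[OF assms] by blast
  then show thesis
    using that[of "u - cscale (cnj \<alpha>) (fshift u)"] norm_blaschke_isometry[of \<alpha> u]
      disc_eval_blaschke_pair[OF assms(1)] by simp
qed

lemma multiply_blaschke_factor:
  assumes "cmod \<alpha> < 1"
  obtains f where "norm f = norm g" "\<And>z. cmod z < 1 \<Longrightarrow> disc_eval f z = blaschke_factor \<alpha> z * disc_eval g z"
proof -
  have "cmod (cnj \<alpha>) < 1" using assms by simp
  from shift_resolvent[OF this, of g] show thesis
    using that[of "linmult \<alpha> (shift_resolvent (cnj \<alpha>) g)"]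
      norm_blaschke_isometry[of \<alpha> "shift_resolvent (cnj \<alpha>) g"]
      disc_eval_blaschke_pair[OF assms, of _ "shift_resolvent (cnj \<alpha>) g"] by simp
qed

subsection \<open>Orders of zeros\<close>

definition nonzero_holo :: "(complex \<Rightarrow> complex) \<Rightarrow> bool" where
  "nonzero_holo \<phi> \<longleftrightarrow> \<phi> holomorphic_on ball 0 1 \<and> (\<exists>z\<in>ball 0 1. \<phi> z \<noteq> 0)"

text \<open>On the functions singled out above the integer order is nonnegative, so \<open>nat\<close> loses nothing.\<close>
definition zero_order :: "(complex \<Rightarrow> complex) \<Rightarrow> complex \<Rightarrow> nat" where
  "zero_order \<phi> \<alpha> = nat (zorder \<phi> \<alpha>)"

lemma at_eqI:
  fixes f g :: "complex \<Rightarrow> complex"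
  assumes "isCont f \<alpha>" "isCont g \<alpha>" "\<forall>\<^sub>F z in at \<alpha>. f z = g z"
  shows "f \<alpha> = g \<alpha>"
proof -
  have "(f \<longlongrightarrow> f \<alpha>) (at \<alpha>)" "(g \<longlongrightarrow> g \<alpha>) (at \<alpha>)" using assms by (auto simp: isCont_def)
  moreover from this have "(f \<longlongrightarrow> g \<alpha>) (at \<alpha>)" using assms(3) by (simp add: filterlim_cong)
  ultimately show ?thesis using tendsto_unique[OF at_neq_bot] by blast
qed

lemma eventually_punctured_disc:
  assumes "cmod \<alpha> < 1" shows "\<forall>\<^sub>F z in at \<alpha>. z \<in> ball 0 1 \<and> z \<noteq> \<alpha>"
  using assms eventually_at_in_open[of "ball 0 1" \<alpha>] by simp

text \<open>The cofactor \<open>F\<close> is only given near \<open>\<alpha>\<close>, so that orders can be read off from functions that are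
  not known to lie in the Hardy space.\<close>
lemma divide_linear_power:
  assumes "cmod \<alpha> < 1" "isCont F \<alpha>" "\<forall>\<^sub>F z in at \<alpha>. disc_eval f z = (z - \<alpha>) ^ m * F z"
  obtains h where "f = (linmult \<alpha> ^^ m) h" "disc_eval h \<alpha> = F \<alpha>"
  using assms(3)
proof (induction m arbitrary: f thesis)
  case 0
  have "disc_eval f \<alpha> = F \<alpha>"
    using 0(2) disc_eval_isCont assms(1,2) by (auto intro: at_eqI)
  then show ?case using 0(1)[of f] by simp
next
  case (Suc m)
  have "disc_eval f \<alpha> = (\<lambda>z. (z - \<alpha>) ^ Suc m * F z) \<alpha>"
  proof (rule at_eqI[where g = "\<lambda>z. (z - \<alpha>) ^ Suc m * F z"])
    show "isCont (\<lambda>z. (z - \<alpha>) ^ Suc m * F z) \<alpha>" using assms(2) by (intro continuous_intros)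
  qed (use Suc(3) disc_eval_isCont assms(1) in auto)
  then obtain u where u: "f = linmult \<alpha> u" using divide_linear_factor[OF assms(1)] by auto
  have "\<forall>\<^sub>F z in at \<alpha>. z \<in> ball 0 1 \<and> z \<noteq> \<alpha>"
    by (rule eventually_punctured_disc[OF assms(1)])
  with Suc(3) have "\<forall>\<^sub>F z in at \<alpha>. disc_eval u z = (z - \<alpha>) ^ m * F z"
    by eventually_elim (auto simp: u disc_eval_linmult)
  from Suc.IH[OF _ this] obtain h where "u = (linmult \<alpha> ^^ m) h" "disc_eval h \<alpha> = F \<alpha>" by blast
  then show ?case using Suc(2)[of h] u by simp
qed

lemma nonzero_holo_near:
  assumes "nonzero_holo \<phi>" "cmod \<alpha> < 1"
  shows "\<forall>\<^sub>F z in at \<alpha>. \<phi> z \<noteq> 0 \<and> z \<in> ball 0 1"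
  using assms non_zero_neighbour_alt[of \<phi> "ball 0 1" \<alpha>] by (auto simp: nonzero_holo_def)

lemma zero_order_factor:
  assumes "nonzero_holo \<phi>" "cmod \<alpha> < 1"
  shows "0 < zero_order \<phi> \<alpha> \<longleftrightarrow> \<phi> \<alpha> = 0"
    "\<exists>F. isCont F \<alpha> \<and> F \<alpha> \<noteq> 0 \<and> (\<forall>\<^sub>F z in at \<alpha>. \<phi> z = (z - \<alpha>) ^ zero_order \<phi> \<alpha> * F z)"
proof -
  define F where "F = zor_poly \<phi> \<alpha>"
  have "(if \<phi> \<alpha> = 0 then 0 < zorder \<phi> \<alpha> else zorder \<phi> \<alpha> = 0) \<and> (\<exists>r. r > 0 \<and> cball \<alpha> r \<subseteq> ball 0 1 \<and>
      zor_poly \<phi> \<alpha> holomorphic_on cball \<alpha> r \<and>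
      (\<forall>w\<in>cball \<alpha> r. \<phi> w = zor_poly \<phi> \<alpha> w * (w - \<alpha>) ^ nat (zorder \<phi> \<alpha>) \<and> zor_poly \<phi> \<alpha> w \<noteq> 0))"
    by (rule zorder_exist_zero) (use assms in \<open>auto simp: nonzero_holo_def\<close>)
  then obtain r where *: "if \<phi> \<alpha> = 0 then 0 < zorder \<phi> \<alpha> else zorder \<phi> \<alpha> = 0"
    "r > 0" "cball \<alpha> r \<subseteq> ball 0 1" "F holomorphic_on cball \<alpha> r"
    "\<And>w. w \<in> cball \<alpha> r \<Longrightarrow> \<phi> w = F w * (w - \<alpha>) ^ nat (zorder \<phi> \<alpha>) \<and> F w \<noteq> 0"
    unfolding F_def by blast
  show "0 < zero_order \<phi> \<alpha> \<longleftrightarrow> \<phi> \<alpha> = 0" using *(1) by (auto simp: zero_order_def split: if_splits)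
  have "F holomorphic_on ball \<alpha> r" using *(4) by (rule holomorphic_on_subset) auto
  then have "isCont F \<alpha>"
    using holomorphic_on_imp_continuous_on[of F "ball \<alpha> r"] *(2)
    by (simp add: continuous_on_eq_continuous_at)
  moreover have "\<forall>\<^sub>F z in at \<alpha>. \<phi> z = (z - \<alpha>) ^ zero_order \<phi> \<alpha> * F z"
  proof -
    have "\<forall>\<^sub>F z in at \<alpha>. z \<in> ball \<alpha> r"
      using *(2) eventually_at_in_open[of "ball \<alpha> r" \<alpha>] by (simp add: eventually_conj_iff)
    then show ?thesis by eventually_elim (use *(5) in \<open>auto simp: zero_order_def mult.commute\<close>)
  qed
  ultimately show "\<exists>F. isCont F \<alpha> \<and> F \<alpha> \<noteq> 0 \<and> (\<forall>\<^sub>F z in at \<alpha>. \<phi> z = (z - \<alpha>) ^ zero_order \<phi> \<alpha> * F z)"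
    using *(2) *(5)[of \<alpha>] by auto
qed

text \<open>Near \<open>\<alpha>\<close> the function is \<open>(z - \<alpha>) ^ m\<close> times a function that is nonzero at \<open>\<alpha>\<close>, and each
  linear factor lowers the index of the Jordan vector by one.\<close>
lemma cinner_jordan_zero_order:
  assumes "nonzero_holo \<phi>" "cmod \<alpha> < 1" and f: "\<And>z. cmod z < 1 \<Longrightarrow> disc_eval f z = \<phi> z"
  shows "j < zero_order \<phi> \<alpha> \<Longrightarrow> taylor f \<alpha> j = 0"
    "taylor f \<alpha> (zero_order \<phi> \<alpha>) \<noteq> 0"
proof -
  obtain F where F: "isCont F \<alpha>" "F \<alpha> \<noteq> 0"
    "\<forall>\<^sub>F z in at \<alpha>. \<phi> z = (z - \<alpha>) ^ zero_order \<phi> \<alpha> * F z"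
    using zero_order_factor(2)[OF assms(1,2)] by blast
  from F(3) nonzero_holo_near[OF assms(1,2)]
  have "\<forall>\<^sub>F z in at \<alpha>. disc_eval f z = (z - \<alpha>) ^ zero_order \<phi> \<alpha> * F z"
    by eventually_elim (use f in auto)
  then obtain h where h: "f = (linmult \<alpha> ^^ zero_order \<phi> \<alpha>) h" "disc_eval h \<alpha> = F \<alpha>"
    using divide_linear_power[OF assms(2) F(1)] by blast
  show "j < zero_order \<phi> \<alpha> \<Longrightarrow> taylor f \<alpha> j = 0"
    by (simp add: h(1) cinner_linmult_power[OF assms(2)])
  show "taylor f \<alpha> (zero_order \<phi> \<alpha>) \<noteq> 0"
    using F(2) h(2) assms(2)
    by (simp add: h(1) cinner_linmult_power[OF assms(2)] disc_eval_cinner)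
qed

text \<open>Each vanishing coefficient permits one more division by \<open>z - \<alpha>\<close>.\<close>
lemma cinner_jordan_vanish_imp:
  assumes "cmod \<alpha> < 1" "\<And>j. j < l \<Longrightarrow> taylor f \<alpha> j = 0"
  obtains h where "f = (linmult \<alpha> ^^ l) h"
  using assms(2)
proof (induction l arbitrary: thesis)
  case 0 then show ?case by simp
next
  case (Suc l)
  obtain h where h: "f = (linmult \<alpha> ^^ l) h" using Suc.IH Suc.prems(2) by auto
  then have "disc_eval h \<alpha> = 0"
    using Suc.prems(2)[of l] assms(1) by (simp add: cinner_linmult_power disc_eval_cinner)
  then obtain u where "h = linmult \<alpha> u" using divide_linear_factor[OF assms(1)] by blast
  then have "f = (linmult \<alpha> ^^ Suc l) u" using h by (simp add: funpow_swap1)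
  then show ?case by (rule Suc.prems(1))
qed


lemma zero_order_cong:
  assumes "\<And>z. cmod z < 1 \<Longrightarrow> \<phi> z = \<psi> z" "cmod \<alpha> < 1"
  shows "zero_order \<phi> \<alpha> = zero_order \<psi> \<alpha>"
proof -
  have "\<forall>\<^sub>F z in nhds \<alpha>. z \<in> ball 0 1"
    using assms(2) by (intro eventually_nhds_in_open) auto
  then have "\<forall>\<^sub>F z in nhds \<alpha>. \<phi> z = \<psi> z" by eventually_elim (use assms in auto)
  then have "zorder \<phi> \<alpha> = zorder \<psi> \<alpha>"
    by (intro zorder_cong) (auto simp: eventually_at_filter elim: eventually_mono)
  then show ?thesis by (simp add: zero_order_def)
qed

lemma zero_order_mult:
  assumes "nonzero_holo \<phi>" "nonzero_holo \<psi>" "cmod \<alpha> < 1"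
    and "\<And>z. cmod z < 1 \<Longrightarrow> \<theta> z = \<phi> z * \<psi> z"
  shows "zero_order \<theta> \<alpha> = zero_order \<phi> \<alpha> + zero_order \<psi> \<alpha>"
proof -
  have an: "\<phi> analytic_on {\<alpha>}" "\<psi> analytic_on {\<alpha>}"
    using assms by (auto simp: nonzero_holo_def analytic_at intro!: exI[of _ "ball 0 1"])
  have nz: "\<forall>\<^sub>F z in at \<alpha>. \<phi> z \<noteq> 0" "\<forall>\<^sub>F z in at \<alpha>. \<psi> z \<noteq> 0"
    using nonzero_holo_near[OF assms(1,3)] nonzero_holo_near[OF assms(2,3)]
    by (auto elim: eventually_mono)
  have "zorder (\<lambda>z. \<phi> z * \<psi> z) \<alpha> = zorder \<phi> \<alpha> + zorder \<psi> \<alpha>"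
    using nz by (intro zorder_times_analytic an) (auto elim: eventually_elim2)
  moreover have "zorder \<phi> \<alpha> \<ge> 0" "zorder \<psi> \<alpha> \<ge> 0"
    using nz an by (auto intro!: zorder_ge_0 eventually_frequently at_neq_bot)
  ultimately show ?thesis
    using zero_order_cong[OF assms(4,3)] by (simp add: zero_order_def nat_add_distrib)
qed

section \<open>Inner functions and Blaschke products\<close>

subsection \<open>Inner functions\<close>

abbreviation radial_limit :: "(complex \<Rightarrow> complex) \<Rightarrow> real \<Rightarrow> complex \<Rightarrow> bool" where
  "radial_limit \<phi> t w \<equiv> ((\<lambda>r. \<phi> (complex_of_real r * cis t)) \<longlongrightarrow> w) (at_left 1)"

text \<open>The zero function has radial limits \<open>0\<close>, not of modulus one.\<close>
lemma inner_function_nonzero_holo: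
  assumes "inner_function \<phi>" shows "nonzero_holo \<phi>"
proof -
  have "\<exists>z\<in>ball 0 1. \<phi> z \<noteq> 0"
  proof (rule ccontr)
    assume *: "\<not> (\<exists>z\<in>ball 0 1. \<phi> z \<noteq> 0)"
    have "AE t in lborel. \<exists>w. cmod w = 1 \<and> radial_limit \<phi> t w"
      using assms by (simp add: inner_function_def)
    moreover have "\<not> (\<exists>w. cmod w = 1 \<and> radial_limit \<phi> t w)" for t
    proof safe
      fix w assume w: "cmod w = 1" "radial_limit \<phi> t w"
      have "\<forall>\<^sub>F r in at_left (1::real). r \<in> {0<..<1}"
        by (rule eventually_at_left_real) simp
      then have "\<forall>\<^sub>F r in at_left 1. \<phi> (complex_of_real r * cis t) = 0"
        by eventually_elim (use * in \<open>auto simp: norm_mult\<close>)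
      then have "radial_limit \<phi> t 0"
        by (rule tendsto_eventually)
      then have "w = 0" using tendsto_unique[OF trivial_limit_at_left_real] w(2) by blast
      then show False using w(1) by simp
    qed
    ultimately have "AE t::real in lborel. False" by simp
    then have "ae_filter lborel = (bot :: real filter)" by (simp add: trivial_limit_def)
    then show False by (simp add: ae_filter_eq_bot_iff)
  qed
  then show ?thesis using assms by (auto simp: nonzero_holo_def inner_function_def)
qed

lemma inner_function_bounded:
  assumes "inner_function \<phi>"
  shows "\<exists>C. \<forall>z\<in>ball 0 1. cmod (\<phi> z) \<le> C"
  using assms by (auto simp: inner_function_def bounded_iff)

lemma inner_function_mult:
  assumes "inner_function \<phi>" "inner_function \<psi>" "\<And>z. cmod z < 1 \<Longrightarrow> \<theta> z = \<phi> z * \<psi> z"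
  shows "inner_function \<theta>"
  unfolding inner_function_def
proof (intro conjI)
  have "(\<lambda>z. \<phi> z * \<psi> z) holomorphic_on ball 0 1"
    using assms by (auto simp: inner_function_def intro: holomorphic_on_mult)
  then show "\<theta> holomorphic_on ball 0 1"
    by (rule holomorphic_transform) (use assms(3) in auto)
  obtain C where C: "\<And>z. z \<in> ball 0 1 \<Longrightarrow> cmod (\<phi> z) \<le> C"
    using inner_function_bounded[OF assms(1)] by blast
  obtain D where D: "\<And>z. z \<in> ball 0 1 \<Longrightarrow> cmod (\<psi> z) \<le> D"
    using inner_function_bounded[OF assms(2)] by blast
  have "cmod (\<theta> z) \<le> C * D" if "z \<in> ball 0 1" for z
  proof -
    have "C \<ge> 0" using C[OF that] norm_ge_zero order_trans by blast
    then show ?thesis using C[OF that] D[OF that] that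
      by (simp add: assms(3) norm_mult mult_mono)
  qed
  then show "bounded (\<theta> ` ball 0 1)" unfolding bounded_iff by blast
  have "AE t in lborel. (\<exists>w. cmod w = 1 \<and> radial_limit \<phi> t w)
      \<and> (\<exists>w. cmod w = 1 \<and> radial_limit \<psi> t w)"
    using assms(1,2) by (simp add: inner_function_def)
  then show "AE t in lborel. \<exists>w. cmod w = 1 \<and> radial_limit \<theta> t w"
  proof (rule AE_mp, intro AE_I2 impI, elim conjE exE)
    fix t v w
    assume *: "cmod v = 1" "radial_limit \<phi> t v"
      "cmod w = 1" "radial_limit \<psi> t w"
    have "\<forall>\<^sub>F r in at_left (1::real). r \<in> {0<..<1}" by (rule eventually_at_left_real) simp
    then have "\<forall>\<^sub>F r in at_left 1. \<phi> (complex_of_real r * cis t) * \<psi> (complex_of_real r * cis t)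
        = \<theta> (complex_of_real r * cis t)"
      by eventually_elim (auto simp: assms(3) norm_mult)
    with tendsto_mult[OF *(2,4)] have "radial_limit \<theta> t (v * w)"
      by (rule Lim_transform_eventually)
    then show "\<exists>w. cmod w = 1 \<and> radial_limit \<theta> t w"
      using * by (intro exI[of _ "v * w"]) (simp add: norm_mult)
  qed
qed

lemma inner_dvd_trans:
  assumes "inner_dvd \<phi> \<psi>" "inner_dvd \<psi> \<theta>" shows "inner_dvd \<phi> \<theta>"
proof -
  obtain u v where "inner_function u" "\<And>z. z \<in> ball 0 1 \<Longrightarrow> \<psi> z = \<phi> z * u z"
    "inner_function v" "\<And>z. z \<in> ball 0 1 \<Longrightarrow> \<theta> z = \<psi> z * v z"
    using assms by (auto simp: inner_dvd_def)
  then show ?thesis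
    unfolding inner_dvd_def using inner_function_mult[of u v "\<lambda>z. u z * v z"]
    by (intro exI[of _ "\<lambda>z. u z * v z"]) auto
qed

lemma inner_function_one: "inner_function (\<lambda>_. 1)"
  by (auto simp: inner_function_def bounded_iff intro!: exI[of _ 1])

lemma inner_function_power: "inner_function \<phi> \<Longrightarrow> inner_function (\<lambda>z. \<phi> z ^ l)"
proof (induction l)
  case 0 then show ?case by (simp add: inner_function_one)
next
  case (Suc l)
  show ?case
    by (rule inner_function_mult[of \<phi> "\<lambda>z. \<phi> z ^ l"]) (use Suc in auto)
qed

lemma blaschke_factor_holomorphic:
  "cmod \<alpha> < 1 \<Longrightarrow> blaschke_factor \<alpha> holomorphic_on ball 0 1"
  unfolding blaschke_factor_def using one_minus_cnj_mult_nonzero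
  by (intro holomorphic_intros) auto

lemma blaschke_factor_eq_0_iff:
  "cmod \<alpha> < 1 \<Longrightarrow> cmod z < 1 \<Longrightarrow> blaschke_factor \<alpha> z = 0 \<longleftrightarrow> z = \<alpha>"
  using one_minus_cnj_mult_nonzero by (auto simp: blaschke_factor_def)

lemma blaschke_factor_isCont: "cmod \<alpha> < 1 \<Longrightarrow> cmod z < 1 \<Longrightarrow> isCont (blaschke_factor \<alpha>) z"
  using holomorphic_on_imp_continuous_on[OF blaschke_factor_holomorphic]
  by (simp add: continuous_on_eq_continuous_at)

lemma blaschke_norm_identity:
  "(cmod (1 - cnj \<alpha> * z))\<^sup>2 - (cmod (z - \<alpha>))\<^sup>2 = (1 - (cmod \<alpha>)\<^sup>2) * (1 - (cmod z)\<^sup>2)"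
  by (simp add: cmod_power2) (simp add: power2_eq_square algebra_simps)

lemma blaschke_factor_radial_limit:
  assumes "cmod \<alpha> < 1"
  shows "radial_limit (blaschke_factor \<alpha>) t (blaschke_factor \<alpha> (cis t))"
    and "cmod (blaschke_factor \<alpha> (cis t)) = 1"
proof -
  have nz: "1 - cnj \<alpha> * cis t \<noteq> 0"
  proof
    assume "1 - cnj \<alpha> * cis t = 0"
    then have "cmod (cnj \<alpha> * cis t) = 1" by (metis eq_iff_diff_eq_0 norm_one)
    then show False using assms by (simp add: norm_mult)
  qed
  have "((\<lambda>r. complex_of_real r * cis t) \<longlongrightarrow> complex_of_real 1 * cis t) (at_left 1)"
    by (intro tendsto_intros)
  then show "radial_limit (blaschke_factor \<alpha>) t (blaschke_factor \<alpha> (cis t))"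
    unfolding blaschke_factor_def using nz by (intro tendsto_intros) auto
  have "(cmod (1 - cnj \<alpha> * cis t))\<^sup>2 = (cmod (cis t - \<alpha>))\<^sup>2"
    using blaschke_norm_identity[of \<alpha> "cis t"] by simp
  then have eq: "cmod (cis t - \<alpha>) = cmod (1 - cnj \<alpha> * cis t)" by (simp add: power2_eq_iff_nonneg)
  then show "cmod (blaschke_factor \<alpha> (cis t)) = 1"
    using nz unfolding blaschke_factor_def norm_divide eq by simp
qed

lemma cmod_blaschke_factor_le: assumes "cmod \<alpha> < 1" "cmod z < 1" shows "cmod (blaschke_factor \<alpha> z) \<le> 1"
proof -
  have "(1 - (cmod \<alpha>)\<^sup>2) * (1 - (cmod z)\<^sup>2) \<ge> 0"
    using assms by (intro mult_nonneg_nonneg) (auto simp: power_le_one)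
  then have "(cmod (z - \<alpha>))\<^sup>2 \<le> (cmod (1 - cnj \<alpha> * z))\<^sup>2"
    using blaschke_norm_identity[of \<alpha> z] by linarith
  then have "cmod (z - \<alpha>) \<le> cmod (1 - cnj \<alpha> * z)" by (rule power2_le_imp_le) simp
  then show ?thesis by (simp add: blaschke_factor_def norm_divide divide_le_eq_1)
qed

lemma inner_function_blaschke_factor:
  assumes "cmod \<alpha> < 1" shows "inner_function (blaschke_factor \<alpha>)"
  unfolding inner_function_def
proof (intro conjI AE_I2)
  show "bounded (blaschke_factor \<alpha> ` ball 0 1)"
    using cmod_blaschke_factor_le[OF assms] by (auto simp: bounded_iff intro!: exI[of _ 1])
  show "\<exists>w. cmod w = 1 \<and> radial_limit (blaschke_factor \<alpha>) t w" for t
    using blaschke_factor_radial_limit[OF assms] by blast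
qed (rule blaschke_factor_holomorphic[OF assms])

lemma zero_order_blaschke_factor:
  assumes "cmod \<alpha> < 1" "cmod \<beta> < 1"
  shows "zero_order (blaschke_factor \<alpha>) \<beta> = (if \<beta> = \<alpha> then 1 else 0)"
proof (cases "\<beta> = \<alpha>")
  case True
  have "zorder (blaschke_factor \<alpha>) \<alpha> = 1"
  proof (rule zorder_eqI[where S = "ball 0 1" and g = "\<lambda>z. 1 / (1 - cnj \<alpha> * z)"])
    show "(\<lambda>z. 1 / (1 - cnj \<alpha> * z)) holomorphic_on ball 0 1"
      using one_minus_cnj_mult_nonzero[OF assms(1)] by (intro holomorphic_intros) auto
  qed (use assms one_minus_cnj_mult_nonzero[of \<alpha> \<alpha>] in \<open>auto simp: blaschke_factor_def\<close>)
  then show ?thesis using True by (simp add: zero_order_def)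
next
  case False
  then show ?thesis
    using zero_order_factor(1)[OF inner_function_nonzero_holo[OF inner_function_blaschke_factor[OF assms(1)]] assms(2)]
      blaschke_factor_eq_0_iff[OF assms] by auto
qed

text \<open>Near the circle the Blaschke factor is bounded below, and elsewhere compactness gives a bound; so the
  quotient of an inner function by the factor of one of its zeros is again bounded, and its radial limits
  still have modulus one.\<close>
lemma inner_dvd_blaschke_factor_iff:
  assumes "inner_function \<phi>" and \<alpha>: "cmod \<alpha> < 1"
  shows "inner_dvd (blaschke_factor \<alpha>) \<phi> \<longleftrightarrow> \<phi> \<alpha> = 0"
proof
  assume "inner_dvd (blaschke_factor \<alpha>) \<phi>"
  then show "\<phi> \<alpha> = 0" using \<alpha> by (auto simp: inner_dvd_def blaschke_factor_def)
next
  assume 0: "\<phi> \<alpha> = 0"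
  have hol: "\<phi> holomorphic_on ball 0 1" using assms by (simp add: inner_function_def)
  define F where "F z = (if z = \<alpha> then deriv \<phi> \<alpha> else (\<phi> z - \<phi> \<alpha>) / (z - \<alpha>))" for z
  define \<theta> where "\<theta> z = F z * (1 - cnj \<alpha> * z)" for z
  have "F holomorphic_on ball 0 1"
    unfolding F_def by (rule pole_lemma[OF hol]) (use \<alpha> in simp)
  then have \<theta>h: "\<theta> holomorphic_on ball 0 1" unfolding \<theta>_def by (intro holomorphic_intros)
  have eq: "\<phi> z = blaschke_factor \<alpha> z * \<theta> z" if "z \<in> ball 0 1" for z
    using that one_minus_cnj_mult_nonzero[OF \<alpha>, of z] 0
    by (auto simp: \<theta>_def F_def blaschke_factor_def)
  obtain C where C: "\<And>z. z \<in> ball 0 1 \<Longrightarrow> cmod (\<phi> z) \<le> C"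
    using inner_function_bounded[OF assms(1)] by blast
  \<comment> \<open>Outside the disc of radius \<open>\<rho>\<close> the Blaschke factor is at least \<open>(1 - cmod \<alpha>) / 4\<close>.\<close>
  define \<rho> where "\<rho> = (1 + cmod \<alpha>) / 2"
  have \<rho>: "cmod \<alpha> < \<rho>" "\<rho> < 1" using \<alpha> by (auto simp: \<rho>_def)
  have "compact (\<theta> ` cball 0 \<rho>)"
    using \<rho> by (intro compact_continuous_image holomorphic_on_imp_continuous_on
        holomorphic_on_subset[OF \<theta>h]) auto
  then obtain D where D: "\<And>z. z \<in> cball 0 \<rho> \<Longrightarrow> cmod (\<theta> z) \<le> D"
    using compact_imp_bounded by (fastforce simp: bounded_iff)
  have bd: "cmod (\<theta> z) \<le> max D (C * 4 / (1 - cmod \<alpha>))" if z: "z \<in> ball 0 1" for z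
  proof (cases "z \<in> cball 0 \<rho>")
    case True then show ?thesis using D by (simp add: le_max_iff_disj)
  next
    case False
    have "(1 - cmod \<alpha>) / 2 \<le> cmod (z - \<alpha>)"
      using False norm_triangle_ineq2[of z \<alpha>] by (simp add: \<rho>_def field_simps)
    moreover have "cmod (1 - cnj \<alpha> * z) \<le> 2"
    proof -
      have "cmod (1 - cnj \<alpha> * z) \<le> cmod 1 + cmod (cnj \<alpha> * z)" by (rule norm_triangle_ineq4)
      also have "cmod (cnj \<alpha> * z) \<le> 1" using \<alpha> z by (simp add: norm_mult mult_le_one)
      finally show ?thesis by simp
    qed
    moreover have "cmod (1 - cnj \<alpha> * z) > 0" using one_minus_cnj_mult_nonzero[OF \<alpha>, of z] z by simp
    ultimately have "(1 - cmod \<alpha>) / 2 / 2 \<le> cmod (blaschke_factor \<alpha> z)"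
      unfolding blaschke_factor_def norm_divide using \<alpha> by (intro frac_le) auto
    then have "(1 - cmod \<alpha>) / 4 * cmod (\<theta> z) \<le> cmod (blaschke_factor \<alpha> z) * cmod (\<theta> z)"
      by (intro mult_right_mono) auto
    also have "\<dots> \<le> C" using C[OF z] by (simp add: eq[OF z] norm_mult)
    finally show ?thesis using \<alpha> by (simp add: le_max_iff_disj field_simps)
  qed
  have "AE t in lborel. \<exists>w. cmod w = 1 \<and> radial_limit \<phi> t w"
    using assms(1) by (simp add: inner_function_def)
  then have "AE t in lborel. \<exists>w. cmod w = 1 \<and> radial_limit \<theta> t w"
  proof (rule AE_mp, intro AE_I2 impI, elim conjE exE)
    fix t w
    assume w: "cmod w = 1" "radial_limit \<phi> t w"
    let ?b = "\<lambda>r. blaschke_factor \<alpha> (complex_of_real r * cis t)"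
    note b = blaschke_factor_radial_limit[OF \<alpha>, of t]
    have b0: "blaschke_factor \<alpha> (cis t) \<noteq> 0" using b(2) by (metis norm_zero zero_neq_one)
    have "\<forall>\<^sub>F r in at_left (1::real). r \<in> {0<..<1}" by (rule eventually_at_left_real) simp
    with tendsto_imp_eventually_ne[OF b(1) b0]
    have "\<forall>\<^sub>F r in at_left 1. \<phi> (complex_of_real r * cis t) / ?b r = \<theta> (complex_of_real r * cis t)"
      by eventually_elim (auto simp: eq norm_mult)
    with tendsto_divide[OF w(2) b(1) b0]
    have "radial_limit \<theta> t (w / blaschke_factor \<alpha> (cis t))"
      by (rule Lim_transform_eventually)
    then show "\<exists>w. cmod w = 1 \<and> radial_limit \<theta> t w"
      using w(1) b(2) by (intro exI[of _ "w / blaschke_factor \<alpha> (cis t)"]) (simp add: norm_divide)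
  qed
  then have "inner_function \<theta>"
    unfolding inner_function_def bounded_iff using \<theta>h bd by blast
  then show "inner_dvd (blaschke_factor \<alpha>) \<phi>" unfolding inner_dvd_def using eq by blast
qed

lemma blaschke_factor_not_constant:
  assumes "cmod \<alpha> < 1" shows "\<not> blaschke_factor \<alpha> constant_on ball 0 1"
proof
  assume "blaschke_factor \<alpha> constant_on ball 0 1"
  then have c: "\<And>z w. cmod z < 1 \<Longrightarrow> cmod w < 1 \<Longrightarrow> blaschke_factor \<alpha> z = blaschke_factor \<alpha> w"
    unfolding constant_on_def by (metis dist_0_norm mem_ball)
  define z where "z = complex_of_real (if \<alpha> = 0 then 1 / 2 else 0)"
  have "cmod z < 1" "z \<noteq> \<alpha>" by (auto simp: z_def)
  then show False using c[of z \<alpha>] assms blaschke_factor_eq_0_iff by metis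
qed

subsection \<open>Prime parts, orders and quotients\<close>

lemma blaschke_factor_inject:
  assumes "cmod \<alpha> < 1" "cmod \<beta> < 1" "blaschke_factor \<alpha> = blaschke_factor \<beta>" shows "\<alpha> = \<beta>"
  using assms blaschke_factor_eq_0_iff by metis

lemma prime_part_power:
  assumes "cmod \<alpha> < 1" "l \<ge> 1"
  shows "prime_part (\<lambda>z. blaschke_factor \<alpha> z ^ l) = blaschke_factor \<alpha>"
  unfolding prime_part_def
proof (rule the_equality)
  show "\<exists>\<beta>\<in>ball 0 1. \<exists>l'\<ge>1. (\<lambda>z. blaschke_factor \<alpha> z ^ l) = (\<lambda>z. blaschke_factor \<beta> z ^ l') \<and>
      blaschke_factor \<alpha> = blaschke_factor \<beta>" using assms by auto
next
  fix b assume "\<exists>\<beta>\<in>ball 0 1. \<exists>l'\<ge>1. (\<lambda>z. blaschke_factor \<alpha> z ^ l) = (\<lambda>z. blaschke_factor \<beta> z ^ l') \<and>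
      b = blaschke_factor \<beta>"
  then obtain \<beta> l' where *: "cmod \<beta> < 1" "l' \<ge> 1" "b = blaschke_factor \<beta>"
    "\<And>z. blaschke_factor \<alpha> z ^ l = blaschke_factor \<beta> z ^ l'" by (auto simp: fun_eq_iff)
  have "blaschke_factor \<alpha> \<beta> ^ l = 0" using *(2) by (simp add: *(4) blaschke_factor_def[of \<beta>])
  then have "\<beta> = \<alpha>" using blaschke_factor_eq_0_iff[OF assms(1) *(1)] by simp
  then show "b = blaschke_factor \<alpha>" by (simp add: *(3))
qed

lemma factor_order_blaschke_factor:
  assumes "cmod \<alpha> < 1" shows "factor_order \<phi> (blaschke_factor \<alpha>) = zero_order \<phi> \<alpha>"
proof -
  have "(THE \<beta>. \<beta> \<in> ball 0 1 \<and> blaschke_factor \<alpha> = blaschke_factor \<beta>) = \<alpha>"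
    by (rule the_equality) (use assms blaschke_factor_inject in auto)
  then show ?thesis by (simp add: factor_order_def zero_order_def)
qed

lemma inner_dvd_zero_order_le:
  assumes "inner_dvd \<psi> \<phi>" "inner_function \<psi>" "cmod \<alpha> < 1"
  shows "zero_order \<psi> \<alpha> \<le> zero_order \<phi> \<alpha>"
proof -
  obtain \<theta> where "inner_function \<theta>" "\<And>z. cmod z < 1 \<Longrightarrow> \<phi> z = \<psi> z * \<theta> z"
    using assms(1) by (auto simp: inner_dvd_def)
  then show ?thesis
    using zero_order_mult[of \<psi> \<theta> \<alpha> \<phi>] assms by (simp add: inner_function_nonzero_holo)
qed

lemma inner_dvd_factor_iff_order:
  assumes "inner_function \<phi>" "cmod \<alpha> < 1"
  shows "inner_dvd (blaschke_factor \<alpha>) \<phi> \<longleftrightarrow> 0 < zero_order \<phi> \<alpha>"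
  using inner_dvd_blaschke_factor_iff[OF assms]
    zero_order_factor(1)[OF inner_function_nonzero_holo[OF assms(1)] assms(2)] by simp

lemma inner_dvd_quot_iff:
  assumes "inner_dvd \<psi> \<phi>" "inner_function \<psi>" "cmod \<alpha> < 1"
  shows "inner_dvd (blaschke_factor \<alpha>) (inner_quot \<phi> \<psi>) \<longleftrightarrow> zero_order \<psi> \<alpha> < zero_order \<phi> \<alpha>"
proof -
  define \<theta> where "\<theta> = inner_quot \<phi> \<psi>"
  have \<theta>: "inner_function \<theta> \<and> (\<forall>z\<in>ball 0 1. \<phi> z = \<psi> z * \<theta> z)"
    using someI_ex[OF assms(1)[unfolded inner_dvd_def]] unfolding \<theta>_def inner_quot_def .
  then have "zero_order \<phi> \<alpha> = zero_order \<psi> \<alpha> + zero_order \<theta> \<alpha>"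
    using assms(2,3) by (intro zero_order_mult) (auto simp: inner_function_nonzero_holo)
  then show ?thesis
    using inner_dvd_factor_iff_order[of \<theta> \<alpha>] \<theta> assms(3) by (simp add: \<theta>_def[symmetric])
qed

subsection \<open>Divisibility by Blaschke products in the Hardy space\<close>

text \<open>This turns vanishing coefficients into a local condition, which can be transported through products
  and quotients.\<close>
lemma vanish_iff_local_factor:
  assumes "cmod \<alpha> < 1"
  shows "(\<forall>j<l. taylor f \<alpha> j = 0) \<longleftrightarrow>
    (\<exists>F. isCont F \<alpha> \<and> (\<forall>\<^sub>F z in at \<alpha>. disc_eval f z = (z - \<alpha>) ^ l * F z))"
proof safe
  assume "\<forall>j<l. taylor f \<alpha> j = 0"
  then obtain h where h: "f = (linmult \<alpha> ^^ l) h"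
    using cinner_jordan_vanish_imp[OF assms] by blast
  have ev: "disc_eval ((linmult \<alpha> ^^ l) h) z = (z - \<alpha>) ^ l * disc_eval h z" if "cmod z < 1" for z
    using that by (induction l) (auto simp: disc_eval_linmult)
  have "\<forall>\<^sub>F z in at \<alpha>. z \<in> ball 0 1 \<and> z \<noteq> \<alpha>"
    using eventually_punctured_disc[OF assms(1)] .
  then have "\<forall>\<^sub>F z in at \<alpha>. disc_eval f z = (z - \<alpha>) ^ l * disc_eval h z"
    by eventually_elim (auto simp: ev h)
  then show "\<exists>F. isCont F \<alpha> \<and> (\<forall>\<^sub>F z in at \<alpha>. disc_eval f z = (z - \<alpha>) ^ l * F z)"
    using disc_eval_isCont[OF assms] by blast
next
  fix F j assume F: "isCont F \<alpha>" "\<forall>\<^sub>F z in at \<alpha>. disc_eval f z = (z - \<alpha>) ^ l * F z" and j: "j < l"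
  obtain h where "f = (linmult \<alpha> ^^ l) h" using divide_linear_power[OF assms F] by blast
  then show "taylor f \<alpha> j = 0"
    using j by (simp add: cinner_linmult_power[OF assms])
qed


lemma vanish_cancel:
  assumes "cmod \<alpha> < 1" "isCont u \<alpha>" "u \<alpha> \<noteq> 0"
    and "\<And>z. cmod z < 1 \<Longrightarrow> disc_eval g z = u z * disc_eval f z"
    and "\<And>j. j < l \<Longrightarrow> taylor g \<alpha> j = 0" "j < l"
  shows "taylor f \<alpha> j = 0"
proof -
  obtain F where F: "isCont F \<alpha>" "\<forall>\<^sub>F z in at \<alpha>. disc_eval g z = (z - \<alpha>) ^ l * F z"
    using vanish_iff_local_factor[OF assms(1)] assms(5) by blast
  have "\<forall>\<^sub>F z in at \<alpha>. z \<in> ball 0 1 \<and> z \<noteq> \<alpha>"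
    using eventually_punctured_disc[OF assms(1)] .
  moreover have "\<forall>\<^sub>F z in at \<alpha>. u z \<noteq> 0"
    using assms(2,3) by (intro tendsto_imp_eventually_ne[of u "u \<alpha>"]) (auto simp: isCont_def)
  ultimately have "\<forall>\<^sub>F z in at \<alpha>. disc_eval f z = (z - \<alpha>) ^ l * (F z / u z)"
    using F(2) by eventually_elim (auto simp: assms(4) field_simps)
  moreover have "isCont (\<lambda>z. F z / u z) \<alpha>" using F assms(2,3) by (intro continuous_intros)
  ultimately show ?thesis using vanish_iff_local_factor[OF assms(1), of l f] assms(6) by blast
qed

text \<open>After one division the local cofactor is \<open>(1 - cnj \<alpha> * z) * F z\<close>, with one power of \<open>z - \<alpha>\<close> less.\<close>
lemma divide_blaschke_power:
  assumes \<alpha>: "cmod \<alpha> < 1" and "\<And>j. j < l \<Longrightarrow> taylor f \<alpha> j = 0"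
  obtains h where "norm h = norm f" "\<And>z. cmod z < 1 \<Longrightarrow> disc_eval f z = blaschke_factor \<alpha> z ^ l * disc_eval h z"
  using assms(2)
proof (induction l arbitrary: f thesis)
  case 0 then show ?case by (metis lambda_one power_0)
next
  case (Suc l)
  have "disc_eval f \<alpha> = 0" using Suc.prems(2)[of 0] \<alpha> by (simp add: disc_eval_cinner)
  then obtain g where g: "norm g = norm f"
    "\<And>z. cmod z < 1 \<Longrightarrow> disc_eval f z = blaschke_factor \<alpha> z * disc_eval g z"
    using divide_blaschke_factor[OF \<alpha>] by blast
  obtain F where F: "isCont F \<alpha>" "\<forall>\<^sub>F z in at \<alpha>. disc_eval f z = (z - \<alpha>) ^ Suc l * F z"
    using vanish_iff_local_factor[OF \<alpha>, of "Suc l" f] Suc.prems(2) by blast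
  have "\<forall>\<^sub>F z in at \<alpha>. z \<in> ball 0 1 \<and> z \<noteq> \<alpha>"
    by (rule eventually_punctured_disc[OF \<alpha>])
  with F(2) have "\<forall>\<^sub>F z in at \<alpha>. disc_eval g z = (z - \<alpha>) ^ l * ((1 - cnj \<alpha> * z) * F z)"
  proof eventually_elim
    case (elim z)
    then have "(z - \<alpha>) * (disc_eval g z / (1 - cnj \<alpha> * z)) = (z - \<alpha>) * ((z - \<alpha>) ^ l * F z)"
      using g(2)[of z] by (simp add: blaschke_factor_def mult.assoc)
    moreover have "z - \<alpha> \<noteq> 0" using elim by simp
    ultimately have "disc_eval g z / (1 - cnj \<alpha> * z) = (z - \<alpha>) ^ l * F z"
      using mult_left_cancel by blast
    then show ?case
      using elim one_minus_cnj_mult_nonzero[OF \<alpha>, of z] by (simp add: divide_eq_eq mult_ac)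
  qed
  moreover have "isCont (\<lambda>z. (1 - cnj \<alpha> * z) * F z) \<alpha>" using F(1) by (intro continuous_intros)
  ultimately have "\<And>j. j < l \<Longrightarrow> taylor g \<alpha> j = 0"
    using vanish_iff_local_factor[OF \<alpha>, of l g] by blast
  from Suc.IH[OF _ this] obtain h where "norm h = norm g"
    "\<And>z. cmod z < 1 \<Longrightarrow> disc_eval g z = blaschke_factor \<alpha> z ^ l * disc_eval h z" by blast
  then show ?case using Suc.prems(1)[of h] g by simp
qed

lemma multiply_blaschke_power:
  assumes \<alpha>: "cmod \<alpha> < 1"
  obtains f where "norm f = norm g" "\<And>z. cmod z < 1 \<Longrightarrow> disc_eval f z = blaschke_factor \<alpha> z ^ l * disc_eval g z"
proof (induction l arbitrary: thesis)
  case 0 then show ?case by (metis lambda_one power_0)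
next
  case (Suc l)
  obtain f where f: "norm f = norm g"
    "\<And>z. cmod z < 1 \<Longrightarrow> disc_eval f z = blaschke_factor \<alpha> z ^ l * disc_eval g z" using Suc.IH by blast
  obtain f' where "norm f' = norm f"
    "\<And>z. cmod z < 1 \<Longrightarrow> disc_eval f' z = blaschke_factor \<alpha> z * disc_eval f z"
    using multiply_blaschke_factor[OF \<alpha>] by blast
  then show ?case using Suc.prems[of f'] f by simp
qed

text \<open>Fixing the unimodular constants, over which the definition of an expansion quantifies
  existentially, makes the finite partial products definite functions.\<close>
locale blaschke_data =
  fixes \<phi> :: "complex \<Rightarrow> complex" and M :: "nat set" and \<alpha> :: "nat \<Rightarrow> complex"
    and l :: "nat \<Rightarrow> nat" and c :: "nat \<Rightarrow> complex"
  assumes inner: "inner_function \<phi>" and inj: "inj_on \<alpha> M"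
    and disc: "\<And>m. m \<in> M \<Longrightarrow> cmod (\<alpha> m) < 1" and mult: "\<And>m. m \<in> M \<Longrightarrow> 1 \<le> l m"
    and unimod: "\<And>m. m \<in> M \<Longrightarrow> cmod (c m) = 1"
    and lim: "\<And>z. cmod z < 1 \<Longrightarrow>
      (\<lambda>N. \<Prod>m\<in>M \<inter> {..<N}. c m * blaschke_factor (\<alpha> m) z ^ l m) \<longlonglongrightarrow> \<phi> z"
begin

definition partial :: "nat set \<Rightarrow> complex \<Rightarrow> complex" where
  "partial F z = (\<Prod>m\<in>F. c m * blaschke_factor (\<alpha> m) z ^ l m)"

lemma partial_insert: "finite F \<Longrightarrow> m \<notin> F \<Longrightarrow>
    partial (insert m F) z = c m * blaschke_factor (\<alpha> m) z ^ l m * partial F z"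
  by (simp add: partial_def)

lemma partial_multiply:
  assumes "finite F" "F \<subseteq> M"
  shows "\<exists>f. norm f = norm g \<and> (\<forall>z. cmod z < 1 \<longrightarrow> disc_eval f z = partial F z * disc_eval g z)"
  using assms
proof (induction F rule: finite_induct)
  case empty then show ?case by (intro exI[of _ g]) (simp add: partial_def)
next
  case (insert m F)
  then obtain f where f: "norm f = norm g"
    "\<And>z. cmod z < 1 \<Longrightarrow> disc_eval f z = partial F z * disc_eval g z" by auto
  obtain f' where "norm f' = norm f"
    "\<And>z. cmod z < 1 \<Longrightarrow> disc_eval f' z = blaschke_factor (\<alpha> m) z ^ l m * disc_eval f z"
    using multiply_blaschke_power[OF disc] insert.prems by blast
  then show ?case using insert f unimod[of m]
    by (intro exI[of _ "cscale (c m) f'"]) (auto simp: norm_cscale disc_eval_cscale partial_insert)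
qed

lemma partial_isCont: "F \<subseteq> M \<Longrightarrow> cmod z < 1 \<Longrightarrow> isCont (partial F) z"
  unfolding partial_def by (intro continuous_intros blaschke_factor_isCont) (auto intro: disc)

lemma partial_nonzero:
  assumes "finite F" "F \<subseteq> M" "cmod z < 1" "\<And>m. m \<in> F \<Longrightarrow> z \<noteq> \<alpha> m"
  shows "partial F z \<noteq> 0"
  unfolding partial_def
proof (subst prod_zero_iff[OF assms(1)], safe)
  fix m assume "m \<in> F" "c m * blaschke_factor (\<alpha> m) z ^ l m = 0"
  then show False using unimod[of m] assms disc[of m] by (auto simp: blaschke_factor_eq_0_iff)
qed

text \<open>The zeros are distinct, so the product over \<open>F\<close> does not vanish at the next zero and can be
  cancelled there.\<close>
lemma partial_divide:
  assumes "finite F" "F \<subseteq> M"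
    and q: "\<And>m j. m \<in> M \<Longrightarrow> j < l m \<Longrightarrow> taylor q (\<alpha> m) j = 0"
  shows "\<exists>h. norm h = norm q \<and> (\<forall>z. cmod z < 1 \<longrightarrow> disc_eval q z = partial F z * disc_eval h z)"
  using assms(1,2)
proof (induction F rule: finite_induct)
  case empty then show ?case by (intro exI[of _ q]) (simp add: partial_def)
next
  case (insert m F)
  then obtain h where h: "norm h = norm q"
    "\<And>z. cmod z < 1 \<Longrightarrow> disc_eval q z = partial F z * disc_eval h z" by auto
  have m: "m \<in> M" "F \<subseteq> M" using insert.prems by auto
  have "partial F (\<alpha> m) \<noteq> 0"
    using insert.hyps m inj disc[of m] by (intro partial_nonzero) (auto simp: inj_on_def)
  then have "taylor h (\<alpha> m) j = 0" if "j < l m" for j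
    using vanish_cancel[OF disc[OF m(1)] partial_isCont[OF m(2) disc[OF m(1)]] _ h(2) q[OF m(1)] that]
    by blast
  then obtain h' where h': "norm h' = norm h"
    "\<And>z. cmod z < 1 \<Longrightarrow> disc_eval h z = blaschke_factor (\<alpha> m) z ^ l m * disc_eval h' z"
    using divide_blaschke_power[OF disc[OF m(1)]] by blast
  have "c m \<noteq> 0" using unimod[OF m(1)] by auto
  then show ?case using insert h h' unimod[OF m(1)]
    by (intro exI[of _ "cscale (1 / c m) h'"])
      (auto simp: norm_cscale norm_divide disc_eval_cscale partial_insert)
qed

lemma lim_partial: "cmod z < 1 \<Longrightarrow> (\<lambda>N. partial (M \<inter> {..<N}) z) \<longlonglongrightarrow> \<phi> z"
  unfolding partial_def by (rule lim)

text \<open>The finite quotients have constant norm, and a weak limit of them is the full quotient.\<close>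
lemma divide:
  assumes q: "\<And>m j. m \<in> M \<Longrightarrow> j < l m \<Longrightarrow> taylor q (\<alpha> m) j = 0"
  obtains h where "\<And>z. cmod z < 1 \<Longrightarrow> disc_eval q z = \<phi> z * disc_eval h z"
proof -
  have "\<exists>h. norm h = norm q \<and>
      (\<forall>z. cmod z < 1 \<longrightarrow> disc_eval q z = partial (M \<inter> {..<N}) z * disc_eval h z)" for N
    by (rule partial_divide) (use q in auto)
  then obtain H where H: "\<And>N. norm (H N) = norm q"
    "\<And>N z. cmod z < 1 \<Longrightarrow> disc_eval q z = partial (M \<inter> {..<N}) z * disc_eval (H N) z" by metis
  obtain r h where r: "strict_mono r" "\<And>g. (\<lambda>n. cinner (H (r n)) g) \<longlonglongrightarrow> cinner h g"
    using weakly_convergent_subsequence[of H "norm q"] H(1) by (metis order_refl)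
  have "disc_eval q z = \<phi> z * disc_eval h z" if z: "cmod z < 1" for z
  proof -
    have "(\<lambda>n. partial (M \<inter> {..<r n}) z * disc_eval (H (r n)) z) \<longlonglongrightarrow> \<phi> z * disc_eval h z"
      using r(2)[of "jordan (cnj z) 0"] LIMSEQ_subseq_LIMSEQ[OF lim_partial[OF z] r(1)] z
      by (intro tendsto_mult) (auto simp: disc_eval_cinner o_def)
    then show ?thesis unfolding H(2)[OF z, symmetric] by (simp add: LIMSEQ_const_iff)
  qed
  then show thesis using that by blast
qed

text \<open>The finite products are images of the constant \<open>1\<close> under isometries, so they have a weak limit
  in the space; vanishing coefficients pass to this limit.\<close>
lemma hardy_representative:
  obtains f where "\<And>z. cmod z < 1 \<Longrightarrow> disc_eval f z = \<phi> z"
    "\<And>m j. m \<in> M \<Longrightarrow> j < l m \<Longrightarrow> taylor f (\<alpha> m) j = 0"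
proof -
  have "\<exists>h. norm h = norm (ell2_delta (0::nat)) \<and> (\<forall>z. cmod z < 1 \<longrightarrow>
      disc_eval h z = partial (M \<inter> {..<N}) z * disc_eval (ell2_delta 0) z)" for N
    by (rule partial_multiply) auto
  then have "\<exists>h. norm h = 1 \<and> (\<forall>z. cmod z < 1 \<longrightarrow> disc_eval h z = partial (M \<inter> {..<N}) z)" for N
    by (simp add: disc_eval_delta_0)
  then obtain X where X: "\<And>N. norm (X N) = 1"
    "\<And>N z. cmod z < 1 \<Longrightarrow> disc_eval (X N) z = partial (M \<inter> {..<N}) z" by metis
  obtain r f where r: "strict_mono r" "\<And>g. (\<lambda>n. cinner (X (r n)) g) \<longlonglongrightarrow> cinner f g"
    using weakly_convergent_subsequence[of X 1] X(1) by (metis order_refl)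
  show thesis
  proof (rule that)
    fix z :: complex assume z: "cmod z < 1"
    have "(\<lambda>n. disc_eval (X (r n)) z) \<longlonglongrightarrow> disc_eval f z"
      using r(2)[of "jordan (cnj z) 0"] z by (simp add: disc_eval_cinner)
    moreover have "(\<lambda>n. disc_eval (X (r n)) z) \<longlonglongrightarrow> \<phi> z"
      using LIMSEQ_subseq_LIMSEQ[OF lim_partial[OF z] r(1)] z by (simp add: X o_def)
    ultimately show "disc_eval f z = \<phi> z" by (rule LIMSEQ_unique)
  next
    fix m j assume m: "m \<in> M" "j < l m"
    have "taylor (X N) (\<alpha> m) j = 0" if N: "m < N" for N
    proof -
      let ?F = "M \<inter> {..<N} - {m}"
      obtain g where g: "\<And>z. cmod z < 1 \<Longrightarrow> disc_eval g z = partial ?F z * disc_eval (ell2_delta 0) z"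
        using partial_multiply[of ?F "ell2_delta 0"] by auto
      have "M \<inter> {..<N} = insert m ?F" using m N by auto
      then have "partial (M \<inter> {..<N}) z = c m * blaschke_factor (\<alpha> m) z ^ l m * partial ?F z" for z
        using partial_insert[of ?F m z] by simp
      then have eq: "disc_eval (X N) z = blaschke_factor (\<alpha> m) z ^ l m * (c m * disc_eval g z)"
        if "cmod z < 1" for z
        using that by (simp add: X g disc_eval_delta_0)
      have "\<forall>\<^sub>F z in at (\<alpha> m). z \<in> ball 0 1 \<and> z \<noteq> \<alpha> m"
        by (rule eventually_punctured_disc[OF disc[OF m(1)]])
      then have "\<forall>\<^sub>F z in at (\<alpha> m). disc_eval (X N) z
          = (z - \<alpha> m) ^ l m * (c m * disc_eval g z / (1 - cnj (\<alpha> m) * z) ^ l m)"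
        by eventually_elim (auto simp: eq blaschke_factor_def power_divide)
      moreover have "isCont (\<lambda>z. c m * disc_eval g z / (1 - cnj (\<alpha> m) * z) ^ l m) (\<alpha> m)"
        using disc[OF m(1)] one_minus_cnj_mult_nonzero[of "\<alpha> m" "\<alpha> m"]
        by (intro continuous_intros disc_eval_isCont) auto
      ultimately show ?thesis using vanish_iff_local_factor[OF disc[OF m(1)], of "l m" "X N"] m(2) by blast
    qed
    then have "\<forall>\<^sub>F n in sequentially. taylor (X (r n)) (\<alpha> m) j = 0"
      using seq_suble[OF r(1)] by (intro eventually_sequentiallyI[of "Suc m"]) (meson less_le_trans Suc_le_lessD)
    then have "(\<lambda>n. taylor (X (r n)) (\<alpha> m) j) \<longlonglongrightarrow> 0" by (rule tendsto_eventually)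
    then show "taylor f (\<alpha> m) j = 0" using r(2) LIMSEQ_unique by blast
  qed
qed

lemma multiplicity_le_zero_order: "m \<in> M \<Longrightarrow> l m \<le> zero_order \<phi> (\<alpha> m)"
proof (rule ccontr)
  assume m: "m \<in> M" "\<not> l m \<le> zero_order \<phi> (\<alpha> m)"
  obtain f where "\<And>z. cmod z < 1 \<Longrightarrow> disc_eval f z = \<phi> z"
    "\<And>m j. m \<in> M \<Longrightarrow> j < l m \<Longrightarrow> taylor f (\<alpha> m) j = 0"
    by (rule hardy_representative) (rule that; assumption)
  then show False
    using cinner_jordan_zero_order(2)[OF inner_function_nonzero_holo[OF inner] disc[OF m(1)], of f] m by auto
qed

text \<open>If a Blaschke product vanished at a further point, dividing by its Blaschke factor would give a
  function still divisible by the whole product, and the Blaschke factor would be invertible.\<close>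
lemma zeros_subset: assumes z: "cmod z < 1" "\<phi> z = 0" shows "z \<in> \<alpha> ` M"
proof (rule ccontr)
  assume nz: "z \<notin> \<alpha> ` M"
  obtain f where f: "\<And>z. cmod z < 1 \<Longrightarrow> disc_eval f z = \<phi> z"
    "\<And>m j. m \<in> M \<Longrightarrow> j < l m \<Longrightarrow> taylor f (\<alpha> m) j = 0"
    by (rule hardy_representative) (rule that; assumption)
  have "disc_eval f z = 0" using f z by simp
  then obtain g where g: "\<And>w. cmod w < 1 \<Longrightarrow> disc_eval f w = blaschke_factor z w * disc_eval g w"
    using divide_blaschke_factor[OF z(1)] by blast
  have "taylor g (\<alpha> m) j = 0" if m: "m \<in> M" "j < l m" for m j
  proof (rule vanish_cancel[OF disc[OF m(1)] blaschke_factor_isCont[OF z(1) disc[OF m(1)]] _ g f(2)[OF m(1)] m(2)])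
    show "blaschke_factor z (\<alpha> m) \<noteq> 0"
      using nz m disc[of m] blaschke_factor_eq_0_iff[OF z(1), of "\<alpha> m"] by auto
  qed
  then obtain h where h: "\<And>w. cmod w < 1 \<Longrightarrow> disc_eval g w = \<phi> w * disc_eval h w" using divide by blast
  have "\<forall>\<^sub>F w in at z. 1 = blaschke_factor z w * disc_eval h w"
    using nonzero_holo_near[OF inner_function_nonzero_holo[OF inner] z(1)]
  proof eventually_elim
    case (elim w)
    then have "\<phi> w = disc_eval f w" using f by simp
    also have "\<dots> = blaschke_factor z w * (\<phi> w * disc_eval h w)" using g[of w] h[of w] elim by simp
    finally have "\<phi> w * 1 = \<phi> w * (blaschke_factor z w * disc_eval h w)" by (simp add: mult_ac)
    then show ?case using elim by (metis mult_left_cancel)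
  qed
  moreover have "isCont (\<lambda>w. blaschke_factor z w * disc_eval h w) z"
    using z by (intro continuous_intros disc_eval_isCont blaschke_factor_isCont)
  ultimately have "1 = blaschke_factor z z * disc_eval h z"
    using at_eqI[of z "\<lambda>_. 1" "\<lambda>w. blaschke_factor z w * disc_eval h w"] by simp
  then show False by (simp add: blaschke_factor_def)
qed

text \<open>The orthogonal complement in the model space of the listed vectors consists of functions
  divisible by \<open>\<phi>\<close>, which are orthogonal to the model space.\<close>
theorem model_space_eq:
  "model_space \<phi> = closed_cspan {jordan (cnj a) j | a j. cmod a < 1 \<and> j < zero_order \<phi> a}"
    (is "_ = closed_cspan ?J")
proof
  let ?G = "{g. \<exists>h. \<forall>z\<in>ball 0 1. disc_eval g z = \<phi> z * disc_eval h z}"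
  have model: "model_space \<phi> = {f. \<forall>g\<in>?G. cinner f g = 0}" by (auto simp: model_space_def)
  have clo: "closed_csubspace (model_space \<phi>)" unfolding model by (rule closed_csubspace_orth)
  have "?J \<subseteq> model_space \<phi>"
    unfolding model
  proof safe
    fix a j g h
    assume a: "cmod a < 1" and j: "j < zero_order \<phi> a"
      and gh: "\<forall>z\<in>ball 0 1. disc_eval g z = \<phi> z * disc_eval h z"
    obtain F where F: "isCont F a" "\<forall>\<^sub>F z in at a. \<phi> z = (z - a) ^ zero_order \<phi> a * F z"
      using zero_order_factor(2)[OF inner_function_nonzero_holo[OF inner] a] by blast
    have "\<forall>\<^sub>F z in at a. z \<in> ball 0 1 \<and> z \<noteq> a"
      by (rule eventually_punctured_disc[OF a])
    with F(2) have "\<forall>\<^sub>F z in at a. disc_eval g z = (z - a) ^ zero_order \<phi> a * (F z * disc_eval h z)"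
      by eventually_elim (use gh in auto)
    moreover have "isCont (\<lambda>z. F z * disc_eval h z) a"
      using F(1) a by (intro continuous_intros disc_eval_isCont)
    ultimately have "taylor g a j = 0"
      using vanish_iff_local_factor[OF a, of "zero_order \<phi> a" g] j by blast
    then show "cinner (jordan (cnj a) j) g = 0" by (metis cinner_cnj complex_cnj_zero)
  qed
  then show sub: "closed_cspan ?J \<subseteq> model_space \<phi>" by (rule closed_cspan_minimal[OF clo])
  show "model_space \<phi> \<subseteq> closed_cspan ?J"
  proof
    fix f assume f: "f \<in> model_space \<phi>"
    obtain p where p: "p \<in> closed_cspan ?J" "\<And>v. v \<in> closed_cspan ?J \<Longrightarrow> cinner (f - p) v = 0"
      using orthogonal_decomposition[OF closed_csubspace_closed_cspan] by blast
    define q where "q = f - p"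
    have "taylor q (\<alpha> m) j = 0" if m: "m \<in> M" "j < l m" for m j
    proof -
      have "jordan (cnj (\<alpha> m)) j \<in> ?J"
        unfolding mem_Collect_eq using m disc[of m] multiplicity_le_zero_order[of m]
        by (intro exI[of _ "\<alpha> m"] exI[of _ j]) auto
      then have "jordan (cnj (\<alpha> m)) j \<in> closed_cspan ?J" by (rule subsetD[OF closed_cspan_superset])
      then show ?thesis unfolding q_def by (rule p(2))
    qed
    then obtain h where "\<And>z. cmod z < 1 \<Longrightarrow> disc_eval q z = \<phi> z * disc_eval h z" using divide by blast
    then have "q \<in> ?G" by auto
    moreover have "q \<in> model_space \<phi>"
      unfolding q_def using f p(1) sub closed_csubspaceD(3)[OF clo] by blast
    ultimately have "cinner q q = 0" unfolding model by blast
    then have "q = 0" by (simp add: cinner_self_norm)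
    then show "f \<in> closed_cspan ?J" using p(1) by (simp add: q_def)
  qed
qed

end

lemma blaschke_product_data:
  assumes "blaschke_product \<phi>"
  obtains M \<alpha> l c where "blaschke_data \<phi> M \<alpha> l c" "blaschke_expansion \<phi> M \<alpha> l"
  using assms that unfolding blaschke_product_def blaschke_data_def blaschke_expansion_def by fastforce

lemma blaschke_expansion_data:
  assumes "blaschke_product \<phi>" "blaschke_expansion \<phi> M \<alpha> l"
  obtains c where "blaschke_data \<phi> M \<alpha> l c"
  using assms that unfolding blaschke_product_def blaschke_data_def blaschke_expansion_def by fastforce

lemma blaschke_parts_of_zero:
  assumes "blaschke_product \<phi>" "cmod a < 1" "\<phi> a = 0"
  obtains l where "l \<ge> 1" "(\<lambda>z. blaschke_factor a z ^ l) \<in> blaschke_parts \<phi>"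
proof -
  obtain M \<alpha> l c where *: "blaschke_data \<phi> M \<alpha> l c" "blaschke_expansion \<phi> M \<alpha> l"
    using blaschke_product_data[OF assms(1)] .
  then obtain m where m: "m \<in> M" "a = \<alpha> m" using blaschke_data.zeros_subset[OF *(1) assms(2,3)] by blast
  have "(\<lambda>z. blaschke_factor a z ^ l m) \<in> blaschke_parts \<phi>"
    using *(2) m by (auto simp: blaschke_parts_def)
  then show thesis using that blaschke_data.mult[OF *(1) m(1)] by blast
qed

lemma blaschke_partsE:
  assumes "blaschke_product \<phi>" "\<xi> \<in> blaschke_parts \<phi>"
  obtains a l where "cmod a < 1" "l \<ge> 1" "\<xi> = (\<lambda>z. blaschke_factor a z ^ l)" "0 < zero_order \<phi> a"
proof -
  obtain M \<alpha> l m where *: "\<xi> = (\<lambda>z. blaschke_factor (\<alpha> m) z ^ l m)" "blaschke_expansion \<phi> M \<alpha> l" "m \<in> M"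
    using assms(2) by (auto simp: blaschke_parts_def)
  obtain c where c: "blaschke_data \<phi> M \<alpha> l c" using blaschke_expansion_data[OF assms(1) *(2)] .
  show thesis
    using that[OF blaschke_data.disc[OF c *(3)] blaschke_data.mult[OF c *(3)] *(1)]
      blaschke_data.multiplicity_le_zero_order[OF c *(3)] blaschke_data.mult[OF c *(3)] by linarith
qed

lemma blaschke_product_inner: "blaschke_product \<phi> \<Longrightarrow> inner_function \<phi>"
  by (simp add: blaschke_product_def)

lemma countable_zeros:
  assumes "blaschke_product \<phi>" shows "countable {a. cmod a < 1 \<and> 0 < zero_order \<phi> a}"
proof -
  obtain M \<alpha> l c where *: "blaschke_data \<phi> M \<alpha> l c" using blaschke_product_data[OF assms] .
  have "{a. cmod a < 1 \<and> 0 < zero_order \<phi> a} \<subseteq> \<alpha> ` M"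
  proof safe
    fix a assume a: "cmod a < 1" "0 < zero_order \<phi> a"
    then have "\<phi> a = 0"
      using zero_order_factor(1)[OF inner_function_nonzero_holo[OF blaschke_product_inner[OF assms]] a(1)]
      by blast
    then show "a \<in> \<alpha> ` M" by (rule blaschke_data.zeros_subset[OF * a(1)])
  qed
  then show ?thesis by (rule countable_subset) auto
qed

lemma model_space_blaschke:
  assumes "blaschke_product \<phi>"
  shows "model_space \<phi> = closed_cspan {jordan (cnj a) j | a j. cmod a < 1 \<and> j < zero_order \<phi> a}"
proof -
  obtain M \<alpha> l c where "blaschke_data \<phi> M \<alpha> l c" using blaschke_product_data[OF assms] .
  then show ?thesis by (rule blaschke_data.model_space_eq)
qed

lemma blaschke_product_power:
  assumes "cmod a < 1" "l \<ge> 1" shows "blaschke_product (\<lambda>z. blaschke_factor a z ^ l)"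
proof -
  have "(\<lambda>N. \<Prod>m\<in>{0} \<inter> {..<N}. 1 * blaschke_factor a z ^ l) \<longlonglongrightarrow> blaschke_factor a z ^ l" for z
  proof (rule tendsto_eventually, rule eventually_sequentiallyI[of 1])
    fix N :: nat assume "1 \<le> N"
    then have "{0} \<inter> {..<N} = {0}" by auto
    then show "(\<Prod>m\<in>{0} \<inter> {..<N}. 1 * blaschke_factor a z ^ l) = blaschke_factor a z ^ l" by simp
  qed
  then have "blaschke_expansion (\<lambda>z. blaschke_factor a z ^ l) {0} (\<lambda>_. a) (\<lambda>_. l)"
    unfolding blaschke_expansion_def using assms by (auto intro!: exI[of _ "\<lambda>_. 1"])
  then show ?thesis
    unfolding blaschke_product_def
    using inner_function_power[OF inner_function_blaschke_factor[OF assms(1)]] by blast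
qed

lemma zero_order_blaschke_power:
  assumes "cmod a < 1" "cmod b < 1"
  shows "zero_order (\<lambda>z. blaschke_factor a z ^ l) b = (if b = a then l else 0)"
proof (induction l)
  case 0
  then show ?case
    using zero_order_factor(1)[OF inner_function_nonzero_holo[OF inner_function_one] assms(2)] by simp
next
  case (Suc l)
  have "zero_order (\<lambda>z. blaschke_factor a z ^ Suc l) b
      = zero_order (blaschke_factor a) b + zero_order (\<lambda>z. blaschke_factor a z ^ l) b"
    by (intro zero_order_mult inner_function_nonzero_holo inner_function_power
        inner_function_blaschke_factor assms) simp
  then show ?case using Suc zero_order_blaschke_factor[OF assms] by simp
qed

lemma model_space_blaschke_power:
  assumes "cmod a < 1" "l \<ge> 1"
  shows "model_space (\<lambda>z. blaschke_factor a z ^ l) = closed_cspan {jordan (cnj a) j | j. j < l}"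
proof -
  have "{jordan (cnj b) j | b j. cmod b < 1 \<and> j < zero_order (\<lambda>z. blaschke_factor a z ^ l) b}
      = {jordan (cnj a) j | j. j < l}"
  proof safe
    fix j assume "j < l"
    then show "\<exists>b i. jordan (cnj a) j = jordan (cnj b) i \<and> cmod b < 1 \<and>
        i < zero_order (\<lambda>z. blaschke_factor a z ^ l) b"
      using assms by (intro exI[of _ a] exI[of _ j]) (simp add: zero_order_blaschke_power)
  qed (use assms in \<open>auto simp: zero_order_blaschke_power split: if_splits\<close>)
  then show ?thesis using model_space_blaschke[OF blaschke_product_power[OF assms]] by simp
qed

text \<open>Dividing \<open>\<phi>\<close> by the Blaschke factor at \<open>a\<close> lowers the order by one at \<open>a\<close> and nowhere else.\<close>
lemma corner_functional:
  assumes "blaschke_product \<phi>" "cmod a < 1" "0 < zero_order \<phi> a"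
  obtains f where
    "\<And>b j. cmod b < 1 \<Longrightarrow> b \<noteq> a \<Longrightarrow> j < zero_order \<phi> b \<Longrightarrow> taylor f b j = 0"
    "\<And>j. j < zero_order \<phi> a - 1 \<Longrightarrow> taylor f a j = 0"
    "taylor f a (zero_order \<phi> a - 1) \<noteq> 0"
proof -
  note nz = inner_function_nonzero_holo[OF blaschke_product_inner[OF assms(1)]]
  obtain M \<alpha> l c where *: "blaschke_data \<phi> M \<alpha> l c" using blaschke_product_data[OF assms(1)] .
  obtain f where f: "\<And>z. cmod z < 1 \<Longrightarrow> disc_eval f z = \<phi> z"
    by (rule blaschke_data.hardy_representative[OF *]) (rule that; assumption)
  have "disc_eval f a = 0" using zero_order_factor(1)[OF nz assms(2)] assms f by simp
  then obtain g where g: "\<And>z. cmod z < 1 \<Longrightarrow> disc_eval f z = blaschke_factor a z * disc_eval g z"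
    using divide_blaschke_factor[OF assms(2)] by blast
  have ng: "nonzero_holo (disc_eval g)"
    using nz f g disc_eval_holomorphic[of g] by (force simp: nonzero_holo_def)
  have ord: "zero_order \<phi> b = (if b = a then 1 else 0) + zero_order (disc_eval g) b" if "cmod b < 1" for b
    using zero_order_mult[OF inner_function_nonzero_holo[OF inner_function_blaschke_factor[OF assms(2)]] ng that, of \<phi>]
      f g zero_order_blaschke_factor[OF assms(2) that] by simp
  show thesis
    using that[of g] ord cinner_jordan_zero_order[OF ng, of _ g] assms(2) by auto
qed

section \<open>The Hardy space of the polydisc\<close>

subsection \<open>Elementary tensors\<close>

text \<open>A finite set of multi-indices lies in a product of finite sets, over which the sum of squares
  factorizes.\<close>
lemma tensor_exists:
  fixes f :: "'n::finite \<Rightarrow> hardy_disc"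
  shows "\<exists>h. (\<forall>\<kappa>. ell2_coeff h \<kappa> = (\<Prod>i\<in>UNIV. ell2_coeff (f i) (\<kappa> i))) \<and> norm h \<le> (\<Prod>i\<in>UNIV. norm (f i))"
proof -
  obtain h where "ell2_coeff h = (\<lambda>\<kappa>. \<Prod>i\<in>UNIV. ell2_coeff (f i) (\<kappa> i))"
    "norm h \<le> (\<Prod>i\<in>UNIV. norm (f i))"
  proof (rule ell2_of_bounded_sums)
    show "0 \<le> (\<Prod>i\<in>UNIV. norm (f i))" by (intro prod_nonneg) auto
  next
    fix F :: "('n \<Rightarrow> nat) set" assume F: "finite F"
    define G where "G i = (\<lambda>\<kappa>. \<kappa> i) ` F" for i
    have fG: "finite (G i)" for i using F by (simp add: G_def)
    have "(\<Sum>\<kappa>\<in>F. (cmod (\<Prod>i\<in>UNIV. ell2_coeff (f i) (\<kappa> i)))\<^sup>2)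
        = (\<Sum>\<kappa>\<in>F. \<Prod>i\<in>UNIV. (cmod (ell2_coeff (f i) (\<kappa> i)))\<^sup>2)"
      by (simp add: prod_norm[symmetric] prod_power_distrib)
    also have "\<dots> \<le> (\<Sum>\<kappa>\<in>PiE UNIV G. \<Prod>i\<in>UNIV. (cmod (ell2_coeff (f i) (\<kappa> i)))\<^sup>2)"
      by (intro sum_mono2 finite_PiE fG prod_nonneg) (auto simp: G_def)
    also have "\<dots> = (\<Prod>i\<in>UNIV. \<Sum>k\<in>G i. (cmod (ell2_coeff (f i) k))\<^sup>2)"
      by (rule prod_sum_PiE[symmetric]) (auto intro: fG)
    also have "\<dots> \<le> (\<Prod>i\<in>UNIV. (norm (f i))\<^sup>2)"
      by (intro prod_mono conjI sum_nonneg finite_sum_coeff_le fG) auto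
    finally show "(\<Sum>\<kappa>\<in>F. (cmod (\<Prod>i\<in>UNIV. ell2_coeff (f i) (\<kappa> i)))\<^sup>2) \<le> (\<Prod>i\<in>UNIV. norm (f i))\<^sup>2"
      by (simp add: prod_power_distrib)
  qed (use that in auto)
  then show ?thesis by (intro exI[of _ h]) simp
qed

definition tensor :: "('n::finite \<Rightarrow> hardy_disc) \<Rightarrow> 'n hardy" where
  "tensor f = (SOME h. (\<forall>\<kappa>. ell2_coeff h \<kappa> = (\<Prod>i\<in>UNIV. ell2_coeff (f i) (\<kappa> i))) \<and>
     norm h \<le> (\<Prod>i\<in>UNIV. norm (f i)))"

lemma coeff_tensor: "ell2_coeff (tensor f) \<kappa> = (\<Prod>i\<in>UNIV. ell2_coeff (f i) (\<kappa> i))"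
  and norm_tensor_le: "norm (tensor f) \<le> (\<Prod>i\<in>UNIV. norm (f i))"
  using someI_ex[OF tensor_exists[of f]] unfolding tensor_def[symmetric] by auto

lemma cinner_tensor: "cinner (tensor f) (tensor g) = (\<Prod>i\<in>UNIV. cinner (f i) (g i))"
proof -
  have "cinner (tensor f) (tensor g) = (\<Sum>\<^sub>\<infinity>\<kappa>\<in>PiE UNIV (\<lambda>_. UNIV).
      \<Prod>i\<in>UNIV. ell2_coeff (f i) (\<kappa> i) * cnj (ell2_coeff (g i) (\<kappa> i)))"
    by (simp add: cinner.rep_eq coeff_tensor prod.distrib)
  also have "\<dots> = (\<Prod>i\<in>UNIV. \<Sum>\<^sub>\<infinity>k. ell2_coeff (f i) k * cnj (ell2_coeff (g i) k))"
    by (intro infsum_prod_PiE_abs finite summable_on_iff_abs_summable_on_complex[THEN iffD1]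
        cinner_summable)
  finally show ?thesis by (simp add: cinner.rep_eq)
qed

lemma prod_fun_upd:
  fixes F :: "'n::finite \<Rightarrow> 'b \<Rightarrow> 'c::comm_monoid_mult"
  shows "(\<Prod>j\<in>UNIV. F j ((x(i := y)) j)) = F i y * (\<Prod>j\<in>UNIV - {i}. F j (x j))"
proof -
  have "(\<Prod>j\<in>UNIV. F j ((x(i := y)) j)) = F i y * (\<Prod>j\<in>UNIV - {i}. F j ((x(i := y)) j))"
    using prod.remove[of UNIV i "\<lambda>j. F j ((x(i := y)) j)"] by simp
  also have "(\<Prod>j\<in>UNIV - {i}. F j ((x(i := y)) j)) = (\<Prod>j\<in>UNIV - {i}. F j (x j))"
    by (rule prod.cong) auto
  finally show ?thesis .
qed

lemma coeff_tensor_upd: "ell2_coeff (tensor (x(i := y))) \<kappa> =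
    ell2_coeff y (\<kappa> i) * (\<Prod>j\<in>UNIV - {i}. ell2_coeff (x j) (\<kappa> j))"
  unfolding coeff_tensor using prod_fun_upd[of "\<lambda>j v. ell2_coeff v (\<kappa> j)"] .

lemma bounded_clinear_tensor_upd: "bounded_clinear (\<lambda>y. tensor (x(i := y)))"
proof (rule bounded_clinear_intro)
  show "norm (tensor (x(i := y))) \<le> norm y * (\<Prod>j\<in>UNIV - {i}. norm (x j))" for y
    using norm_tensor_le[of "x(i := y)"] prod_fun_upd[of "\<lambda>_. norm" x i y] by simp
qed (auto intro!: ell2_ext simp: coeff_tensor_upd plus_ell2.rep_eq cscale.rep_eq distrib_right)


text \<open>The tensor is linear and continuous in each factor, so the factors can be moved from the generators
  to their closed spans one at a time.\<close>
lemma tensor_in_closed_cspan: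
  assumes "\<And>i. x i \<in> closed_cspan (G i)"
  shows "tensor x \<in> closed_cspan {tensor g | g. \<forall>i. g i \<in> G i}"
proof -
  let ?V = "closed_cspan {tensor g | g. \<forall>i. g i \<in> G i}"
  have "\<forall>x. (\<forall>i\<in>I. x i \<in> closed_cspan (G i)) \<and> (\<forall>i\<in>-I. x i \<in> G i) \<longrightarrow> tensor x \<in> ?V" if "finite I" for I
    using that
  proof (induction I rule: finite_induct)
    case empty
    then show ?case using closed_cspan_superset[of "{tensor g | g. \<forall>i. g i \<in> G i}"] by auto
  next
    case (insert i I)
    show ?case
    proof (intro allI impI, elim conjE)
      fix x assume x: "\<forall>j\<in>insert i I. x j \<in> closed_cspan (G j)" "\<forall>j\<in>- insert i I. x j \<in> G j"
      have "closed_cspan (G i) \<subseteq> {y. tensor (x(i := y)) \<in> ?V}"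
      proof (rule closed_cspan_minimal)
        show "closed_csubspace {y. tensor (x(i := y)) \<in> ?V}"
          by (rule closed_csubspace_vimage[OF bounded_clinear_tensor_upd closed_csubspace_closed_cspan])
        show "G i \<subseteq> {y. tensor (x(i := y)) \<in> ?V}"
          using insert.IH insert.hyps x by auto
      qed
      then have "tensor (x(i := x i)) \<in> ?V" using x(1) by blast
      then show "tensor x \<in> ?V" by simp
    qed
  qed
  from this[OF finite[of UNIV]] show ?thesis using assms by simp
qed

subsection \<open>Evaluation and coordinate shifts\<close>

lemma hardy_eval_cinner:
  assumes "z \<in> polydisc"
  shows "hardy_eval f z = cinner f (tensor (\<lambda>i. jordan (cnj (z $ i)) 0))"
  unfolding hardy_eval_def cinner.rep_eq using assms
  by (simp add: coeff_tensor coeff_jordan_0 polydisc_def)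

lemma hardy_eval_tensor:
  assumes "z \<in> polydisc"
  shows "hardy_eval (tensor f) z = (\<Prod>i\<in>UNIV. disc_eval (f i) (z $ i))"
  using assms by (simp add: hardy_eval_cinner cinner_tensor disc_eval_cinner polydisc_def)

lemma delta_tensor: "ell2_delta \<kappa> = tensor (\<lambda>i. ell2_delta (\<kappa> i))"
  by (rule ell2_ext) (auto simp: coeff_tensor ell2_delta.rep_eq fun_eq_iff intro!: prod_zero)

text \<open>In one variable the kernel functions span a dense subspace, so their tensors span a dense subspace
  too, and evaluation is pairing with these tensors.\<close>
lemma hardy_eval_inject:
  assumes "\<And>z. z \<in> polydisc \<Longrightarrow> hardy_eval f z = hardy_eval g z"
  shows "f = g"
proof -
  let ?G = "{jordan (cnj z) 0 | z. cmod z < 1}"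
  have k: "cinner (tensor x) (f - g) = 0" if "\<forall>i. x i \<in> ?G" for x
  proof -
    have "\<forall>i. \<exists>w. cmod w < 1 \<and> x i = jordan (cnj w) 0" using that by blast
    then obtain z where z: "\<And>i. cmod (z i) < 1" "\<And>i. x i = jordan (cnj (z i)) 0" by metis
    let ?z = "\<chi> i. z i"
    have p: "?z \<in> polydisc" using z(1) by (simp add: polydisc_def)
    have "x = (\<lambda>i. jordan (cnj (?z $ i)) 0)" using z(2) by (simp add: fun_eq_iff)
    then have "cinner (f - g) (tensor x) = 0"
      using assms[OF p] by (simp add: hardy_eval_cinner[OF p] cinner_diff_left)
    then show ?thesis using cinner_cnj[of "f - g" "tensor x"] by simp
  qed
  have "ell2_coeff (f - g) \<kappa> = 0" for \<kappa>
  proof -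
    have "tensor (\<lambda>i. ell2_delta (\<kappa> i)) \<in> closed_cspan {tensor x | x. \<forall>i. x i \<in> ?G}"
      by (rule tensor_in_closed_cspan) (simp add: closed_cspan_kernels)
    then have "cinner (ell2_delta \<kappa>) (f - g) = 0"
      unfolding delta_tensor by (rule cinner_closed_cspan_zero[rotated]) (use k in blast)
    then show ?thesis
      using cinner_cnj[of "ell2_delta \<kappa>" "f - g"] by (simp add: cinner_delta_right)
  qed
  then show ?thesis by (intro ell2_ext) (simp add: minus_ell2.rep_eq)
qed

text \<open>As evaluation is injective, the generating functions of the tensor product are exactly the elementary
  tensors.\<close>
lemma tensor_space_closed_cspan:
  fixes G :: "'n::finite \<Rightarrow> hardy_disc set"
  assumes "\<And>i. E i = closed_cspan (G i)"
  shows "tensor_space E = closed_cspan {tensor g | g. \<forall>i. g i \<in> G i}"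
proof -
  have "h = tensor f \<longleftrightarrow> (\<forall>z\<in>polydisc. hardy_eval h z = (\<Prod>i\<in>UNIV. disc_eval (f i) (z $ i)))"
    for h and f :: "'n \<Rightarrow> hardy_disc"
    using hardy_eval_inject[of h "tensor f"] by (auto simp: hardy_eval_tensor)
  then have "{h. \<exists>f. (\<forall>i. f i \<in> E i) \<and> (\<forall>z\<in>polydisc. hardy_eval h z = (\<Prod>i\<in>UNIV. disc_eval (f i) (z $ i)))}
      = {tensor f | f. \<forall>i. f i \<in> E i}" by blast
  then have "tensor_space E = closed_cspan {tensor f | f. \<forall>i. f i \<in> E i}"
    unfolding tensor_space_def by simp
  also have "\<dots> = closed_cspan {tensor g | g. \<forall>i. g i \<in> G i}"
  proof (rule closed_cspan_eqI)
    show "{tensor f | f. \<forall>i. f i \<in> E i} \<subseteq> closed_cspan {tensor g | g. \<forall>i. g i \<in> G i}"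
      using tensor_in_closed_cspan[of _ G] assms by auto
    have "{tensor g | g. \<forall>i. g i \<in> G i} \<subseteq> {tensor f | f. \<forall>i. f i \<in> E i}"
      using closed_cspan_superset[of "G _"] assms by blast
    then show "{tensor g | g. \<forall>i. g i \<in> G i} \<subseteq> closed_cspan {tensor f | f. \<forall>i. f i \<in> E i}"
      by (rule order_trans[OF _ closed_cspan_superset])
  qed
  finally show ?thesis .
qed

definition raise :: "'n \<Rightarrow> ('n \<Rightarrow> nat) \<Rightarrow> 'n \<Rightarrow> nat" where
  "raise i \<kappa> = \<kappa>(i := Suc (\<kappa> i))"

lemma inj_raise: "inj (raise i)"
proof (rule injI)
  fix \<kappa> \<mu> assume *: "raise i \<kappa> = raise i \<mu>"
  have "\<kappa> j = \<mu> j" for j using fun_cong[OF *, of j] by (auto simp: raise_def split: if_splits)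
  then show "\<kappa> = \<mu>" by blast
qed

lemma range_raise: "range (raise i) = {\<kappa>. \<kappa> i \<noteq> 0}"
proof safe
  fix \<kappa> :: "'a \<Rightarrow> nat" assume "0 < \<kappa> i"
  then have "\<kappa> = raise i (\<kappa>(i := \<kappa> i - 1))" by (auto simp: raise_def)
  then show "\<kappa> \<in> range (raise i)" by blast
qed (auto simp: raise_def)

lift_definition coord_shift :: "'n \<Rightarrow> 'n hardy \<Rightarrow> 'n hardy" is
  "\<lambda>i f \<kappa>. if \<kappa> i = 0 then 0 else f (\<kappa>(i := \<kappa> i - 1))"
proof -
  fix i :: 'n and f :: "('n \<Rightarrow> nat) \<Rightarrow> complex"
  let ?g = "\<lambda>\<kappa>. (cmod (if \<kappa> i = 0 then 0 else f (\<kappa>(i := \<kappa> i - 1))))\<^sup>2"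
  assume f: "(\<lambda>x. (cmod (f x))\<^sup>2) summable_on UNIV"
  have "(?g \<circ> raise i) = (\<lambda>x. (cmod (f x))\<^sup>2)" by (auto simp: fun_eq_iff raise_def)
  then have "?g summable_on range (raise i)"
    using f summable_on_reindex[OF inj_raise, of ?g i] by simp
  moreover have "?g summable_on UNIV \<longleftrightarrow> ?g summable_on range (raise i)"
    by (rule summable_on_cong_neutral) (auto simp: range_raise)
  ultimately show "?g summable_on UNIV" by simp
qed

lift_definition back_shift :: "'n \<Rightarrow> 'n hardy \<Rightarrow> 'n hardy" is "\<lambda>i f \<kappa>. f (raise i \<kappa>)"
proof -
  fix i :: 'n and f :: "('n \<Rightarrow> nat) \<Rightarrow> complex"
  assume "(\<lambda>x. (cmod (f x))\<^sup>2) summable_on UNIV"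
  then have "(\<lambda>x. (cmod (f x))\<^sup>2) summable_on range (raise i)"
    by (rule summable_on_subset_banach) simp
  then show "(\<lambda>x. (cmod (f (raise i x)))\<^sup>2) summable_on UNIV"
    using summable_on_reindex[OF inj_raise, of "\<lambda>x. (cmod (f x))\<^sup>2" i] by (simp add: o_def)
qed

lemma cinner_coord_shift: "cinner (coord_shift i f) g = cinner f (back_shift i g)"
proof -
  let ?h = "\<lambda>\<kappa>. ell2_coeff (coord_shift i f) \<kappa> * cnj (ell2_coeff g \<kappa>)"
  have "cinner (coord_shift i f) g = infsum ?h (range (raise i))"
    unfolding cinner.rep_eq
    by (rule infsum_cong_neutral) (auto simp: range_raise coord_shift.rep_eq)
  also have "\<dots> = infsum (?h \<circ> raise i) UNIV" by (rule infsum_reindex[OF inj_raise])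
  also have "\<dots> = cinner f (back_shift i g)"
    unfolding cinner.rep_eq
    by (rule infsum_cong) (simp add: coord_shift.rep_eq back_shift.rep_eq, simp add: raise_def)
  finally show ?thesis .
qed

lemma back_shift_tensor: "back_shift i (tensor x) = tensor (x(i := bshift (x i)))"
proof (rule ell2_ext)
  fix \<kappa>
  have "ell2_coeff (back_shift i (tensor x)) \<kappa> =
      (\<Prod>j\<in>UNIV. (\<lambda>j k. ell2_coeff (x j) k) j ((\<kappa>(i := Suc (\<kappa> i))) j))"
    by (simp add: back_shift.rep_eq coeff_tensor raise_def del: fun_upd_apply)
  also have "\<dots> = ell2_coeff (x i) (Suc (\<kappa> i)) * (\<Prod>j\<in>UNIV - {i}. ell2_coeff (x j) (\<kappa> j))"
    by (rule prod_fun_upd)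
  finally show "ell2_coeff (back_shift i (tensor x)) \<kappa> = ell2_coeff (tensor (x(i := bshift (x i)))) \<kappa>"
    by (simp add: coeff_tensor_upd bshift.rep_eq)
qed

lemma hardy_eval_coord_shift:
  assumes "z \<in> polydisc"
  shows "hardy_eval (coord_shift i f) z = z $ i * hardy_eval f z"
proof -
  let ?k = "\<lambda>i. jordan (cnj (z $ i)) 0"
  have "cmod (cnj (z $ i)) < 1" using assms by (simp add: polydisc_def)
  then have "back_shift i (tensor ?k) = tensor (?k(i := cscale (cnj (z $ i)) (?k i)))"
    by (simp add: back_shift_tensor bshift_jordan_0)
  also have "\<dots> = cscale (cnj (z $ i)) (tensor ?k)"
  proof -
    have "?k(i := ?k i) = ?k" by auto
    then show ?thesis
      using bounded_clinearD(6)[OF bounded_clinear_tensor_upd[of ?k i], of "cnj (z $ i)" "?k i"]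
      by (simp only:)
  qed
  finally show ?thesis
    using assms by (simp add: hardy_eval_cinner cinner_coord_shift cinner_cscale_right)
qed

lemma coord_mult_eq: "coord_mult i f = coord_shift i f"
  unfolding coord_mult_def
  by (rule the_equality) (auto simp: hardy_eval_coord_shift intro: hardy_eval_inject)

lemma cadjoint_coord_mult: "cadjoint (coord_mult i) = back_shift i"
  unfolding cadjoint_def
proof (rule the_equality)
  show "\<forall>f g. cinner (coord_mult i f) g = cinner f (back_shift i g)"
    by (simp add: coord_mult_eq cinner_coord_shift)
next
  fix T' assume *: "\<forall>f g. cinner (coord_mult i f) g = cinner f (T' g)"
  have "cinner f (T' g - back_shift i g) = 0" for f g
    using * by (simp add: cinner_diff_right coord_mult_eq cinner_coord_shift)
  then have "cinner (T' g - back_shift i g) (T' g - back_shift i g) = 0" for g by blast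
  then show "T' = back_shift i" by (simp add: cinner_self_norm fun_eq_iff)
qed

lemma norm_back_shift_le: "norm (back_shift i f) \<le> norm f"
proof -
  have inv: "back_shift i (coord_shift i f) = f" for f
    by (rule ell2_ext) (simp add: back_shift.rep_eq coord_shift.rep_eq, simp add: raise_def)
  have "cinner (coord_shift i g) (coord_shift i g) = cinner g g" for g
    by (simp add: cinner_coord_shift inv)
  then have n: "norm (coord_shift i g) = norm g" for g
    unfolding cinner_self_norm of_real_eq_iff by (simp add: power2_eq_iff_nonneg)
  have "(norm (back_shift i f))\<^sup>2 = cmod (cinner (coord_shift i (back_shift i f)) f)"
    by (simp add: cinner_coord_shift cinner_self_norm norm_power)
  also have "\<dots> \<le> norm (back_shift i f) * norm f"
    using cmod_cinner_le[of "coord_shift i (back_shift i f)" f] by (simp add: n)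
  finally show ?thesis by (cases "norm (back_shift i f) = 0") (auto simp: power2_eq_square)
qed

interpretation back_shift: commuting_tuple "back_shift :: 'n::finite \<Rightarrow> 'n hardy \<Rightarrow> 'n hardy"
proof
  show "bounded_clinear (back_shift i)" for i :: 'n
    by (rule bounded_clinear_intro[where K = 1])
      (auto intro!: ell2_ext simp: back_shift.rep_eq plus_ell2.rep_eq cscale.rep_eq norm_back_shift_le)
  have "raise i (raise j \<kappa>) = raise j (raise i \<kappa>)" for i j :: 'n and \<kappa>
    by (auto simp: raise_def fun_eq_iff)
  then show "back_shift i (back_shift j x) = back_shift j (back_shift i x)" for i j :: 'n and x
    by (intro ell2_ext) (simp add: back_shift.rep_eq)
qed

lemma co_rank_eq: "co_rank Q = tuple_rank back_shift Q"
  by (simp add: co_rank_def cadjoint_coord_mult)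

subsection \<open>Joint Jordan chains\<close>

text \<open>Pairing with \<open>poly_jordan \<mu> \<beta>\<close> is taking the Taylor coefficient of order \<open>\<beta>\<close> at \<open>\<mu>\<close>.\<close>
definition poly_jordan :: "('n::finite \<Rightarrow> complex) \<Rightarrow> ('n \<Rightarrow> nat) \<Rightarrow> 'n hardy" where
  "poly_jordan \<mu> \<beta> = tensor (\<lambda>i. jordan (cnj (\<mu> i)) (\<beta> i))"

lemma back_shift_poly_jordan:
  assumes "cmod (\<mu> i) < 1"
  shows "back_shift i (poly_jordan \<mu> \<beta>) = cscale (cnj (\<mu> i)) (poly_jordan \<mu> \<beta>) +
    (if \<beta> i = 0 then 0 else poly_jordan \<mu> (\<beta>(i := \<beta> i - 1)))"
proof -
  let ?x = "\<lambda>j. jordan (cnj (\<mu> j)) (\<beta> j)"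
  have a: "cmod (cnj (\<mu> i)) < 1" using assms by simp
  note lin = bounded_clinearD[OF bounded_clinear_tensor_upd[of ?x i]]
  have self: "tensor (?x(i := ?x i)) = poly_jordan \<mu> \<beta>"
    unfolding poly_jordan_def by (intro arg_cong[where f = tensor] ext) auto
  show ?thesis
  proof (cases "\<beta> i")
    case 0
    then have "bshift (?x i) = cscale (cnj (\<mu> i)) (?x i)" using a by (simp add: bshift_jordan_0)
    then have "back_shift i (poly_jordan \<mu> \<beta>) = cscale (cnj (\<mu> i)) (tensor (?x(i := ?x i)))"
      unfolding poly_jordan_def back_shift_tensor lin(6)[symmetric] by simp
    then show ?thesis unfolding self using 0 by simp
  next
    case (Suc b)
    have "bshift (?x i) = cscale (cnj (\<mu> i)) (?x i) + jordan (cnj (\<mu> i)) b"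
      using a Suc by (simp add: bshift_jordan_Suc)
    then have "back_shift i (poly_jordan \<mu> \<beta>) = cscale (cnj (\<mu> i)) (tensor (?x(i := ?x i)))
        + tensor (?x(i := jordan (cnj (\<mu> i)) b))"
      unfolding poly_jordan_def back_shift_tensor lin(6)[symmetric] lin(2)[symmetric] by simp
    moreover have "?x(i := jordan (cnj (\<mu> i)) b) = (\<lambda>j. jordan (cnj (\<mu> j)) ((\<beta>(i := b)) j))"
      by (auto simp: fun_eq_iff)
    then have "tensor (?x(i := jordan (cnj (\<mu> i)) b)) = poly_jordan \<mu> (\<beta>(i := b))"
      by (simp only: poly_jordan_def)
    ultimately show ?thesis unfolding self using Suc by simp
  qed
qed

lemma cinner_poly_jordan:
  "cinner (tensor f) (poly_jordan \<mu> \<beta>) = (\<Prod>i\<in>UNIV. taylor (f i) (\<mu> i) (\<beta> i))"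
  by (simp add: poly_jordan_def cinner_tensor)

lemma back_shift_nilpotent:
  assumes "cmod (\<mu> i) < 1"
  shows "((\<lambda>x. back_shift i x - cscale (cnj (\<mu> i)) x) ^^ Suc (\<beta> i)) (poly_jordan \<mu> \<beta>) = 0"
proof -
  let ?N = "\<lambda>x. back_shift i x - cscale (cnj (\<mu> i)) x"
  have step: "?N (poly_jordan \<mu> \<beta>) = (if \<beta> i = 0 then 0 else poly_jordan \<mu> (\<beta>(i := \<beta> i - 1)))" for \<beta>
    using back_shift_poly_jordan[of \<mu> i \<beta>, OF assms] by simp
  have "(?N ^^ Suc k) (poly_jordan \<mu> \<beta>) = 0" if "\<beta> i = k" for k \<beta>
    using that
  proof (induction k arbitrary: \<beta>)
    case 0 then show ?case using step[of \<beta>] by simp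
  next
    case (Suc k)
    have "(?N ^^ Suc (Suc k)) (poly_jordan \<mu> \<beta>) = (?N ^^ Suc k) (?N (poly_jordan \<mu> \<beta>))"
      by (simp only: funpow_Suc_right o_apply)
    also have "?N (poly_jordan \<mu> \<beta>) = poly_jordan \<mu> (\<beta>(i := k))" using step[of \<beta>] Suc by simp
    also have "(?N ^^ Suc k) \<dots> = 0" by (rule Suc.IH) simp
    finally show ?case .
  qed
  then show ?thesis by simp
qed

text \<open>The dual functionals are given by the polynomials \<open>\<Prod>\<^sub>i (z\<^sub>i - a\<^sub>i) ^ \<beta>\<^sub>i\<close>.\<close>
lemma poly_jordan_independent:
  assumes a: "\<And>i. cmod (a i) < 1" and "poly_jordan a \<beta> \<in> closed_cspan (poly_jordan a ` D)"
  shows "\<beta> \<in> D"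
proof (rule ccontr)
  assume \<beta>: "\<beta> \<notin> D"
  define f where "f = tensor (\<lambda>i. (linmult (a i) ^^ \<beta> i) (ell2_delta 0))"
  have c0: "cinner (ell2_delta 0) (jordan b j) = (if j = 0 then 1 else 0)" if "cmod b < 1" for b j
  proof -
    have "ell2_coeff (jordan b j) 0 = (if j = 0 then 1 else 0)"
    proof (cases j)
      case (Suc i)
      have "ell2_coeff (jordan b (Suc i) - cscale b (fshift (jordan b (Suc i)))) 0 = 0"
        using shift_resolvent[OF that, of "fshift (jordan b i)"]
        by (simp add: jordan.simps fshift.rep_eq)
      then show ?thesis using Suc by (simp add: minus_ell2.rep_eq cscale.rep_eq fshift.rep_eq)
    qed (use that coeff_jordan_0 in simp)
    then show ?thesis using cinner_cnj[of "jordan b j" "ell2_delta 0"]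
      by (simp add: cinner_delta_right split: if_splits)
  qed
  have dual: "cinner f (poly_jordan a \<gamma>) = (if \<gamma> = \<beta> then 1 else 0)" for \<gamma>
  proof -
    have "cinner f (poly_jordan a \<gamma>) = (\<Prod>i\<in>UNIV. if \<gamma> i = \<beta> i then 1 else 0)"
      unfolding f_def cinner_poly_jordan
      by (rule prod.cong) (auto simp: cinner_linmult_power[OF a] c0 a)
    also have "\<dots> = (if \<gamma> = \<beta> then 1 else 0)" by (auto simp: fun_eq_iff intro!: prod_zero)
    finally show ?thesis .
  qed
  have "cinner (poly_jordan a \<gamma>) f = (if \<gamma> = \<beta> then 1 else 0)" for \<gamma>
    using cinner_cnj[of f "poly_jordan a \<gamma>"] dual[of \<gamma>] by (simp split: if_splits)
  moreover from this have "cinner (poly_jordan a \<beta>) f = 0"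
    using \<beta> by (intro cinner_closed_cspan_zero[OF _ assms(2)]) auto
  ultimately show False by simp
qed

lemma closed_cspan_UN:
  "closed_cspan (\<Union>k\<in>K. closed_cspan (X k)) = closed_cspan (\<Union>k\<in>K. X k)"
proof (rule closed_cspan_eqI)
  show "(\<Union>k\<in>K. closed_cspan (X k)) \<subseteq> closed_cspan (\<Union>k\<in>K. X k)"
    by (intro UN_least closed_cspan_mono) blast
  show "(\<Union>k\<in>K. X k) \<subseteq> closed_cspan (\<Union>k\<in>K. closed_cspan (X k))"
    by (rule order_trans[OF UN_mono[OF order_refl closed_cspan_superset] closed_cspan_superset])
qed

section \<open>Unions of boxes along a monotone family\<close>

text \<open>The exponents at one point of the polydisc: \<open>m i k\<close> is the order of the \<open>i\<close>-th function with
  index \<open>k\<close>, and \<open>box k\<close> is the set of orders of derivatives that it determines.\<close>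
locale monotone_orders =
  fixes m :: "'n::finite \<Rightarrow> int \<Rightarrow> nat" and A B :: "'n set"
  assumes nonempty: "A \<noteq> {}" "B \<noteq> {}" and B_eq: "B = UNIV - A"
    and step_A: "\<And>i k. i \<in> A \<Longrightarrow> m i k \<le> m i (k + 1)"
    and step_B: "\<And>i k. i \<in> B \<Longrightarrow> m i (k + 1) \<le> m i k"
    and zero: "\<And>i. \<exists>k. m i k = 0"
begin

lemma mono_A:
  assumes "i \<in> A" "k \<le> k'" shows "m i k \<le> m i k'"
  using assms(2) by (induction k' rule: int_ge_induct) (auto intro: order_trans step_A assms(1))

lemma mono_B:
  assumes "i \<in> B" "k \<le> k'" shows "m i k' \<le> m i k"
  using assms(2) by (induction k' rule: int_ge_induct) (auto intro: order_trans[OF step_B] assms(1))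

definition support :: "int set" where
  "support = {k. \<forall>i. 0 < m i k}"

definition jumps :: "int set" where
  "jumps = {k \<in> support. \<exists>i\<in>A. m i (k - 1) < m i k}"

definition box :: "int \<Rightarrow> ('n \<Rightarrow> nat) set" where
  "box k = {\<beta>. \<forall>i. \<beta> i < m i k}"

text \<open>The boxes at these indices are the maximal ones, each listed once: at the first index of a run of
  equal boxes.\<close>
definition peaks :: "int set" where
  "peaks = {k \<in> jumps. \<forall>k'\<in>jumps. k < k' \<longrightarrow> (\<exists>i\<in>B. m i k' < m i k)}"

lemma finite_support: "finite support"
proof -
  obtain i j where ij: "i \<in> A" "j \<in> B" using nonempty by blast
  obtain p q where pq: "m i p = 0" "m j q = 0" using zero by metis
  have "support \<subseteq> {p..q}"
  proof
    fix k assume "k \<in> support"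
    then have "0 < m i k" "0 < m j k" by (auto simp: support_def)
    then show "k \<in> {p..q}"
      using mono_A[OF ij(1), of k p] mono_B[OF ij(2), of q k] pq by (cases "k \<le> p"; cases "q \<le> k") auto
  qed
  then show ?thesis by (rule finite_subset) simp
qed

lemma finite_jumps: "finite jumps"
  using finite_support by (rule rev_finite_subset) (auto simp: jumps_def)

lemma peaks_subset: "peaks \<subseteq> support"
  by (auto simp: peaks_def jumps_def)

lemma finite_peaks: "finite peaks"
  using peaks_subset finite_support by (rule finite_subset)

lemma jump_below: "k \<in> jumps \<Longrightarrow> k' < k \<Longrightarrow> \<exists>i\<in>A. m i k' < m i k"
  using mono_A[of _ k' "k - 1"] unfolding jumps_def by force

text \<open>The order has to grow at some step. There the orders in \<open>A\<close> are at least those at \<open>k\<close> and the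
  orders in \<open>B\<close> at least those at \<open>k'\<close>, so this step belongs to the support.\<close>
lemma jump_between:
  assumes "k \<in> support" "k \<le> k'" "k' \<in> support" "i \<in> A" "m i k < m i k'"
  shows "\<exists>k1\<in>jumps. k < k1 \<and> k1 \<le> k'"
proof -
  have "k' \<ge> k \<Longrightarrow> m i k < m i k' \<Longrightarrow> \<exists>k1. k < k1 \<and> k1 \<le> k' \<and> m i (k1 - 1) < m i k1"
  proof (induction k' rule: int_ge_induct)
    case (step j)
    show ?case
    proof (cases "m i j < m i (j + 1)")
      case True then show ?thesis using step.hyps by (intro exI[of _ "j + 1"]) auto
    next
      case False
      then have "m i k < m i j" using step.prems by linarith
      then obtain k1 where "k < k1 \<and> k1 \<le> j \<and> m i (k1 - 1) < m i k1" using step.IH by blast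
      then show ?thesis by (intro exI[of _ k1]) auto
    qed
  qed simp
  then obtain k1 where k1: "k < k1" "k1 \<le> k'" "m i (k1 - 1) < m i k1" using assms by blast
  have "0 < m j k1" for j
  proof (cases "j \<in> A")
    case True then show ?thesis using mono_A[OF True, of k k1] assms(1) k1 by (auto simp: support_def intro: less_le_trans)
  next
    case False
    then have "j \<in> B" by (simp add: B_eq)
    then show ?thesis using mono_B[of j k1 k'] assms(3) k1 by (auto simp: support_def intro: less_le_trans)
  qed
  then have "k1 \<in> jumps" using k1 assms(4) by (auto simp: jumps_def support_def)
  then show ?thesis using k1 by blast
qed

text \<open>Just before the minimum some order is zero, and it cannot be one in \<open>B\<close>.\<close>
lemma Min_support_in_jumps: assumes "support \<noteq> {}" shows "Min support \<in> jumps"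
proof -
  define p where "p = Min support"
  have p: "p \<in> support" using Min_in[OF finite_support assms] by (simp add: p_def)
  have "p - 1 \<notin> support" using Min_le[OF finite_support, of "p - 1"] by (auto simp: p_def)
  then obtain i where i: "m i (p - 1) = 0" by (auto simp: support_def)
  have "i \<in> A"
  proof (rule ccontr)
    assume "i \<notin> A"
    then have "m i p \<le> m i (p - 1)" by (intro mono_B) (auto simp: B_eq)
    moreover have "0 < m i p" using p by (simp add: support_def)
    ultimately show False using i by simp
  qed
  then have "p \<in> jumps" using p i by (auto simp: jumps_def support_def intro!: bexI[of _ i])
  then show ?thesis by (simp add: p_def)
qed

text \<open>Every box lies in the box of a peak: first go down to the preceding jump, then up to the last
  jump with the same orders in \<open>B\<close>.\<close>
lemma box_subset_peak:
  assumes k: "k \<in> support"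
  obtains k' where "k' \<in> peaks" "\<And>i. m i k \<le> m i k'"
proof -
  define J where "J = {j \<in> jumps. j \<le> k}"
  have J: "finite J" "J \<noteq> {}"
    using finite_jumps Min_support_in_jumps k Min_le[OF finite_support k] by (auto simp: J_def)
  define k1 where "k1 = Max J"
  have k1: "k1 \<in> jumps" "k1 \<le> k" using Max_in[OF J] by (auto simp: k1_def J_def)
  have le1: "m i k \<le> m i k1" for i
  proof (cases "i \<in> A")
    case True
    show ?thesis
    proof (rule ccontr)
      assume "\<not> m i k \<le> m i k1"
      then obtain j where "j \<in> jumps" "k1 < j" "j \<le> k"
        using jump_between[OF _ k1(2) k True] k1(1) by (auto simp: jumps_def)
      then show False using Max_ge[OF J(1), of j] by (simp add: k1_def J_def)
    qed
  next
    case False then show ?thesis using mono_B k1(2) by (simp add: B_eq)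
  qed
  define L where "L = {j \<in> jumps. k1 \<le> j \<and> (\<forall>i\<in>B. m i j = m i k1)}"
  have L: "finite L" "L \<noteq> {}" using finite_jumps k1 by (auto simp: L_def)
  define k2 where "k2 = Max L"
  have k2: "k2 \<in> jumps" "k1 \<le> k2" "\<And>i. i \<in> B \<Longrightarrow> m i k2 = m i k1"
    using Max_in[OF L] by (auto simp: k2_def L_def)
  have "k2 \<in> peaks"
    unfolding peaks_def
  proof (intro CollectI conjI ballI impI k2(1))
    fix k' assume k': "k' \<in> jumps" "k2 < k'"
    have "k' \<notin> L" using Max_ge[OF L(1), of k'] k'(2) by (auto simp: k2_def)
    then obtain i where i: "i \<in> B" "m i k' \<noteq> m i k1" using k' k2(2) by (auto simp: L_def)
    then show "\<exists>i\<in>B. m i k' < m i k2"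
      using k2(3)[of i] mono_B[of i k2 k'] k'(2) by (intro bexI[of _ i]) auto
  qed
  moreover have "m i k1 \<le> m i k2" for i
    using mono_A[of i, OF _ k2(2)] k2(3)[of i] by (cases "i \<in> A") (auto simp: B_eq)
  then have "m i k \<le> m i k2" for i using le1[of i] order_trans by blast
  ultimately show thesis using that by blast
qed

lemma peaks_nonempty: "support \<noteq> {} \<Longrightarrow> peaks \<noteq> {}"
  using box_subset_peak by blast

lemma box_peaks: "(\<Union>k\<in>peaks. box k) = (\<Union>k\<in>support. box k)"
proof
  show "(\<Union>k\<in>support. box k) \<subseteq> (\<Union>k\<in>peaks. box k)"
  proof safe
    fix k \<beta> assume k: "k \<in> support" "\<beta> \<in> box k"
    obtain k' where "k' \<in> peaks" "\<And>i. m i k \<le> m i k'" using box_subset_peak[OF k(1)] by blast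
    then have "k' \<in> peaks" "\<beta> \<in> box k'" using k(2) by (auto simp: box_def intro: less_le_trans)
    then show "\<beta> \<in> (\<Union>k\<in>peaks. box k)" by blast
  qed
qed (use peaks_subset in blast)

definition corner :: "int \<Rightarrow> 'n \<Rightarrow> nat" where
  "corner k i = m i k - 1"

lemma corner_less: "k \<in> support \<Longrightarrow> corner k i < m i k"
  by (auto simp: corner_def support_def)

text \<open>A box containing the corner of a peak belongs to the same run of indices, so distinct peaks
  need distinct boxes in any cover.\<close>
lemma card_peaks_le:
  assumes K: "K \<subseteq> support" and eq: "(\<Union>k\<in>K. box k) = (\<Union>k\<in>support. box k)"
  shows "card peaks \<le> card K"
proof -
  have "\<exists>k'\<in>K. \<forall>i. m i k \<le> m i k'" if k: "k \<in> peaks" for k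
  proof -
    have s: "k \<in> support" using k peaks_subset by blast
    then have "corner k \<in> box k" by (simp add: box_def corner_less)
    then obtain k' where k': "k' \<in> K" "corner k \<in> box k'" using s eq by blast
    have "m i k \<le> m i k'" for i
      using k'(2) s by (auto simp: box_def corner_def support_def dest!: spec[of _ i])
    then show ?thesis using k'(1) by blast
  qed
  then obtain g where g: "\<And>k. k \<in> peaks \<Longrightarrow> g k \<in> K" "\<And>k i. k \<in> peaks \<Longrightarrow> m i k \<le> m i (g k)" by metis
  have ne: "g k1 \<noteq> g k2" if k: "k1 \<in> peaks" "k2 \<in> peaks" "k1 < k2" for k1 k2
  proof
    assume eq': "g k1 = g k2"
    have "k2 \<le> g k2"
    proof (rule ccontr)
      assume "\<not> k2 \<le> g k2"
      then obtain i where "m i (g k2) < m i k2" using jump_below[of k2 "g k2"] k(2) by (auto simp: peaks_def)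
      then show False using g(2)[OF k(2), of i] by simp
    qed
    moreover obtain i where i: "i \<in> B" "m i k2 < m i k1" using k by (auto simp: peaks_def)
    ultimately have "m i (g k2) \<le> m i k2" by (intro mono_B) auto
    then show False using g(2)[OF k(1), of i] i eq' by simp
  qed
  have "inj_on g peaks"
  proof (rule inj_onI)
    fix x y assume "x \<in> peaks" "y \<in> peaks" "g x = g y"
    then show "x = y" using ne[of x y] ne[of y x] by (cases x y rule: linorder_cases) auto
  qed
  then show ?thesis
    using card_inj_on_le[of g peaks K] g(1) finite_subset[OF K finite_support] by blast
qed

lemma card_minimal_cover:
  "card (ARG_MIN card K. K \<subseteq> support \<and> (\<Union>k\<in>K. box k) = (\<Union>k\<in>support. box k)) = card peaks"
    (is "card ?Z = _")
proof -
  let ?P = "\<lambda>K. K \<subseteq> support \<and> (\<Union>k\<in>K. box k) = (\<Union>k\<in>support. box k)"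
  have "?P peaks" using peaks_subset box_peaks by blast
  from arg_min_nat_lemma[of ?P, OF this, of card]
  have "?P ?Z" "card ?Z \<le> card peaks" using \<open>?P peaks\<close> by blast+
  then show ?thesis using card_peaks_le[of ?Z] by linarith
qed

text \<open>The orders in \<open>B\<close> decrease, so whether a jump is a peak is decided at the next jump; the last
  jump always is one.\<close>
lemma card_peaks:
  assumes "support \<noteq> {}"
  defines "ks \<equiv> sorted_list_of_set jumps"
  shows "card peaks = 1 + card {ks ! j | j. Suc j < length ks \<and> (\<exists>i\<in>B. m i (ks ! Suc j) < m i (ks ! j))}"
proof -
  let ?D = "{ks ! j | j. Suc j < length ks \<and> (\<exists>i\<in>B. m i (ks ! Suc j) < m i (ks ! j))}"
  have set: "set ks = jumps" and sd: "sorted_wrt (<) ks"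
    using finite_jumps by (auto simp: ks_def)
  have dis: "distinct ks" by (simp add: ks_def)
  have "jumps \<noteq> {}" using Min_support_in_jumps[OF assms(1)] by blast
  then have ne: "ks \<noteq> []" using set by auto
  define last_ix where "last_ix = length ks - 1"
  have len: "length ks = Suc last_ix" using ne by (simp add: last_ix_def)
  have lt: "ks ! j < ks ! j' \<longleftrightarrow> j < j'" if "j < length ks" "j' < length ks" for j j'
    using sorted_wrt_nth_less[OF sd, of j j'] sorted_wrt_nth_less[OF sd, of j' j] that
    by (cases j j' rule: linorder_cases) auto
  have "peaks = insert (ks ! last_ix) ?D"
  proof (intro equalityI subsetI)
    fix k assume k: "k \<in> peaks"
    then have "k \<in> set ks" by (simp add: set peaks_def)
    then obtain j where j: "j < length ks" "k = ks ! j" by (auto simp: in_set_conv_nth)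
    show "k \<in> insert (ks ! last_ix) ?D"
    proof (cases "Suc j < length ks")
      case True
      then have "ks ! Suc j \<in> jumps" "k < ks ! Suc j" using lt[of j "Suc j"] j set nth_mem by auto
      then show ?thesis using k True j by (auto simp: peaks_def)
    next
      case False
      then have "j = last_ix" using j len by simp
      then show ?thesis using j by simp
    qed
  next
    fix k assume "k \<in> insert (ks ! last_ix) ?D"
    then obtain j where j: "j < length ks" "k = ks ! j"
      and drop: "Suc j < length ks \<Longrightarrow> \<exists>i\<in>B. m i (ks ! Suc j) < m i (ks ! j)"
    proof (cases "k = ks ! last_ix")
      case True
      show thesis by (rule that[of last_ix]) (use len True in auto)
    next
      case False
      with \<open>k \<in> insert (ks ! last_ix) ?D\<close> obtain j where "k = ks ! j" "Suc j < length ks"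
        "\<exists>i\<in>B. m i (ks ! Suc j) < m i (ks ! j)" by blast
      then show thesis by (intro that[of j]) auto
    qed
    have "k \<in> jumps" using j set nth_mem by blast
    moreover have "\<exists>i\<in>B. m i k' < m i k" if k': "k' \<in> jumps" "k < k'" for k'
    proof -
      obtain j' where j': "j' < length ks" "k' = ks ! j'" using k'(1) set by (metis in_set_conv_nth)
      then have "Suc j \<le> j'" using lt[OF j(1) j'(1)] k'(2) j(2) by simp
      then have le: "Suc j < length ks" "ks ! Suc j \<le> k'"
        using j' lt[of "Suc j" j'] by (auto simp: le_less)
      then obtain i where "i \<in> B" "m i (ks ! Suc j) < m i (ks ! j)" using drop by blast
      then show ?thesis using mono_B[of i "ks ! Suc j" k'] le(2) j(2) by (intro bexI[of _ i]) auto
    qed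
    ultimately show "k \<in> peaks" by (simp add: peaks_def)
  qed
  moreover have "ks ! last_ix \<notin> ?D"
    using dis len by (auto simp: nth_eq_iff_index_eq)
  moreover have "finite ?D" by (rule finite_subset[of _ "set ks"]) auto
  ultimately show ?thesis by simp
qed

text \<open>The run of a peak consists of the later indices with the same orders in \<open>B\<close>. The orders in \<open>A\<close>
  are constant on it too, as a jump inside the run would contradict the choice of the peak.\<close>
lemma peak_run:
  assumes k: "k \<in> peaks"
  obtains k2 where "k \<le> k2" "\<And>i. m i k2 = m i k"
    "\<And>k'. k' < k \<Longrightarrow> \<exists>i\<in>A. m i k' < m i k" "\<And>k'. k2 < k' \<Longrightarrow> \<exists>i\<in>B. m i k' < m i k"
proof -
  have kj: "k \<in> jumps" and ks: "k \<in> support" using k peaks_subset by (auto simp: peaks_def)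
  define L where "L = {j. k \<le> j \<and> (\<forall>i\<in>B. m i j = m i k)}"
  have "L \<subseteq> support"
  proof
    fix j assume j: "j \<in> L"
    have "0 < m i j" for i
    proof (cases "i \<in> A")
      case True
      then have "m i k \<le> m i j" using j by (intro mono_A) (auto simp: L_def)
      moreover have "0 < m i k" using ks by (simp add: support_def)
      ultimately show ?thesis by linarith
    next
      case False then show ?thesis using j ks by (auto simp: L_def support_def B_eq)
    qed
    then show "j \<in> support" by (simp add: support_def)
  qed
  then have L: "finite L" "L \<noteq> {}" using finite_subset[OF _ finite_support] by (auto simp: L_def)
  define k2 where "k2 = Max L"
  have k2L: "k2 \<in> L" using Max_in[OF L] by (simp add: k2_def)
  then have k2: "k \<le> k2" "\<And>i. i \<in> B \<Longrightarrow> m i k2 = m i k" by (auto simp: L_def)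
  show thesis
  proof (rule that[OF k2(1)])
    fix i show "m i k2 = m i k"
    proof (cases "i \<in> A")
      case True
      show ?thesis
      proof (rule ccontr)
        assume "m i k2 \<noteq> m i k"
        then have "m i k < m i k2" using mono_A[OF True k2(1)] by simp
        then obtain k1 where k1: "k1 \<in> jumps" "k < k1" "k1 \<le> k2"
          using jump_between[OF ks k2(1) _ True] k2L \<open>L \<subseteq> support\<close> by blast
        then obtain j where j: "j \<in> B" "m j k1 < m j k" using k by (auto simp: peaks_def)
        then show False using mono_B[OF j(1) k1(3)] k2(2)[OF j(1)] by simp
      qed
    next
      case False then show ?thesis using k2(2) by (simp add: B_eq)
    qed
  next
    fix k' assume "k' < k" then show "\<exists>i\<in>A. m i k' < m i k" by (rule jump_below[OF kj])
  next
    fix k' assume k': "k2 < k'"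
    then have "k' \<notin> L" using Max_ge[OF L(1), of k'] by (auto simp: k2_def)
    then obtain i where i: "i \<in> B" "m i k' \<noteq> m i k" using k' k2(1) by (auto simp: L_def)
    then show "\<exists>i\<in>B. m i k' < m i k" using mono_B[of i k k'] k' k2(1) by (intro bexI[of _ i]) auto
  qed
qed

lemma corner_inject:
  assumes "k1 \<in> peaks" "k2 \<in> peaks" "corner k1 = corner k2" shows "k1 = k2"
proof -
  have "\<exists>i. m i k1 \<noteq> m i k2" if p: "k1 \<in> peaks" "k2 \<in> peaks" "k1 < k2" for k1 k2
  proof -
    obtain i where "m i k1 < m i k2" using jump_below[of k2 k1] p by (auto simp: peaks_def)
    then show ?thesis by (intro exI[of _ i]) simp
  qed
  then have "k1 \<noteq> k2 \<Longrightarrow> \<exists>i. m i k1 \<noteq> m i k2" using assms(1,2) by (metis linorder_neqE)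
  moreover have "m i k1 = m i k2" for i
  proof -
    have "0 < m i k1" "0 < m i k2" using assms(1,2) peaks_subset by (auto simp: support_def)
    moreover have "m i k1 - 1 = m i k2 - 1" using fun_cong[OF assms(3), of i] by (simp add: corner_def)
    ultimately show ?thesis by linarith
  qed
  ultimately show ?thesis by blast
qed

end

section \<open>The quotient module of a family of sequences of Blaschke products\<close>

locale blaschke_family =
  fixes \<phi> :: "'n::finite \<Rightarrow> int \<Rightarrow> complex \<Rightarrow> complex" and A B :: "'n set"
  assumes nonempty: "A \<noteq> {}" "B \<noteq> {}" and B_eq: "B = UNIV - A"
    and blaschke: "\<And>i k. blaschke_product (\<phi> i k)"
    and no_common: "\<And>i. \<not> (\<exists>\<psi>. inner_function \<psi> \<and> \<not> \<psi> constant_on ball 0 1 \<and> (\<forall>k. inner_dvd \<psi> (\<phi> i k)))"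
    and increasing: "\<And>i k. i \<in> A \<Longrightarrow> inner_dvd (\<phi> i k) (\<phi> i (k + 1))"
    and decreasing: "\<And>i k. i \<in> B \<Longrightarrow> inner_dvd (\<phi> i (k + 1)) (\<phi> i k)"
begin

lemmas inner = blaschke_product_inner[OF blaschke]

definition ord :: "'n \<Rightarrow> int \<Rightarrow> complex \<Rightarrow> nat" where
  "ord i k \<alpha> = zero_order (\<phi> i k) \<alpha>"

lemma monotone_orders_at:
  assumes "\<And>i. cmod (a i) < 1"
  shows "monotone_orders (\<lambda>i k. ord i k (a i)) A B"
proof
  fix i
  have "\<exists>k. \<not> inner_dvd (blaschke_factor (a i)) (\<phi> i k)"
    using no_common[of i] inner_function_blaschke_factor[OF assms[of i]]
      blaschke_factor_not_constant[OF assms[of i]] by blast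
  then show "\<exists>k. ord i k (a i) = 0"
    using inner_dvd_factor_iff_order[OF inner assms[of i]] by (auto simp: ord_def)
qed (use nonempty B_eq assms in \<open>auto simp: ord_def intro!: inner_dvd_zero_order_le increasing
  decreasing inner\<close>)

definition support :: "('n \<Rightarrow> complex) \<Rightarrow> int set" where
  "support a = monotone_orders.support (\<lambda>i k. ord i k (a i))"

definition peaks :: "('n \<Rightarrow> complex) \<Rightarrow> int set" where
  "peaks a = monotone_orders.peaks (\<lambda>i k. ord i k (a i)) A B"

definition corner :: "('n \<Rightarrow> complex) \<Rightarrow> int \<Rightarrow> 'n \<Rightarrow> nat" where
  "corner a k i = ord i k (a i) - 1"

text \<open>The orthogonal complement of the quotient module is given by the vanishing of these Taylor coefficients.\<close>
definition chain_indices :: "(('n \<Rightarrow> complex) \<times> ('n \<Rightarrow> nat)) set" where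
  "chain_indices = {(a, \<beta>). \<exists>k. \<forall>i. cmod (a i) < 1 \<and> \<beta> i < ord i k (a i)}"

lemma tensor_space_model:
  "tensor_space (\<lambda>i. model_space (\<phi> i k)) =
    closed_cspan {poly_jordan a \<beta> | a \<beta>. \<forall>i. cmod (a i) < 1 \<and> \<beta> i < ord i k (a i)}"
proof -
  let ?G = "\<lambda>i. {jordan (cnj a) j | a j. cmod a < 1 \<and> j < zero_order (\<phi> i k) a}"
  have "tensor_space (\<lambda>i. model_space (\<phi> i k)) = closed_cspan {tensor g | g. \<forall>i. g i \<in> ?G i}"
    by (rule tensor_space_closed_cspan) (rule model_space_blaschke[OF blaschke])
  also have "{tensor g | g. \<forall>i. g i \<in> ?G i} =
      {poly_jordan a \<beta> | a \<beta>. \<forall>i. cmod (a i) < 1 \<and> \<beta> i < ord i k (a i)}"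
  proof safe
    fix g assume "\<forall>i. g i \<in> ?G i"
    then have "\<forall>i. \<exists>a j. g i = jordan (cnj a) j \<and> cmod a < 1 \<and> j < zero_order (\<phi> i k) a" by simp
    then obtain a \<beta> where "\<And>i. g i = jordan (cnj (a i)) (\<beta> i)" "\<And>i. cmod (a i) < 1"
      "\<And>i. \<beta> i < zero_order (\<phi> i k) (a i)" by metis
    then show "\<exists>a \<beta>. tensor g = poly_jordan a \<beta> \<and> (\<forall>i. cmod (a i) < 1 \<and> \<beta> i < ord i k (a i))"
      unfolding poly_jordan_def ord_def
      by (intro exI[of _ a] exI[of _ \<beta>] conjI arg_cong[where f = tensor] ext allI) auto
  next
    fix a \<beta> assume "\<forall>i. cmod (a i) < 1 \<and> \<beta> i < ord i k (a i)"
    then show "\<exists>g. poly_jordan a \<beta> = tensor g \<and> (\<forall>i. g i \<in> ?G i)"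
      unfolding poly_jordan_def ord_def
      by (intro exI[of _ "\<lambda>i. jordan (cnj (a i)) (\<beta> i)"]) auto
  qed
  finally show ?thesis .
qed

lemma Q_Phi_eq: "Q_Phi \<phi> = closed_cspan {poly_jordan a \<beta> | a \<beta>. (a, \<beta>) \<in> chain_indices}"
proof -
  have "(\<Union>k. {poly_jordan a \<beta> | a \<beta>. \<forall>i. cmod (a i) < 1 \<and> \<beta> i < ord i k (a i)})
      = {poly_jordan a \<beta> | a \<beta>. (a, \<beta>) \<in> chain_indices}"
    by (auto simp: chain_indices_def)
  then show ?thesis
    unfolding Q_Phi_def tensor_space_model closed_cspan_UN by simp
qed

lemma chain_in_Q: "(a, \<beta>) \<in> chain_indices \<Longrightarrow> poly_jordan a \<beta> \<in> Q_Phi \<phi>"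
  unfolding Q_Phi_eq by (rule subsetD[OF closed_cspan_superset]) blast

lemma closed_Q: "closed_csubspace (Q_Phi \<phi>)"
  unfolding Q_Phi_eq by (rule closed_csubspace_closed_cspan)

lemma chain_lower:
  assumes "(a, \<beta>) \<in> chain_indices" "\<And>i. \<gamma> i \<le> \<beta> i"
  shows "(a, \<gamma>) \<in> chain_indices"
  using assms le_less_trans unfolding chain_indices_def by blast

lemma Q_invariant: assumes "x \<in> Q_Phi \<phi>" shows "back_shift i x \<in> Q_Phi \<phi>"
proof -
  have "closed_cspan {poly_jordan a \<beta> | a \<beta>. (a, \<beta>) \<in> chain_indices} \<subseteq> {x. back_shift i x \<in> Q_Phi \<phi>}"
  proof (rule closed_cspan_minimal[OF closed_csubspace_vimage[OF back_shift.bounded closed_Q]], safe)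
    fix a \<beta> assume a: "(a, \<beta>) \<in> chain_indices"
    then have "cmod (a i) < 1" by (auto simp: chain_indices_def)
    moreover have "(a, \<beta>(i := \<beta> i - 1)) \<in> chain_indices" by (rule chain_lower[OF a]) simp
    ultimately show "back_shift i (poly_jordan a \<beta>) \<in> Q_Phi \<phi>"
      using a closed_csubspaceD[OF closed_Q] chain_in_Q by (auto simp: back_shift_poly_jordan)
  qed
  then show ?thesis using assms Q_Phi_eq by blast
qed

lemma corner_in_chain:
  assumes a: "\<And>i. cmod (a i) < 1" and k: "k \<in> peaks a"
  shows "(a, corner a k) \<in> chain_indices"
proof -
  interpret o: monotone_orders "\<lambda>i k. ord i k (a i)" A B by (rule monotone_orders_at[OF a])
  have "k \<in> o.support" using k o.peaks_subset by (auto simp: peaks_def)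
  then show ?thesis
    using o.corner_less[of k] a unfolding chain_indices_def corner_def o.corner_def by auto
qed

subsection \<open>Lower bound\<close>

text \<open>Taking the factors with increasing sequences at the end of the run of the peak and the others at its
  beginning makes them divisible as often as possible. After removing one Blaschke factor from each, the
  product still vanishes to all listed orders, except for the one at the corner of the peak.\<close>
lemma corner_dual:
  assumes a: "\<And>i. cmod (a i) < 1" and k: "k \<in> peaks a"
  obtains g where "cinner (poly_jordan a (corner a k)) g \<noteq> 0"
    "\<And>b \<beta>. (b, \<beta>) \<in> chain_indices \<Longrightarrow> (b, \<beta>) \<noteq> (a, corner a k) \<Longrightarrow> cinner (poly_jordan b \<beta>) g = 0"
    "\<And>\<beta>. (a, \<beta>) \<in> chain_indices \<Longrightarrow> (\<And>i. corner a k i \<le> \<beta> i) \<Longrightarrow> \<beta> = corner a k"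
proof -
  interpret o: monotone_orders "\<lambda>i k. ord i k (a i)" A B by (rule monotone_orders_at[OF a])
  have kp: "k \<in> o.peaks" using k by (simp add: peaks_def)
  have kpos: "0 < ord i k (a i)" for i using kp o.peaks_subset by (auto simp: o.support_def)
  obtain k2 where k2: "k \<le> k2" "\<And>i. ord i k2 (a i) = ord i k (a i)"
    "\<And>k'. k' < k \<Longrightarrow> \<exists>i\<in>A. ord i k' (a i) < ord i k (a i)"
    "\<And>k'. k2 < k' \<Longrightarrow> \<exists>i\<in>B. ord i k' (a i) < ord i k (a i)"
    using o.peak_run[OF kp] by metis
  define \<kappa> where "\<kappa> i = (if i \<in> A then k2 else k)" for i
  have ord\<kappa>: "ord i (\<kappa> i) (a i) = ord i k (a i)" for i by (simp add: \<kappa>_def k2(2))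
  have mono: "ord i k' b \<le> ord i k'' b" if "i \<in> A \<and> k' \<le> k'' \<or> i \<in> B \<and> k'' \<le> k'" "cmod b < 1" for i k' k'' b
  proof -
    interpret p: monotone_orders "\<lambda>i k. ord i k ((\<lambda>_. b) i)" A B
      by (rule monotone_orders_at) (use that in simp)
    show ?thesis using that p.mono_A p.mono_B by auto
  qed
  have "\<exists>f. (\<forall>b j. cmod b < 1 \<longrightarrow> b \<noteq> a i \<longrightarrow> j < ord i (\<kappa> i) b \<longrightarrow> taylor f b j = 0) \<and>
      (\<forall>j. j < ord i k (a i) - 1 \<longrightarrow> taylor f (a i) j = 0) \<and>
      taylor f (a i) (ord i k (a i) - 1) \<noteq> 0" for i
  proof -
    have pos: "0 < zero_order (\<phi> i (\<kappa> i)) (a i)" using kpos ord\<kappa> by (simp add: ord_def)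
    obtain f where
      "\<And>b j. cmod b < 1 \<Longrightarrow> b \<noteq> a i \<Longrightarrow> j < zero_order (\<phi> i (\<kappa> i)) b \<Longrightarrow> taylor f b j = 0"
      "\<And>j. j < zero_order (\<phi> i (\<kappa> i)) (a i) - 1 \<Longrightarrow> taylor f (a i) j = 0"
      "taylor f (a i) (zero_order (\<phi> i (\<kappa> i)) (a i) - 1) \<noteq> 0"
      using corner_functional[OF blaschke a pos] by blast
    then show ?thesis unfolding ord\<kappa>[symmetric] unfolding ord_def by blast
  qed
  then obtain f where f:
    "\<And>i b j. cmod b < 1 \<Longrightarrow> b \<noteq> a i \<Longrightarrow> j < ord i (\<kappa> i) b \<Longrightarrow> taylor (f i) b j = 0"
    "\<And>i j. j < ord i k (a i) - 1 \<Longrightarrow> taylor (f i) (a i) j = 0"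
    "\<And>i. taylor (f i) (a i) (ord i k (a i) - 1) \<noteq> 0" by metis
  have zero_iff: "cinner (poly_jordan b \<beta>) (tensor f) = 0 \<longleftrightarrow> (\<exists>i. taylor (f i) (b i) (\<beta> i) = 0)"
    for b \<beta>
  proof -
    have "cinner (poly_jordan b \<beta>) (tensor f) = cnj (cinner (tensor f) (poly_jordan b \<beta>))"
      by (rule cinner_cnj[symmetric])
    then show ?thesis by (simp add: cinner_poly_jordan)
  qed
  have run: "k \<le> k' \<and> k' \<le> k2" if ex: "\<And>i. \<lbrakk>i \<in> A \<longrightarrow> k' < k; i \<in> B \<longrightarrow> k2 < k'\<rbrakk> \<Longrightarrow> ord i k (a i) \<le> ord i k' (a i)" for k'
  proof (rule ccontr)
    assume "\<not> (k \<le> k' \<and> k' \<le> k2)"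
    then consider "k' < k" | "k2 < k'" by linarith
    then show False
    proof cases
      case 1
      then obtain i where "i \<in> A" "ord i k' (a i) < ord i k (a i)" using k2(3) by blast
      then show False using ex[of i] 1 B_eq by auto
    next
      case 2
      then obtain i where "i \<in> B" "ord i k' (a i) < ord i k (a i)" using k2(4) by blast
      then show False using ex[of i] 2 B_eq by auto
    qed
  qed
  show thesis
  proof (rule that[of "tensor f"])
    show "cinner (poly_jordan a (corner a k)) (tensor f) \<noteq> 0"
      unfolding zero_iff corner_def using f(3) by blast
  next
    fix b \<beta> assume b: "(b, \<beta>) \<in> chain_indices" "(b, \<beta>) \<noteq> (a, corner a k)"
    then obtain k' where bd: "\<And>i. cmod (b i) < 1" and lt: "\<And>i. \<beta> i < ord i k' (b i)"
      by (auto simp: chain_indices_def)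
    show "cinner (poly_jordan b \<beta>) (tensor f) = 0"
    proof (rule ccontr)
      assume "cinner (poly_jordan b \<beta>) (tensor f) \<noteq> 0"
      then have nz: "taylor (f i) (b i) (\<beta> i) \<noteq> 0" for i using zero_iff by blast
      have ge1: "ord i (\<kappa> i) (b i) \<le> \<beta> i" if "b i \<noteq> a i" for i
        using f(1)[OF bd that] nz[of i] by (meson not_le)
      have ge2: "ord i k (a i) - 1 \<le> \<beta> i" if "b i = a i" for i
        using f(2)[of "\<beta> i" i] nz[of i] that by (metis not_le)
      have "k \<le> k' \<and> k' \<le> k2"
      proof (rule run)
        fix i assume i: "i \<in> A \<longrightarrow> k' < k" "i \<in> B \<longrightarrow> k2 < k'"
        have "ord i k' (b i) \<le> ord i (\<kappa> i) (b i)"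
          using i k2(1) by (intro mono bd) (auto simp: \<kappa>_def B_eq)
        then have "b i = a i" using ge1[of i] lt[of i] by linarith
        then show "ord i k (a i) \<le> ord i k' (a i)" using ge2[of i] lt[of i] by simp
      qed
      have "b i = a i \<and> \<beta> i = corner a k i" for i
      proof -
        have "ord i k' (b i) \<le> ord i (\<kappa> i) (b i)"
          using \<open>k \<le> k' \<and> k' \<le> k2\<close> by (intro mono bd) (auto simp: \<kappa>_def B_eq)
        then have "\<beta> i < ord i (\<kappa> i) (b i)" using lt[of i] by linarith
        moreover from this have "b i = a i" using ge1[of i] by linarith
        ultimately show ?thesis using ge2[of i] ord\<kappa>[of i] by (simp add: corner_def)
      qed
      then show False using b(2) by (auto simp: fun_eq_iff)
    qed
  next
    fix \<beta> assume \<beta>: "(a, \<beta>) \<in> chain_indices" "\<And>i. corner a k i \<le> \<beta> i"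
    then obtain k' where lt: "\<And>i. \<beta> i < ord i k' (a i)" by (auto simp: chain_indices_def)
    have le: "ord i k (a i) \<le> ord i k' (a i)" for i
      using lt[of i] \<beta>(2)[of i] by (simp add: corner_def)
    then have "k \<le> k' \<and> k' \<le> k2" by (intro run)
    then have "ord i k' (a i) \<le> ord i (\<kappa> i) (a i)" for i
      by (intro mono a) (auto simp: \<kappa>_def B_eq)
    then have "ord i k' (a i) \<le> ord i k (a i)" for i using ord\<kappa> by simp
    then have lt': "\<beta> i < ord i k (a i)" for i using lt less_le_trans by blast
    have "\<beta> i \<le> corner a k i" for i using lt'[of i] by (simp add: corner_def)
    then show "\<beta> = corner a k" using \<beta>(2) by (intro ext antisym) auto
  qed
qed

text \<open>The dual functions of the peaks are joint eigenfunctionals: on the vector at the corner the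
  nilpotent part of the shift leads to a vector that they annihilate, and no listed vector is led to the
  corner, because corners of peaks are maximal.\<close>
lemma card_peaks_le_co_rank:
  assumes a: "\<And>i. cmod (a i) < 1"
  shows "enat (card (peaks a)) \<le> co_rank (Q_Phi \<phi>)"
proof -
  interpret o: monotone_orders "\<lambda>i k. ord i k (a i)" A B by (rule monotone_orders_at[OF a])
  have "\<forall>k\<in>peaks a. \<exists>g. cinner (poly_jordan a (corner a k)) g \<noteq> 0 \<and>
      (\<forall>b \<beta>. (b, \<beta>) \<in> chain_indices \<longrightarrow> (b, \<beta>) \<noteq> (a, corner a k) \<longrightarrow> cinner (poly_jordan b \<beta>) g = 0) \<and>
      (\<forall>\<beta>. (a, \<beta>) \<in> chain_indices \<longrightarrow> (\<forall>i. corner a k i \<le> \<beta> i) \<longrightarrow> \<beta> = corner a k)"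
  proof
    fix k assume k: "k \<in> peaks a"
    show "\<exists>g. cinner (poly_jordan a (corner a k)) g \<noteq> 0 \<and>
      (\<forall>b \<beta>. (b, \<beta>) \<in> chain_indices \<longrightarrow> (b, \<beta>) \<noteq> (a, corner a k) \<longrightarrow> cinner (poly_jordan b \<beta>) g = 0) \<and>
      (\<forall>\<beta>. (a, \<beta>) \<in> chain_indices \<longrightarrow> (\<forall>i. corner a k i \<le> \<beta> i) \<longrightarrow> \<beta> = corner a k)"
      by (rule corner_dual[OF a k]) blast
  qed
  from bchoice[OF this] obtain g where gg: "\<forall>k\<in>peaks a. cinner (poly_jordan a (corner a k)) (g k) \<noteq> 0 \<and>
      (\<forall>b \<beta>. (b, \<beta>) \<in> chain_indices \<longrightarrow> (b, \<beta>) \<noteq> (a, corner a k) \<longrightarrow> cinner (poly_jordan b \<beta>) (g k) = 0) \<and>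
      (\<forall>\<beta>. (a, \<beta>) \<in> chain_indices \<longrightarrow> (\<forall>i. corner a k i \<le> \<beta> i) \<longrightarrow> \<beta> = corner a k)" ..
  have g: "cinner (poly_jordan a (corner a k)) (g k) \<noteq> 0"
    "\<And>b \<beta>. (b, \<beta>) \<in> chain_indices \<Longrightarrow> (b, \<beta>) \<noteq> (a, corner a k) \<Longrightarrow> cinner (poly_jordan b \<beta>) (g k) = 0"
    "\<And>\<beta>. (a, \<beta>) \<in> chain_indices \<Longrightarrow> (\<And>i. corner a k i \<le> \<beta> i) \<Longrightarrow> \<beta> = corner a k"
    if "k \<in> peaks a" for k
    using bspec[OF gg that] by blast+
  have eig: "cinner (back_shift i x) (g k) = cnj (a i) * cinner x (g k)"
    if k: "k \<in> peaks a" and x: "x \<in> Q_Phi \<phi>" for k i x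
  proof -
    let ?F = "\<lambda>x. back_shift i x + cscale (- cnj (a i)) x"
    have bF: "bounded_clinear ?F"
      by (intro bounded_clinear_add back_shift.bounded bounded_clinear_cscale)
    have "closed_cspan {poly_jordan b \<beta> | b \<beta>. (b, \<beta>) \<in> chain_indices} \<subseteq>
        {x. ?F x \<in> {y. \<forall>h\<in>{g k}. cinner y h = 0}}"
    proof (rule closed_cspan_minimal[OF closed_csubspace_vimage[OF bF closed_csubspace_orth]], safe)
      fix b \<beta> assume b: "(b, \<beta>) \<in> chain_indices"
      then have bi: "cmod (b i) < 1" by (auto simp: chain_indices_def)
      have low: "cinner (if \<beta> i = 0 then 0 else poly_jordan b (\<beta>(i := \<beta> i - 1))) (g k) = 0"
      proof (cases "\<beta> i = 0")
        case False
        have c: "(b, \<beta>(i := \<beta> i - 1)) \<in> chain_indices" by (rule chain_lower[OF b]) simp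
        have "(b, \<beta>(i := \<beta> i - 1)) \<noteq> (a, corner a k)"
        proof
          assume eq: "(b, \<beta>(i := \<beta> i - 1)) = (a, corner a k)"
          then have "corner a k j \<le> \<beta> j" for j by (metis Pair_inject diff_le_self fun_upd_apply order_refl)
          then have "\<beta> = corner a k" using g(3)[OF k, of \<beta>] b eq by auto
          then show False using eq False by (metis Pair_inject diff_less fun_upd_same less_irrefl neq0_conv zero_less_one)
        qed
        then show ?thesis using g(2)[OF k c] False by simp
      qed simp
      have "(cnj (b i) - cnj (a i)) * cinner (poly_jordan b \<beta>) (g k) = 0"
        using g(2)[OF k b] by (cases "(b, \<beta>) = (a, corner a k)") auto
      then show "cinner (?F (poly_jordan b \<beta>)) (g k) = 0"
        unfolding back_shift_poly_jordan[of b i \<beta>, OF bi] cinner_add_left cinner_cscale_left low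
        by (simp add: algebra_simps)
    qed
    then have "cinner (?F x) (g k) = 0" using x Q_Phi_eq by blast
    then show ?thesis by (simp add: cinner_add_left cinner_cscale_left del: ell2.scale_minus_left)
  qed
  have "enat (card (peaks a)) \<le> ecard S" if S: "generated back_shift S = Q_Phi \<phi>" for S
  proof (rule back_shift.card_le_generators[OF S _ eig, where e = "\<lambda>k. poly_jordan a (corner a k)"])
    show "finite (peaks a)" using o.finite_peaks by (simp add: peaks_def)
    fix k assume k: "k \<in> peaks a"
    show "poly_jordan a (corner a k) \<in> Q_Phi \<phi>" by (rule chain_in_Q[OF corner_in_chain[OF a k]])
    show "cinner (poly_jordan a (corner a k)) (g k) \<noteq> 0" by (rule g(1)[OF k])
  next
    fix j k assume jk: "j \<in> peaks a" "k \<in> peaks a" "j \<noteq> k"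
    have "o.corner j \<noteq> o.corner k"
      using o.corner_inject[of j k] jk by (auto simp: peaks_def)
    then have "corner a j \<noteq> corner a k" unfolding corner_def o.corner_def by (simp add: fun_eq_iff)
    then show "cinner (poly_jordan a (corner a j)) (g k) = 0"
      using g(2)[OF jk(2) corner_in_chain[OF a jk(1)]] by simp
  qed
  then show ?thesis
    unfolding co_rank_eq tuple_rank_def by (intro INF_greatest) auto
qed

subsection \<open>Upper bound\<close>

text \<open>The \<open>i\<close>-th shift minus the conjugate of \<open>a i\<close> lowers the exponent \<open>\<beta> i\<close> by one.\<close>
lemma chain_descend:
  assumes W: "closed_csubspace W" "\<And>i x. x \<in> W \<Longrightarrow> back_shift i x \<in> W"
    and a: "\<And>i. cmod (a i) < 1" and "poly_jordan a \<beta> \<in> W" "\<And>i. \<gamma> i \<le> \<beta> i"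
  shows "poly_jordan a \<gamma> \<in> W"
  using assms(4,5)
proof (induction "\<Sum>i\<in>UNIV. \<beta> i - \<gamma> i" arbitrary: \<beta> rule: less_induct)
  case less
  show ?case
  proof (cases "\<beta> = \<gamma>")
    case False
    then obtain i where i: "\<gamma> i < \<beta> i" using less.prems(2) by (metis ext le_neq_implies_less)
    define \<beta>' where "\<beta>' = \<beta>(i := \<beta> i - 1)"
    have "poly_jordan a \<beta>' = back_shift i (poly_jordan a \<beta>) - cscale (cnj (a i)) (poly_jordan a \<beta>)"
      using back_shift_poly_jordan[of a i \<beta>, OF a] i by (simp add: \<beta>'_def)
    then have "poly_jordan a \<beta>' \<in> W"
      using less.prems(1) W(2) closed_csubspaceD[OF W(1)] by auto
    moreover have "(\<Sum>j\<in>UNIV. \<beta>' j - \<gamma> j) < (\<Sum>j\<in>UNIV. \<beta> j - \<gamma> j)"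
      by (rule sum_strict_mono_ex1) (use i in \<open>auto simp: \<beta>'_def intro!: exI[of _ i]\<close>)
    moreover have "\<gamma> j \<le> \<beta>' j" for j using i less.prems(2)[of j] by (cases "j = i") (auto simp: \<beta>'_def)
    ultimately show ?thesis using less.hyps by blast
  qed (use less.prems in simp)
qed

lemma countable_points: "countable {a. (\<forall>i. cmod (a i) < 1) \<and> support a \<noteq> {}}"
proof (rule countable_subset)
  let ?C = "\<lambda>i. \<Union>k. {\<alpha>. cmod \<alpha> < 1 \<and> 0 < zero_order (\<phi> i k) \<alpha>}"
  show "countable (PiE UNIV ?C)"
    by (intro countable_PiE countable_UN countable_zeros blaschke) auto
  show "{a. (\<forall>i. cmod (a i) < 1) \<and> support a \<noteq> {}} \<subseteq> PiE UNIV ?C"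
  proof
    fix a assume "a \<in> {a. (\<forall>i. cmod (a i) < 1) \<and> support a \<noteq> {}}"
    then obtain k where a: "\<forall>i. cmod (a i) < 1" "k \<in> support a" by blast
    then interpret o: monotone_orders "\<lambda>i k. ord i k (a i)" A B by (intro monotone_orders_at) auto
    have "k \<in> o.support" using a(2) by (simp add: support_def)
    then have "0 < ord i k (a i)" for i by (simp add: o.support_def)
    then have "0 < zero_order (\<phi> i k) (a i)" for i unfolding ord_def .
    then have "a i \<in> ?C i" for i using a(1) by blast
    then show "a \<in> PiE UNIV ?C" by (intro PiE_I) auto
  qed
qed

text \<open>The \<open>j\<close>-th generator is a superposition over all points of the chain at the corner of one
  peak. Different points differ in a coordinate and can be separated there, so the superposition
  generates all its terms; and the chains at the corners generate all chains.\<close>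
lemma co_rank_le:
  assumes r: "\<And>a. (\<And>i. cmod (a i) < 1) \<Longrightarrow> support a \<noteq> {} \<Longrightarrow> card (peaks a) \<le> r"
  shows "co_rank (Q_Phi \<phi>) \<le> enat r"
proof -
  define P where "P = {a. (\<forall>i. cmod (a i) < 1) \<and> support a \<noteq> {}}"
  have cP: "countable P" unfolding P_def by (rule countable_points)
  have enum: "\<exists>c. peaks a = c ` {..<r}" if "a \<in> P" for a
  proof -
    have a: "\<And>i. cmod (a i) < 1" and s: "support a \<noteq> {}" using that by (auto simp: P_def)
    interpret o: monotone_orders "\<lambda>i k. ord i k (a i)" A B by (rule monotone_orders_at[OF a])
    have fin: "finite (peaks a)" using o.finite_peaks by (simp add: peaks_def)
    have "peaks a \<noteq> {}" using o.peaks_nonempty s by (simp add: peaks_def support_def)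
    then have pos: "0 < card (peaks a)" using fin by (simp add: card_gt_0_iff)
    obtain h where h: "bij_betw h {0..<card (peaks a)} (peaks a)"
      using ex_bij_betw_nat_finite[OF fin] by blast
    then have img: "peaks a = h ` {0..<card (peaks a)}" by (simp add: bij_betw_def)
    have "peaks a = (\<lambda>j. if j < card (peaks a) then h j else h 0) ` {..<r}" (is "_ = ?c ` _")
    proof (rule equalityI)
      have "{0..<card (peaks a)} \<subseteq> {..<r}" using r[OF a s] by auto
      moreover have "h ` {0..<card (peaks a)} = ?c ` {0..<card (peaks a)}" by (rule image_cong) auto
      ultimately show "peaks a \<subseteq> ?c ` {..<r}" unfolding img[symmetric] using img by blast
      show "?c ` {..<r} \<subseteq> peaks a" using pos bij_betwE[OF h] by auto
    qed
    then show ?thesis by blast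
  qed
  then obtain c where c: "\<And>a. a \<in> P \<Longrightarrow> peaks a = c a ` {..<r}" by metis
  \<comment> \<open>The points are numbered injectively by \<open>N\<close>; the other indices carry the zero vector.\<close>
  define N where "N = to_nat_on P ` P"
  define pt where "pt = from_nat_into P"
  define v where "v j n = (if n \<in> N then poly_jordan (pt n) (corner (pt n) (c (pt n) j)) else 0)" for j n
  have ptP: "pt n \<in> P" if "n \<in> N" for n
    using that from_nat_into[of P n] by (auto simp: N_def pt_def)
  have pt_inj: "pt n \<noteq> pt n'" if "n \<in> N" "n' \<in> N" "n \<noteq> n'" for n n'
    using that cP by (auto simp: N_def pt_def)
  have "\<exists>f. f \<in> closed_cspan (range (v j)) \<and>
      (\<forall>W m. closed_csubspace W \<longrightarrow> (\<forall>i. \<forall>x\<in>W. back_shift i x \<in> W) \<longrightarrow> f \<in> W \<longrightarrow> v j m \<in> W)" for j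
  proof -
    have "\<exists>R. back_shift.polynomial_op R \<and> R (v j n) = v j n \<and> R (v j n') = 0"
      if nn: "n \<noteq> n'" "v j n \<noteq> 0" for n n'
    proof (cases "n' \<in> N")
      case False
      then show ?thesis using back_shift.polynomial_op.ident by (intro exI[of _ "\<lambda>x. x"]) (simp add: v_def)
    next
      case True
      have n: "n \<in> N" using nn(2) by (auto simp: v_def split: if_splits)
      obtain i where i: "pt n i \<noteq> pt n' i" using pt_inj[OF n True nn(1)] by blast
      have disc: "cmod (pt n i) < 1" "cmod (pt n' i) < 1" using ptP n True by (auto simp: P_def)
      have "cnj (pt n i) \<noteq> cnj (pt n' i)" using i by simp
      from back_shift.isolating_operator[OF back_shift.polynomial_op.coord[of i] this
          back_shift_nilpotent[of "pt n" i, OF disc(1)] back_shift_nilpotent[of "pt n'" i, OF disc(2)]]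
      obtain R where "back_shift.polynomial_op R" "R (v j n) = v j n" "R (v j n') = 0"
        using n True by (auto simp: v_def)
      then show ?thesis by blast
    qed
    from back_shift.cyclic_superposition[of "v j", OF this] show ?thesis by metis
  qed
  then obtain f where f: "\<And>j. f j \<in> closed_cspan (range (v j))"
    "\<And>j W m. closed_csubspace W \<Longrightarrow> (\<And>i x. x \<in> W \<Longrightarrow> back_shift i x \<in> W) \<Longrightarrow> f j \<in> W \<Longrightarrow> v j m \<in> W"
    by metis
  define S where "S = f ` {..<r}"
  have "S \<subseteq> Q_Phi \<phi>"
  proof -
    have "v j n \<in> Q_Phi \<phi>" if "j < r" for j n
    proof (cases "n \<in> N")
      case True
      then have "pt n \<in> P" by (rule ptP)
      then have "cmod (pt n i) < 1" "c (pt n) j \<in> peaks (pt n)" for i using c that by (auto simp: P_def)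
      then show ?thesis using True by (simp add: v_def chain_in_Q corner_in_chain)
    qed (simp add: v_def closed_csubspaceD(1)[OF closed_Q])
    then have "closed_cspan (range (v j)) \<subseteq> Q_Phi \<phi>" if "j < r" for j
      using that by (intro closed_cspan_minimal closed_Q) auto
    then show ?thesis using f(1) by (auto simp: S_def)
  qed
  moreover have "generated back_shift S = Q_Phi \<phi>"
  proof
    show "generated back_shift S \<subseteq> Q_Phi \<phi>"
      by (rule back_shift.generated_minimal[OF closed_Q Q_invariant \<open>S \<subseteq> Q_Phi \<phi>\<close>])
    let ?W = "generated back_shift S"
    note W = back_shift.closed_csubspace_generated[of S] back_shift.generated_invariant[of _ S]
    show "Q_Phi \<phi> \<subseteq> ?W"
      unfolding Q_Phi_eq
    proof (rule closed_cspan_minimal[OF W(1)], safe)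
      fix a \<beta> assume "(a, \<beta>) \<in> chain_indices"
      then obtain k where a: "\<And>i. cmod (a i) < 1" and k: "\<And>i. \<beta> i < ord i k (a i)"
        by (auto simp: chain_indices_def)
      interpret o: monotone_orders "\<lambda>i k. ord i k (a i)" A B by (rule monotone_orders_at[OF a])
      have ks: "k \<in> o.support" using k by (auto simp: o.support_def intro: le_less_trans[OF le0])
      then have aP: "a \<in> P" using a by (auto simp: P_def support_def)
      obtain k' where k': "k' \<in> o.peaks" "\<And>i. ord i k (a i) \<le> ord i k' (a i)"
        using o.box_subset_peak[OF ks] by blast
      have "k' \<in> c a ` {..<r}" using c[OF aP] k'(1) by (simp add: peaks_def)
      then obtain j where j: "j < r" "k' = c a j" by auto
      define n where "n = to_nat_on P a"
      have n: "n \<in> N" "pt n = a" using aP cP by (auto simp: n_def N_def pt_def)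
      have "f j \<in> ?W" using back_shift.generated_superset[of S] j by (auto simp: S_def)
      then have "v j n \<in> ?W" using f(2)[OF W] by blast
      then have cor: "poly_jordan a (corner a k') \<in> ?W" using n j by (simp add: v_def)
      have le: "\<beta> i \<le> corner a k' i" for i
        using k[of i] k'(2)[of i] by (simp add: corner_def)
      show "poly_jordan a \<beta> \<in> ?W"
        by (rule chain_descend[OF W(1) _ a cor le]) (rule W(2))
    qed
  qed
  ultimately have "co_rank (Q_Phi \<phi>) \<le> ecard S"
    unfolding co_rank_eq tuple_rank_def by (intro INF_lower) auto
  also have "ecard S \<le> enat r"
    using card_image_le[of "{..<r}" f] by (simp add: ecard_def S_def)
  finally show ?thesis .
qed

end

section \<open>Minimal index sets and the co-rank\<close>

lemma inner_dvd_refl: "inner_dvd \<psi> \<psi>"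
  unfolding inner_dvd_def using inner_function_one by (intro exI[of _ "\<lambda>_. 1"]) auto

context blaschke_family
begin

lemma decreasing_le:
  assumes "i \<in> B" "k \<le> k'" shows "inner_dvd (\<phi> i k') (\<phi> i k)"
  using assms(2)
  by (induction k' rule: int_ge_induct)
    (auto intro: inner_dvd_refl inner_dvd_trans[OF decreasing[OF assms(1)]])

lemma Lambda_point:
  assumes "\<xi> \<in> Lambda \<phi>"
  obtains a where "\<And>i. cmod (a i) < 1" "\<And>i. prime_part (\<xi> i) = blaschke_factor (a i)" "support a \<noteq> {}"
proof -
  obtain k where k: "\<And>i. \<xi> i \<in> blaschke_parts (\<phi> i k)" using assms by (auto simp: Lambda_def)
  have "\<exists>b. cmod b < 1 \<and> prime_part (\<xi> i) = blaschke_factor b \<and> 0 < ord i k b" for i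
  proof -
    obtain b l where "cmod b < 1" "l \<ge> 1" "\<xi> i = (\<lambda>z. blaschke_factor b z ^ l)" "0 < zero_order (\<phi> i k) b"
      using blaschke_partsE[OF blaschke k] by blast
    then show ?thesis using prime_part_power[of b l] by (auto simp: ord_def)
  qed
  then obtain a where a: "\<And>i. cmod (a i) < 1" "\<And>i. prime_part (\<xi> i) = blaschke_factor (a i)"
    "\<And>i. 0 < ord i k (a i)" by metis
  interpret o: monotone_orders "\<lambda>i k. ord i k (a i)" A B by (rule monotone_orders_at[OF a(1)])
  have "k \<in> support a" using a(3) by (simp add: support_def o.support_def)
  then show thesis using that[of a] a by blast
qed

lemma point_Lambda:
  assumes a: "\<And>i. cmod (a i) < 1" and "support a \<noteq> {}"
  obtains \<xi> where "\<xi> \<in> Lambda \<phi>" "\<And>i. prime_part (\<xi> i) = blaschke_factor (a i)"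
proof -
  interpret o: monotone_orders "\<lambda>i k. ord i k (a i)" A B by (rule monotone_orders_at[OF a])
  obtain k where "k \<in> o.support" using assms(2) by (auto simp: support_def)
  then have pos: "0 < ord i k (a i)" for i by (simp add: o.support_def)
  have "\<exists>l\<ge>1. (\<lambda>z. blaschke_factor (a i) z ^ l) \<in> blaschke_parts (\<phi> i k)" for i
  proof -
    have "\<phi> i k (a i) = 0"
      using zero_order_factor(1)[OF inner_function_nonzero_holo[OF inner] a[of i]] pos[of i]
      by (simp add: ord_def)
    then show ?thesis using blaschke_parts_of_zero[OF blaschke a] by metis
  qed
  then obtain l where l: "\<And>i. l i \<ge> 1" "\<And>i. (\<lambda>z. blaschke_factor (a i) z ^ l i) \<in> blaschke_parts (\<phi> i k)"
    by metis
  show thesis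
  proof (rule that[of "\<lambda>i z. blaschke_factor (a i) z ^ l i"])
    show "(\<lambda>i z. blaschke_factor (a i) z ^ l i) \<in> Lambda \<phi>" using l(2) by (auto simp: Lambda_def)
    show "prime_part (\<lambda>z. blaschke_factor (a i) z ^ l i) = blaschke_factor (a i)" for i
      by (rule prime_part_power[OF a l(1)])
  qed
qed

context
  fixes \<xi> :: "'n \<Rightarrow> complex \<Rightarrow> complex" and a :: "'n \<Rightarrow> complex"
  assumes a: "\<And>i. cmod (a i) < 1" and prime: "\<And>i. prime_part (\<xi> i) = blaschke_factor (a i)"
begin

interpretation o: monotone_orders "\<lambda>i k. ord i k (a i)" A B by (rule monotone_orders_at[OF a])

lemma Z_set_eq: "Z_set \<phi> \<xi> = o.support"
  unfolding Z_set_def prime o.support_def unfolding ord_def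
  by (simp add: inner_dvd_factor_iff_order[OF inner a])

lemma I_set_eq: "I_set \<phi> A \<xi> = o.jumps"
proof -
  have "inner_dvd (blaschke_factor (a i)) (inner_quot (\<phi> i k) (\<phi> i (k - 1))) \<longleftrightarrow>
      ord i (k - 1) (a i) < ord i k (a i)" if "i \<in> A" for i k
  proof -
    have "inner_dvd (\<phi> i (k - 1)) (\<phi> i k)" using increasing[OF that, of "k - 1"] by simp
    from inner_dvd_quot_iff[OF this inner a[of i]] show ?thesis by (simp add: ord_def)
  qed
  then show ?thesis unfolding I_set_def Z_set_eq prime o.jumps_def by blast
qed

lemma Q_join_eq:
  assumes "K \<subseteq> o.support"
  shows "Q_join \<phi> \<xi> K = closed_cspan (poly_jordan a ` (\<Union>k\<in>K. o.box k))"
proof -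
  have "tensor_space (\<lambda>i. model_space (\<lambda>z. prime_part (\<xi> i) z ^ factor_order (\<phi> i k) (prime_part (\<xi> i))))
      = closed_cspan (poly_jordan a ` o.box k)" if k: "k \<in> K" for k
  proof -
    have pos: "1 \<le> ord i k (a i)" for i
    proof -
      have "k \<in> o.support" using assms k by blast
      then show ?thesis by (simp add: o.support_def Suc_le_eq)
    qed
    let ?G = "\<lambda>i. {jordan (cnj (a i)) j | j. j < ord i k (a i)}"
    have "tensor_space (\<lambda>i. model_space (\<lambda>z. prime_part (\<xi> i) z ^ factor_order (\<phi> i k) (prime_part (\<xi> i))))
        = closed_cspan {tensor g | g. \<forall>i. g i \<in> ?G i}"
    proof (rule tensor_space_closed_cspan)
      fix i
      show "model_space (\<lambda>z. prime_part (\<xi> i) z ^ factor_order (\<phi> i k) (prime_part (\<xi> i))) = closed_cspan (?G i)"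
        unfolding prime factor_order_blaschke_factor[OF a] ord_def[symmetric]
        by (rule model_space_blaschke_power[OF a pos])
    qed
    also have "{tensor g | g. \<forall>i. g i \<in> ?G i} = poly_jordan a ` o.box k"
    proof safe
      fix g assume "\<forall>i. g i \<in> ?G i"
      then have "\<forall>i. \<exists>j. g i = jordan (cnj (a i)) j \<and> j < ord i k (a i)" by simp
      then obtain \<beta> where \<beta>: "\<And>i. g i = jordan (cnj (a i)) (\<beta> i)" "\<And>i. \<beta> i < ord i k (a i)" by metis
      then have "tensor g = poly_jordan a \<beta>"
        unfolding poly_jordan_def by (intro arg_cong[where f = tensor] ext)
      then show "tensor g \<in> poly_jordan a ` o.box k" using \<beta>(2) by (auto simp: o.box_def)
    next
      fix \<beta> assume "\<beta> \<in> o.box k"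
      then show "\<exists>g. poly_jordan a \<beta> = tensor g \<and> (\<forall>i. g i \<in> ?G i)"
        unfolding poly_jordan_def o.box_def
        by (intro exI[of _ "\<lambda>i. jordan (cnj (a i)) (\<beta> i)"]) auto
    qed
    finally show ?thesis .
  qed
  then have "Q_join \<phi> \<xi> K = closed_cspan (\<Union>k\<in>K. closed_cspan (poly_jordan a ` o.box k))"
    unfolding Q_join_def by (intro arg_cong[where f = closed_cspan] SUP_cong) auto
  then show ?thesis unfolding closed_cspan_UN image_UN .
qed

text \<open>Jordan vectors are independent, even with respect to closed spans.\<close>
lemma Q_join_eq_iff:
  assumes "K \<subseteq> o.support"
  shows "Q_join \<phi> \<xi> (Z_set \<phi> \<xi>) = Q_join \<phi> \<xi> K \<longleftrightarrow> (\<Union>k\<in>K. o.box k) = (\<Union>k\<in>o.support. o.box k)"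
proof
  assume *: "Q_join \<phi> \<xi> (Z_set \<phi> \<xi>) = Q_join \<phi> \<xi> K"
  show "(\<Union>k\<in>K. o.box k) = (\<Union>k\<in>o.support. o.box k)"
  proof
    show "(\<Union>k\<in>o.support. o.box k) \<subseteq> (\<Union>k\<in>K. o.box k)"
    proof
      fix \<beta> assume "\<beta> \<in> (\<Union>k\<in>o.support. o.box k)"
      then have "poly_jordan a \<beta> \<in> closed_cspan (poly_jordan a ` (\<Union>k\<in>o.support. o.box k))"
        by (intro subsetD[OF closed_cspan_superset] imageI)
      also have "\<dots> = closed_cspan (poly_jordan a ` (\<Union>k\<in>K. o.box k))"
        using * Q_join_eq[OF assms] Q_join_eq[OF order_refl] by (simp add: Z_set_eq)
      finally show "\<beta> \<in> (\<Union>k\<in>K. o.box k)" by (rule poly_jordan_independent[OF a])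
    qed
  qed (use assms in blast)
next
  assume "(\<Union>k\<in>K. o.box k) = (\<Union>k\<in>o.support. o.box k)"
  then show "Q_join \<phi> \<xi> (Z_set \<phi> \<xi>) = Q_join \<phi> \<xi> K"
    using Q_join_eq[OF assms] Q_join_eq[OF order_refl] by (simp add: Z_set_eq)
qed

lemma card_Z_tilde: "card (Z_tilde \<phi> \<xi>) = card (peaks a)"
proof -
  have "(\<lambda>K. K \<subseteq> Z_set \<phi> \<xi> \<and> Q_join \<phi> \<xi> (Z_set \<phi> \<xi>) = Q_join \<phi> \<xi> K)
      = (\<lambda>K. K \<subseteq> o.support \<and> (\<Union>k\<in>K. o.box k) = (\<Union>k\<in>o.support. o.box k))"
  proof (intro ext conj_cong)
    fix K assume "K \<subseteq> o.support"
    then show "Q_join \<phi> \<xi> (Z_set \<phi> \<xi>) = Q_join \<phi> \<xi> K \<longleftrightarrow> (\<Union>k\<in>K. o.box k) = (\<Union>k\<in>o.support. o.box k)"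
      by (rule Q_join_eq_iff)
  qed (simp add: Z_set_eq)
  then show ?thesis unfolding Z_tilde_def peaks_def using o.card_minimal_cover by simp
qed

lemma card_Z_tilde_formula:
  assumes "support a \<noteq> {}"
  defines "ks \<equiv> sorted_list_of_set (I_set \<phi> A \<xi>)"
  shows "card (Z_tilde \<phi> \<xi>) = 1 + card {ks ! j | j. Suc j < length ks \<and>
    (\<exists>i\<in>B. inner_dvd (prime_part (\<xi> i)) (inner_quot (\<phi> i (ks ! j)) (\<phi> i (ks ! Suc j))))}"
proof -
  have ks: "ks = sorted_list_of_set o.jumps" by (simp add: ks_def I_set_eq)
  have "inner_dvd (prime_part (\<xi> i)) (inner_quot (\<phi> i (ks ! j)) (\<phi> i (ks ! Suc j))) \<longleftrightarrow>
      ord i (ks ! Suc j) (a i) < ord i (ks ! j) (a i)" if "Suc j < length ks" "i \<in> B" for i j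
  proof -
    have "ks ! j \<le> ks ! Suc j"
      using sorted_nth_mono[of ks j "Suc j"] that(1) by (simp add: ks_def)
    from inner_dvd_quot_iff[OF decreasing_le[OF that(2) this] inner a[of i]] show ?thesis
      by (simp add: prime ord_def)
  qed
  then have "{ks ! j | j. Suc j < length ks \<and>
      (\<exists>i\<in>B. inner_dvd (prime_part (\<xi> i)) (inner_quot (\<phi> i (ks ! j)) (\<phi> i (ks ! Suc j))))}
    = {ks ! j | j. Suc j < length ks \<and> (\<exists>i\<in>B. ord i (ks ! Suc j) (a i) < ord i (ks ! j) (a i))}"
    by blast
  then show ?thesis
    using o.card_peaks assms(1) unfolding card_Z_tilde ks peaks_def support_def by simp
qed

end

text \<open>The points \<open>a\<close> with nonempty support are exactly those coming from \<open>Lambda \<phi>\<close>, as every zero of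
  a Blaschke product occurs in each of its expansions.\<close>
lemma co_rank_eq_SUP: "co_rank (Q_Phi \<phi>) = (SUP \<xi>\<in>Lambda \<phi>. enat (card (Z_tilde \<phi> \<xi>)))"
proof (rule antisym)
  show "(SUP \<xi>\<in>Lambda \<phi>. enat (card (Z_tilde \<phi> \<xi>))) \<le> co_rank (Q_Phi \<phi>)"
  proof (rule SUP_least)
    fix \<xi> assume "\<xi> \<in> Lambda \<phi>"
    then obtain a where a: "\<And>i. cmod (a i) < 1" "\<And>i. prime_part (\<xi> i) = blaschke_factor (a i)"
      using Lambda_point by blast
    show "enat (card (Z_tilde \<phi> \<xi>)) \<le> co_rank (Q_Phi \<phi>)"
      unfolding card_Z_tilde[OF a] by (rule card_peaks_le_co_rank[OF a(1)])
  qed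
  show "co_rank (Q_Phi \<phi>) \<le> (SUP \<xi>\<in>Lambda \<phi>. enat (card (Z_tilde \<phi> \<xi>)))" (is "_ \<le> ?r")
  proof (cases ?r)
    case (enat r)
    have "co_rank (Q_Phi \<phi>) \<le> enat r"
    proof (rule co_rank_le)
      fix a assume a: "\<And>i. cmod (a i) < 1" "support a \<noteq> {}"
      obtain \<xi> where \<xi>: "\<xi> \<in> Lambda \<phi>" "\<And>i. prime_part (\<xi> i) = blaschke_factor (a i)"
        using point_Lambda[OF a] by blast
      have "enat (card (Z_tilde \<phi> \<xi>)) \<le> ?r" by (rule SUP_upper[OF \<xi>(1)])
      then show "card (peaks a) \<le> r" using card_Z_tilde[OF a(1) \<xi>(2)] enat by simp
    qed
    then show ?thesis using enat by simp
  qed simp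
qed

end

theorem theorem5p4:
  fixes \<phi> :: "'n::finite \<Rightarrow> int \<Rightarrow> complex \<Rightarrow> complex" and A B :: "'n set"
  assumes "CARD('n) \<ge> 2"
    and "A \<noteq> {}" and "A \<noteq> UNIV" and "B = UNIV - A"
    and "\<And>i k. blaschke_product (\<phi> i k)"
    and "\<And>i. \<not> (\<exists>\<psi>. inner_function \<psi> \<and> \<not> \<psi> constant_on ball 0 1 \<and> (\<forall>k. inner_dvd \<psi> (\<phi> i k)))"
    and "\<And>i k. i \<in> A \<Longrightarrow> inner_dvd (\<phi> i k) (\<phi> i (k + 1))"
    and "\<And>i k. i \<in> B \<Longrightarrow> inner_dvd (\<phi> i (k + 1)) (\<phi> i k)"
  shows "co_rank (Q_Phi \<phi>) = (SUP \<xi>\<in>Lambda \<phi>. enat (card (Z_tilde \<phi> \<xi>))) \<and>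
    (\<forall>\<xi>\<in>Lambda \<phi>. let ks = sorted_list_of_set (I_set \<phi> A \<xi>) in
       card (Z_tilde \<phi> \<xi>) = 1 + card {ks ! j | j. Suc j < length ks \<and>
         (\<exists>i\<in>B. inner_dvd (prime_part (\<xi> i)) (inner_quot (\<phi> i (ks ! j)) (\<phi> i (ks ! Suc j))))})"
proof -
  interpret blaschke_family \<phi> A B by unfold_locales (use assms in auto)
  show ?thesis
    unfolding Let_def
  proof (intro conjI ballI)
    show "co_rank (Q_Phi \<phi>) = (SUP \<xi>\<in>Lambda \<phi>. enat (card (Z_tilde \<phi> \<xi>)))" by (rule co_rank_eq_SUP)
    fix \<xi> assume "\<xi> \<in> Lambda \<phi>"
    then obtain a where a: "\<And>i. cmod (a i) < 1" "\<And>i. prime_part (\<xi> i) = blaschke_factor (a i)"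
      "support a \<noteq> {}" using Lambda_point by blast
    let ?ks = "sorted_list_of_set (I_set \<phi> A \<xi>)"
    show "card (Z_tilde \<phi> \<xi>) = 1 + card {?ks ! j | j. Suc j < length ?ks \<and>
        (\<exists>i\<in>B. inner_dvd (prime_part (\<xi> i)) (inner_quot (\<phi> i (?ks ! j)) (\<phi> i (?ks ! Suc j))))}"
      by (rule card_Z_tilde_formula[OF a])
  qed
qed

end
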